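(* Let $e$ be a nonzero nilpotent element of even depth $d$ in a semisimple Lie algebra $\mathfrak g$ over an algebraically closed field of characteristic $0$, and let $\mathfrak q\subset\mathfrak g$ be a reducing subalgebra for $e$. Then $e$ is of semisimple type in $\mathfrak g$ if and only if $e\in\mathfrak q$ and $e$ is of semisimple type in $\mathfrak q$.
   Context: $G$ is the connected simply connected group with Lie algebra $\mathfrak g$; $\mathfrak s=\{e,h,f\}$ is an $\mathfrak{sl}_2$-triple containing $e$; $\mathfrak g_j$ is the $j$-eigenspace of $\mathrm{ad}\,h$, and the depth $d$ is the largest $j$ with $\mathfrak g_j\ne 0$. A cyclic element associated with $e$ is $e+F$ with $0\ne F\in\mathfrak g_{-d}$; $e$ is of semisimple type if $e+F$ is semisimple for all $F$ in a nonempty Zariski open subset of $\mathfrak g_{-d}$. $Z(\mathfrak s)$ is the centralizer of $\mathfrak s$ in $G$. A reducing subalgebra for $e$ is a semisimple subalgebra $\mathfrak q\subset\mathfrak g$ with $[\mathfrak s,\mathfrak q]\subset\mathfrak q$ such that $Z(\mathfrak s)(\mathfrak q\cap\mathfrak g_{-d})$ is Zariski dense in $\mathfrak g_{-d}$. When $e\in\mathfrak q$, $\mathfrak s\subset\mathfrak q$ may be used to define the type of $e$ in $\mathfrak q$. *)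

theory Defs
  imports Main "HOL-Computational_Algebra.Polynomial"
begin

definition lie_alg :: "('a::field \<Rightarrow> 'v::ab_group_add \<Rightarrow> 'v) \<Rightarrow> ('v \<Rightarrow> 'v \<Rightarrow> 'v) \<Rightarrow> bool" where
  "lie_alg smul br \<longleftrightarrow> vector_space smul \<and>
     (\<forall>x y z. br (x + y) z = br x z + br y z) \<and>
     (\<forall>x y z. br x (y + z) = br x y + br x z) \<and>
     (\<forall>c x y. br (smul c x) y = smul c (br x y)) \<and>
     (\<forall>c x y. br x (smul c y) = smul c (br x y)) \<and>
     (\<forall>x. br x x = 0) \<and>
     (\<forall>x y z. br x (br y z) + br y (br z x) + br z (br x y) = 0)"

definition lin_span :: "('a::field \<Rightarrow> 'v::ab_group_add \<Rightarrow> 'v) \<Rightarrow> 'v set \<Rightarrow> 'v set" where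
  "lin_span smul S = {v. \<exists>F c. finite F \<and> F \<subseteq> S \<and> v = (\<Sum>x\<in>F. smul (c x) x)}"

definition fin_dim :: "('a::field \<Rightarrow> 'v::ab_group_add \<Rightarrow> 'v) \<Rightarrow> bool" where
  "fin_dim smul \<longleftrightarrow> (\<exists>S. finite S \<and> lin_span smul S = UNIV)"

definition subsp :: "('a::field \<Rightarrow> 'v::ab_group_add \<Rightarrow> 'v) \<Rightarrow> 'v set \<Rightarrow> bool" where
  "subsp smul L \<longleftrightarrow> 0 \<in> L \<and> (\<forall>x\<in>L. \<forall>y\<in>L. x + y \<in> L) \<and> (\<forall>c. \<forall>x\<in>L. smul c x \<in> L)"

definition lie_subalg :: "('a::field \<Rightarrow> 'v::ab_group_add \<Rightarrow> 'v) \<Rightarrow> ('v \<Rightarrow> 'v \<Rightarrow> 'v) \<Rightarrow> 'v set \<Rightarrow> bool" where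
  "lie_subalg smul br L \<longleftrightarrow> subsp smul L \<and> (\<forall>x\<in>L. \<forall>y\<in>L. br x y \<in> L)"

definition lie_ideal :: "('a::field \<Rightarrow> 'v::ab_group_add \<Rightarrow> 'v) \<Rightarrow> ('v \<Rightarrow> 'v \<Rightarrow> 'v) \<Rightarrow> 'v set \<Rightarrow> 'v set \<Rightarrow> bool" where
  "lie_ideal smul br L I \<longleftrightarrow> subsp smul I \<and> I \<subseteq> L \<and> (\<forall>x\<in>L. \<forall>y\<in>I. br x y \<in> I)"

fun derived :: "('a::field \<Rightarrow> 'v::ab_group_add \<Rightarrow> 'v) \<Rightarrow> ('v \<Rightarrow> 'v \<Rightarrow> 'v) \<Rightarrow> 'v set \<Rightarrow> nat \<Rightarrow> 'v set" where
  "derived smul br I 0 = I"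
| "derived smul br I (Suc n) =
     lin_span smul {br x y | x y. x \<in> derived smul br I n \<and> y \<in> derived smul br I n}"

definition solvable_lie :: "('a::field \<Rightarrow> 'v::ab_group_add \<Rightarrow> 'v) \<Rightarrow> ('v \<Rightarrow> 'v \<Rightarrow> 'v) \<Rightarrow> 'v set \<Rightarrow> bool" where
  "solvable_lie smul br I \<longleftrightarrow> (\<exists>n. derived smul br I n = {0})"

definition semisimple_lie :: "('a::field \<Rightarrow> 'v::ab_group_add \<Rightarrow> 'v) \<Rightarrow> ('v \<Rightarrow> 'v \<Rightarrow> 'v) \<Rightarrow> 'v set \<Rightarrow> bool" where
  "semisimple_lie smul br L \<longleftrightarrow> lie_subalg smul br L \<and>
     (\<forall>I. lie_ideal smul br L I \<and> solvable_lie smul br I \<longrightarrow> I = {0})"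

definition ad_nilpotent :: "('v::ab_group_add \<Rightarrow> 'v \<Rightarrow> 'v) \<Rightarrow> 'v set \<Rightarrow> 'v \<Rightarrow> bool" where
  "ad_nilpotent br L x \<longleftrightarrow> x \<in> L \<and> (\<exists>n. \<forall>y\<in>L. (br x ^^ n) y = 0)"

definition ad_semisimple :: "('a::field \<Rightarrow> 'v::ab_group_add \<Rightarrow> 'v) \<Rightarrow> ('v \<Rightarrow> 'v \<Rightarrow> 'v) \<Rightarrow> 'v set \<Rightarrow> 'v \<Rightarrow> bool" where
  "ad_semisimple smul br L x \<longleftrightarrow> x \<in> L \<and>
     L \<subseteq> lin_span smul {y \<in> L. \<exists>c. br x y = smul c y}"

definition sl2_triple :: "('a::field \<Rightarrow> 'v::ab_group_add \<Rightarrow> 'v) \<Rightarrow> ('v \<Rightarrow> 'v \<Rightarrow> 'v) \<Rightarrow> 'v set \<Rightarrow> 'v \<Rightarrow> 'v \<Rightarrow> 'v \<Rightarrow> bool" where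
  "sl2_triple smul br L e h f \<longleftrightarrow> e \<in> L \<and> h \<in> L \<and> f \<in> L \<and>
     br h e = smul 2 e \<and> br h f = smul (-2) f \<and> br e f = h"

definition grade :: "('a::field \<Rightarrow> 'v::ab_group_add \<Rightarrow> 'v) \<Rightarrow> ('v \<Rightarrow> 'v \<Rightarrow> 'v) \<Rightarrow> 'v set \<Rightarrow> 'v \<Rightarrow> int \<Rightarrow> 'v set" where
  "grade smul br L h j = {y \<in> L. br h y = smul (of_int j) y}"

definition depth :: "('a::field \<Rightarrow> 'v::ab_group_add \<Rightarrow> 'v) \<Rightarrow> ('v \<Rightarrow> 'v \<Rightarrow> 'v) \<Rightarrow> 'v set \<Rightarrow> 'v \<Rightarrow> int" where
  "depth smul br L h = (GREATEST j. grade smul br L h j \<noteq> {0})"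

inductive_set poly_fun :: "('a::field \<Rightarrow> 'v::ab_group_add \<Rightarrow> 'v) \<Rightarrow> ('v \<Rightarrow> 'a) set"
  for smul where
  pf_const: "(\<lambda>_. c) \<in> poly_fun smul"
| pf_lin: "(\<forall>x y. l (x + y) = l x + l y) \<Longrightarrow> (\<forall>c x. l (smul c x) = c * l x) \<Longrightarrow> l \<in> poly_fun smul"
| pf_add: "p \<in> poly_fun smul \<Longrightarrow> q \<in> poly_fun smul \<Longrightarrow> (\<lambda>x. p x + q x) \<in> poly_fun smul"
| pf_mult: "p \<in> poly_fun smul \<Longrightarrow> q \<in> poly_fun smul \<Longrightarrow> (\<lambda>x. p x * q x) \<in> poly_fun smul"

definition zclosed_in :: "('a::field \<Rightarrow> 'v::ab_group_add \<Rightarrow> 'v) \<Rightarrow> 'v set \<Rightarrow> 'v set \<Rightarrow> bool" where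
  "zclosed_in smul W Z \<longleftrightarrow> Z \<subseteq> W \<and>
     (\<exists>P. P \<subseteq> poly_fun smul \<and> Z = {w \<in> W. \<forall>p\<in>P. p w = 0})"

definition zopen_in :: "('a::field \<Rightarrow> 'v::ab_group_add \<Rightarrow> 'v) \<Rightarrow> 'v set \<Rightarrow> 'v set \<Rightarrow> bool" where
  "zopen_in smul W U \<longleftrightarrow> U \<subseteq> W \<and> zclosed_in smul W (W - U)"

definition zdense_in :: "('a::field \<Rightarrow> 'v::ab_group_add \<Rightarrow> 'v) \<Rightarrow> 'v set \<Rightarrow> 'v set \<Rightarrow> bool" where
  "zdense_in smul W X \<longleftrightarrow> X \<subseteq> W \<and> (\<forall>Z. zclosed_in smul W Z \<and> X \<subseteq> Z \<longrightarrow> Z = W)"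

definition ss_type_wrt :: "('a::field \<Rightarrow> 'v::ab_group_add \<Rightarrow> 'v) \<Rightarrow> ('v \<Rightarrow> 'v \<Rightarrow> 'v) \<Rightarrow> 'v set \<Rightarrow> 'v \<Rightarrow> 'v \<Rightarrow> 'v \<Rightarrow> bool" where
  "ss_type_wrt smul br L e h f \<longleftrightarrow>
     (let V = grade smul br L h (- depth smul br L h) in
      \<exists>U. U \<noteq> {} \<and> zopen_in smul V U \<and> (\<forall>F\<in>U. ad_semisimple smul br L (e + F)))"

definition ss_type :: "('a::field \<Rightarrow> 'v::ab_group_add \<Rightarrow> 'v) \<Rightarrow> ('v \<Rightarrow> 'v \<Rightarrow> 'v) \<Rightarrow> 'v set \<Rightarrow> 'v \<Rightarrow> bool" where
  "ss_type smul br L e \<longleftrightarrow> (\<exists>h f. sl2_triple smul br L e h f \<and> ss_type_wrt smul br L e h f)"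

text \<open>exp(ad x) for ad-nilpotent x, and the adjoint group Ad(G) = Int(L), generated by these.\<close>
definition nil_index :: "('v::ab_group_add \<Rightarrow> 'v \<Rightarrow> 'v) \<Rightarrow> 'v set \<Rightarrow> 'v \<Rightarrow> nat" where
  "nil_index br L x = (LEAST n. \<forall>y\<in>L. (br x ^^ n) y = 0)"

definition exp_ad :: "('a::field_char_0 \<Rightarrow> 'v::ab_group_add \<Rightarrow> 'v) \<Rightarrow> ('v \<Rightarrow> 'v \<Rightarrow> 'v) \<Rightarrow> 'v set \<Rightarrow> 'v \<Rightarrow> 'v \<Rightarrow> 'v" where
  "exp_ad smul br L x y = (\<Sum>k < nil_index br L x. smul (inverse (of_nat (fact k))) ((br x ^^ k) y))"

inductive_set adj_group :: "('a::field_char_0 \<Rightarrow> 'v::ab_group_add \<Rightarrow> 'v) \<Rightarrow> ('v \<Rightarrow> 'v \<Rightarrow> 'v) \<Rightarrow> 'v set \<Rightarrow> ('v \<Rightarrow> 'v) set"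
  for smul br L where
  ag_id: "id \<in> adj_group smul br L"
| ag_exp: "ad_nilpotent br L x \<Longrightarrow> \<phi> \<in> adj_group smul br L \<Longrightarrow> (exp_ad smul br L x \<circ> \<phi>) \<in> adj_group smul br L"

text \<open>Image of Z(s) in GL(g) under the adjoint representation.\<close>
definition centralizer_triple :: "('a::field_char_0 \<Rightarrow> 'v::ab_group_add \<Rightarrow> 'v) \<Rightarrow> ('v \<Rightarrow> 'v \<Rightarrow> 'v) \<Rightarrow> 'v set \<Rightarrow> 'v \<Rightarrow> 'v \<Rightarrow> 'v \<Rightarrow> ('v \<Rightarrow> 'v) set" where
  "centralizer_triple smul br L e h f = {\<phi> \<in> adj_group smul br L. \<phi> e = e \<and> \<phi> h = h \<and> \<phi> f = f}"

definition reducing :: "('a::field_char_0 \<Rightarrow> 'v::ab_group_add \<Rightarrow> 'v) \<Rightarrow> ('v \<Rightarrow> 'v \<Rightarrow> 'v) \<Rightarrow> 'v \<Rightarrow> 'v \<Rightarrow> 'v \<Rightarrow> 'v set \<Rightarrow> bool" where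
  "reducing smul br e h f q \<longleftrightarrow>
     semisimple_lie smul br q \<and> (\<forall>x\<in>{e, h, f}. \<forall>y\<in>q. br x y \<in> q) \<and>
     (let V = grade smul br UNIV h (- depth smul br UNIV h) in
       zdense_in smul V {\<phi> y | \<phi> y. \<phi> \<in> centralizer_triple smul br UNIV e h f \<and> y \<in> q \<inter> V})"

end

theory Submission
  imports Defs "Jordan_Normal_Form.Determinant"
begin

text \<open>
If \<open>s\<close> normalizes \<open>q\<close>, every element of \<open>s\<close> is the sum of an element of \<open>q\<close> and one commuting with
\<open>q\<close>, because the trace form of \<open>g\<close> is nondegenerate on \<open>q\<close> (Cartan's criterion and Engel's theorem).
Write \<open>e = e' + e''\<close> accordingly. The key point is that for \<open>F\<close> in \<open>q \<inter> g\<^sub>-\<^sub>d\<close> the element \<open>e' + F\<close> is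
semisimple on \<open>g\<close> as soon as it is semisimple on \<open>q\<close>. The nilpotent part of its adjoint action commutes
with the grading given by the \<open>q\<close>-component of \<open>h\<close>, yet is homogeneous of degree \<open>2\<close> modulo \<open>d + 2\<close>.
Hence, if \<open>e + F\<close> is semisimple, so is \<open>e''\<close>; being also nilpotent, it vanishes, and \<open>e\<close> lies in \<open>q\<close>.
Conversely, if \<open>e\<close> is of semisimple type in \<open>q\<close>, translating by \<open>Z(s)\<close> the elements \<open>F\<close> of \<open>q\<close> with
\<open>e + F\<close> semisimple gives a dense set in \<open>g\<^sub>-\<^sub>d\<close>, and such a set contains the
nonvanishing locus of a polynomial, namely the Hankel determinant of the traces of the powers of
\<open>ad (e + F)\<close>. Since the type of \<open>e\<close> allows an arbitrary sl2-triple, one also needs that sl2-triples with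
the same \<open>e\<close> are conjugate.
\<close>

text \<open>In the key step \<open>e'\<close> has degree 2 and \<open>F\<close> has degree -d, which
  agree modulo d + 2, while the nilpotent part is a derivation killing the q-component
  \<open>h'\<close> of \<open>h\<close> and so has degree 0. A root of unity z with z^(d+2) = 1 and
  z^2 \<noteq> 1 makes the two degrees clash. This requires ad \<open>h'\<close> to be
  diagonalizable with integer eigenvalues on all of g, not only on q. Hence sl2-triples are studied
  through their action on the whole space, by generalized eigenspaces instead of complete
  reducibility, and the trace form is always taken over g and then restricted to q. In the converse
  the translated set is dense but need not be open. Let m be the largest number of eigenvalues of
  \<open>ad (e + F)\<close> for F in the dense set. Having at least m eigenvalues is forced by a
  nonzero Hankel determinant, an open condition. Being annihilated by a polynomial of degree at most
  m, with coefficients polynomial in F, is a closed condition and spreads from the dense set to the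
  whole space. Together they force m simple roots, that is, semisimplicity.\<close>

locale fd_vs = finite_dimensional_vector_space scale Basis
  for scale :: "'a::field_char_0 \<Rightarrow> 'v::ab_group_add \<Rightarrow> 'v" (infixr "*s" 75) and Basis +
  assumes alg_closed: "\<And>p :: 'a poly. degree p > 0 \<Longrightarrow> \<exists>x. poly p x = 0"
begin

section \<open>Linear endomorphisms and their powers\<close>

abbreviation endo :: "('v \<Rightarrow> 'v) \<Rightarrow> bool" where
  "endo \<equiv> Vector_Spaces.linear (*s) (*s)"

lemma endoI:
  assumes "\<And>x y. T (x + y) = T x + T y" "\<And>c x. T (c *s x) = c *s T x"
  shows "endo T"
  unfolding Vector_Spaces.linear_iff using assms vector_space_axioms by auto

lemma endo_add: "endo T \<Longrightarrow> T (x + y) = T x + T y"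
  and endo_scale: "endo T \<Longrightarrow> T (c *s x) = c *s T x"
  by (auto simp: Vector_Spaces.linear_iff)

lemma endo_0: "endo T \<Longrightarrow> T 0 = 0"
  using endo_scale[of T 0 0] by simp

lemma endo_minus: "endo T \<Longrightarrow> T (- x) = - T x"
  using endo_scale[of T "-1" x] by simp

lemma endo_diff: "endo T \<Longrightarrow> T (x - y) = T x - T y"
  using endo_add[of T x "-y"] endo_minus[of T y] by simp

lemma endo_sum: "endo T \<Longrightarrow> T (sum g A) = (\<Sum>i\<in>A. T (g i))"
  by (induction A rule: infinite_finite_induct) (auto simp: endo_0 endo_add)

lemma endo_funpow: "endo T \<Longrightarrow> endo (T ^^ n)"
proof (induction n)
  case 0
  show ?case by (rule endoI) auto
next
  case (Suc n)
  then show ?case by (intro endoI) (simp_all add: endo_add endo_scale)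
qed

lemma endo_comp: "endo S \<Longrightarrow> endo T \<Longrightarrow> endo (\<lambda>v. S (T v))"
  by (intro endoI) (simp_all add: endo_add endo_scale)

lemma endo_subtract: "endo S \<Longrightarrow> endo T \<Longrightarrow> endo (\<lambda>v. S v - T v)"
  by (intro endoI) (simp_all add: endo_add endo_scale scale_right_diff_distrib)

lemma endo_plus: "endo S \<Longrightarrow> endo T \<Longrightarrow> endo (\<lambda>v. S v + T v)"
  by (intro endoI) (simp_all add: endo_add endo_scale scale_right_distrib)

lemma endo_smult: "endo T \<Longrightarrow> endo (\<lambda>v. c *s T v)"
  by (intro endoI) (simp_all add: endo_add endo_scale scale_right_distrib)

lemma endo_zero: "endo (\<lambda>v. 0)" and endo_ident: "endo (\<lambda>v. v)"
  by (rule endoI; simp)+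

lemma endo_sum_fun: "(\<And>i. i \<in> A \<Longrightarrow> endo (T i)) \<Longrightarrow> endo (\<lambda>v. \<Sum>i\<in>A. T i v)"
  by (induction A rule: infinite_finite_induct) (auto simp: endo_zero endo_plus)

lemma funpow_commute:
  assumes "\<And>v. A (T v) = T (A v)"
  shows "A ((T ^^ n) v) = (T ^^ n) (A v)"
  by (induction n) (simp_all add: assms)

lemma funpow_0_mono:
  assumes "endo T" "(T ^^ m) v = 0" "m \<le> n"
  shows "(T ^^ n) v = 0"
proof -
  have "(T ^^ n) v = (T ^^ (n - m)) ((T ^^ m) v)"
    using assms(3) by (metis comp_apply funpow_add le_add_diff_inverse2)
  then show ?thesis using assms by (simp add: endo_0 endo_funpow)
qed

lemma eigen_funpow: "endo A \<Longrightarrow> A u = c *s u \<Longrightarrow> (A ^^ n) u = c ^ n *s u"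
  by (induction n) (auto simp: endo_scale)

lemma endo_eq_0_on_span:
  assumes "endo T" "\<And>v. v \<in> S \<Longrightarrow> T v = 0" "v \<in> span S"
  shows "T v = 0"
  using assms(3)
  by (induction rule: span_induct_alt)
     (use assms in \<open>auto simp: endo_0 endo_add endo_scale\<close>)

section \<open>Polynomials in an endomorphism\<close>

definition papp :: "'a poly \<Rightarrow> ('v \<Rightarrow> 'v) \<Rightarrow> 'v \<Rightarrow> 'v" where
  "papp p T v = (\<Sum>i\<le>degree p. coeff p i *s (T ^^ i) v)"

lemma papp_ge: "degree p \<le> n \<Longrightarrow> papp p T v = (\<Sum>i\<le>n. coeff p i *s (T ^^ i) v)"
  unfolding papp_def
  by (rule sum.mono_neutral_left) (auto simp: coeff_eq_0)

lemma papp_0[simp]: "papp 0 T v = 0"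
  by (simp add: papp_def)

lemma papp_add: "papp (p + q) T v = papp p T v + papp q T v"
proof -
  let ?n = "max (degree p) (degree q)"
  have "degree (p + q) \<le> ?n" by (simp add: degree_add_le)
  then show ?thesis
    by (simp add: papp_ge[of p ?n] papp_ge[of q ?n] papp_ge[of "p + q" ?n]
        scale_left_distrib sum.distrib)
qed

lemma papp_smult: "papp (Polynomial.smult c p) T v = c *s papp p T v"
  by (simp add: papp_ge[of "Polynomial.smult c p" "degree p"] papp_def scale_sum_right)

lemma papp_pCons:
  assumes "endo T"
  shows "papp (pCons a p) T v = a *s v + T (papp p T v)"
proof -
  have "papp (pCons a p) T v = (\<Sum>i\<le>Suc (degree p). coeff (pCons a p) i *s (T ^^ i) v)"
    by (rule papp_ge) (simp add: degree_pCons_le)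
  also have "\<dots> = a *s v + (\<Sum>i\<le>degree p. coeff p i *s T ((T ^^ i) v))"
    by (simp add: sum.atMost_Suc_shift del: sum.atMost_Suc)
  finally show ?thesis
    using assms by (simp add: papp_def endo_sum endo_scale)
qed

lemma papp_endo: "endo T \<Longrightarrow> endo (papp p T)"
  unfolding papp_def by (intro endo_sum_fun endo_smult endo_funpow)

lemma papp_mult:
  assumes "endo T"
  shows "papp (p * q) T v = papp p T (papp q T v)"
  by (induction p)
     (simp_all add: papp_add papp_smult papp_pCons assms)

lemma papp_commute: "papp p T (papp q T v) = papp q T (papp p T v)" if "endo T"
  by (metis papp_mult that mult.commute)

lemma papp_eigen:
  assumes "endo T" "T v = l *s v"
  shows "papp p T v = poly p l *s v"
  by (induction p) (simp_all add: papp_pCons assms endo_scale scale_left_distrib)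

lemma papp_monom: "endo T \<Longrightarrow> papp (Polynomial.monom c n) T v = c *s (T ^^ n) v"
proof (induction n arbitrary: c)
  case 0
  then show ?case by (simp add: papp_def monom_0)
next
  case (Suc n)
  then show ?case by (simp add: monom_Suc papp_pCons endo_scale)
qed

lemma papp_1 [simp]: "papp 1 T v = v"
  by (simp add: papp_def)

definition shift :: "('v \<Rightarrow> 'v) \<Rightarrow> 'a \<Rightarrow> 'v \<Rightarrow> 'v" where
  "shift T l v = T v - l *s v"

lemma shift_endo: "endo T \<Longrightarrow> endo (shift T l)"
  unfolding shift_def by (intro endo_subtract endo_smult endo_ident)

lemma papp_linear_factor: "endo T \<Longrightarrow> papp [:-l, 1:] T v = shift T l v"
  by (simp add: papp_pCons shift_def endo_0)

lemma papp_linear_factor_power: "endo T \<Longrightarrow> papp ([:-l, 1:] ^ n) T v = (shift T l ^^ n) v"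
  by (induction n) (simp_all add: papp_mult papp_linear_factor del: mult_pCons_left)

text \<open>Among \<open>dimension + 1\<close> powers of \<open>T\<close> applied to
  \<open>v\<close> there is a linear relation. The decomposition into generalized eigenspaces works
  vector by vector, so a polynomial depending on \<open>v\<close> is enough.\<close>

lemma annihilating_poly:
  assumes "endo T"
  shows "\<exists>p. p \<noteq> 0 \<and> papp p T v = 0"
\<comment> \<open>Linear dependence is a property of sets, so coinciding powers, which collapse in
  the image, form a case of their own.\<close>
proof (cases "inj_on (\<lambda>i. (T ^^ i) v) {..dimension}")
  case False
  then obtain i j where ij: "i \<noteq> j" "(T ^^ i) v = (T ^^ j) v"
    by (auto simp: inj_on_def)
  let ?p = "Polynomial.monom 1 i + Polynomial.monom (-1) j :: 'a poly"
  have "coeff ?p i = 1" using ij by simp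
  then have "?p \<noteq> 0" by (metis coeff_0 zero_neq_one)
  moreover have "papp ?p T v = 0"
    using assms ij by (simp add: papp_add papp_monom)
  ultimately show ?thesis by blast
next
  case True
  let ?S = "(\<lambda>i. (T ^^ i) v) ` {..dimension}"
  have "card ?S = Suc dimension" using True by (simp add: card_image)
  moreover have "independent ?S \<Longrightarrow> card ?S \<le> dimension"
    using independent_card_le_dim[of ?S UNIV] by (simp add: dimension_def)
  ultimately have "dependent ?S" by auto
  then obtain u where u: "\<exists>w\<in>?S. u w \<noteq> 0" "(\<Sum>w\<in>?S. u w *s w) = 0"
    using dependent_finite[of ?S] by auto
  let ?p = "\<Sum>i\<le>dimension. Polynomial.monom (u ((T ^^ i) v)) i"
  have c: "coeff ?p i = (if i \<le> dimension then u ((T ^^ i) v) else 0)" for i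
    by (simp add: coeff_sum coeff_monom if_distrib cong: if_cong)
  have "?p \<noteq> 0"
  proof
    assume "?p = 0"
    then have "\<And>i. i \<le> dimension \<Longrightarrow> u ((T ^^ i) v) = 0" by (metis c coeff_0)
    then show False using u(1) by auto
  qed
  moreover have "papp ?p T v = (\<Sum>i\<le>dimension. u ((T ^^ i) v) *s (T ^^ i) v)"
  proof -
    have "degree ?p \<le> dimension" by (rule degree_le) (use c in auto)
    then show ?thesis by (simp add: papp_ge c)
  qed
  moreover have "\<dots> = 0"
    using u(2) True by (simp add: sum.reindex)
  ultimately show ?thesis by metis
qed

section \<open>Generalized eigenspaces\<close>

definition GE :: "('v \<Rightarrow> 'v) \<Rightarrow> 'a \<Rightarrow> 'v set" where
  "GE T l = {v. \<exists>n. (shift T l ^^ n) v = 0}"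

lemma GE_subspace: "endo T \<Longrightarrow> subspace (GE T l)"
proof (rule subspaceI)
  assume T: "endo T"
  note s = shift_endo[OF T, of l] and p = endo_funpow[OF shift_endo[OF T, of l]]
  show "0 \<in> GE T l" by (auto simp: GE_def intro: exI[of _ 0])
  show "c *s x \<in> GE T l" if "x \<in> GE T l" for c x
    using that by (auto simp: GE_def endo_scale[OF p])
  show "x + y \<in> GE T l" if "x \<in> GE T l" "y \<in> GE T l" for x y
  proof -
    obtain m n where "(shift T l ^^ m) x = 0" "(shift T l ^^ n) y = 0"
      using \<open>x \<in> _\<close> \<open>y \<in> _\<close> by (auto simp: GE_def)
    then have "(shift T l ^^ (max m n)) (x + y) = 0"
      using funpow_0_mono[OF s] by (simp add: endo_add[OF p])
    then show ?thesis by (auto simp: GE_def)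
  qed
qed

lemma GE_0: "endo T \<Longrightarrow> 0 \<in> GE T l"
  by (simp add: GE_subspace subspace_0)

lemma eigen_GE: "T v = l *s v \<Longrightarrow> v \<in> GE T l"
  by (auto simp: GE_def shift_def intro!: exI[of _ "Suc 0"])

lemma GE_commute:
  assumes "endo T" "endo A" "\<And>v. A (T v) = T (A v)" "v \<in> GE T l"
  shows "A v \<in> GE T l"
proof -
  obtain n where n: "(shift T l ^^ n) v = 0" using assms by (auto simp: GE_def)
  have "A (shift T l v) = shift T l (A v)" for v
    using assms by (simp add: shift_def endo_diff endo_scale)
  then have "(shift T l ^^ n) (A v) = A ((shift T l ^^ n) v)"
    by (rule funpow_commute[of A "shift T l", symmetric])
  then show ?thesis using n assms by (auto simp: GE_def endo_0)
qed

lemma GE_stable: "endo T \<Longrightarrow> v \<in> GE T l \<Longrightarrow> T v \<in> GE T l"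
  by (rule GE_commute[of T T]) auto

lemma GE_shift: "endo T \<Longrightarrow> shift T l v \<in> GE T l \<Longrightarrow> v \<in> GE T l"
  unfolding GE_def by (auto simp: funpow_swap1[symmetric] intro: exI[of _ "Suc _"])

text \<open>Source of extremal vectors: eigenvectors inside generalized eigenspaces, and vectors
  killed by \<open>e\<close> or \<open>f\<close> in sl2-actions.\<close>

lemma funpow_last_nonzero:
  assumes "(A ^^ n) v = 0" "(v::'v) \<noteq> 0"
  obtains k where "(A ^^ k) v \<noteq> 0" "A ((A ^^ k) v) = 0"
proof -
  define m where "m = (LEAST n. (A ^^ n) v = 0)"
  have m: "(A ^^ m) v = 0" unfolding m_def using assms(1) by (rule LeastI)
  then obtain k where k: "m = Suc k" using assms(2) by (cases m) auto
  have "(A ^^ k) v \<noteq> 0" using not_less_Least[of k "\<lambda>n. (A ^^ n) v = 0"] k m_def by auto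
  then show ?thesis using m k that by simp
qed

lemma GE_eigenvector:
  assumes "endo T" "v \<in> GE T l" "v \<noteq> 0"
  obtains k where "(shift T l ^^ k) v \<noteq> 0" "T ((shift T l ^^ k) v) = l *s (shift T l ^^ k) v"
proof -
  obtain n where "(shift T l ^^ n) v = 0" using assms by (auto simp: GE_def)
  then obtain k where "(shift T l ^^ k) v \<noteq> 0" "shift T l ((shift T l ^^ k) v) = 0"
    using assms(3) by (rule funpow_last_nonzero)
  then show ?thesis by (intro that[of k]) (auto simp: shift_def)
qed

text \<open>An eigenvector for \<open>l\<close> derived from \<open>v\<close> stays in
  \<open>GE T m\<close>, but \<open>T - m\<close> multiplies it by the nonzero scalar
  \<open>l - m\<close>.\<close>

lemma GE_inter:
  assumes "endo T" "v \<in> GE T l" "v \<in> GE T m" "l \<noteq> m"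
  shows "v = 0"
proof (rule ccontr)
  assume "v \<noteq> 0"
  with assms obtain k where
    k: "(shift T l ^^ k) v \<noteq> 0" "T ((shift T l ^^ k) v) = l *s (shift T l ^^ k) v" 
    using GE_eigenvector by blast
  let ?u = "(shift T l ^^ k) v"
  have "T (shift T l v) = shift T l (T v)" for v
    using assms by (simp add: shift_def endo_diff endo_scale)
  then have "(shift T l ^^ k) (T v) = T ((shift T l ^^ k) v)" for v
    by (rule funpow_commute[of T "shift T l", symmetric])
  then have "?u \<in> GE T m"
    by (rule GE_commute[OF assms(1) endo_funpow[OF shift_endo[OF assms(1)]] _ assms(3)])
  then obtain n where "(shift T m ^^ n) ?u = 0" by (auto simp: GE_def)
  moreover have "shift T m ?u = (l - m) *s ?u"
    using k(2) by (simp add: shift_def scale_left_diff_distrib)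
  then have "(shift T m ^^ n) ?u = (l - m) ^ n *s ?u"
    by (rule eigen_funpow[OF shift_endo[OF assms(1)]])
  ultimately show False using k assms by simp
qed

text \<open>A power of \<open>T - m\<close> kills the summand for \<open>m\<close> and keeps the
  others in their generalized eigenspaces. By induction it kills these as well, so each of them lies
  in two generalized eigenspaces at once.\<close>

lemma GE_independent:
  assumes "endo T" "finite F" "\<And>l. l \<in> F \<Longrightarrow> c l \<in> GE T l" "(\<Sum>l\<in>F. c l) = 0" "l \<in> F"
  shows "c l = 0"
  using assms(2-)
proof (induction F arbitrary: c l rule: finite_induct)
  case (insert m F)
  obtain n where n: "(shift T m ^^ n) (c m) = 0"
    using insert.prems(1)[of m] by (auto simp: GE_def)
  let ?A = "shift T m ^^ n"
  have eA: "endo ?A" by (intro endo_funpow shift_endo assms)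
  have "T (shift T m v) = shift T m (T v)" for v
    using assms by (simp add: shift_def endo_diff endo_scale)
  then have com: "?A (T v) = T (?A v)" for v
    by (rule funpow_commute[of T "shift T m", symmetric])
  have "0 = ?A (\<Sum>l\<in>insert m F. c l)" by (simp only: insert.prems(2) endo_0[OF eA])
  also have "\<dots> = ?A (c m) + (\<Sum>l\<in>F. ?A (c l))"
    by (simp only: sum.insert[OF insert.hyps] endo_add[OF eA] endo_sum[OF eA])
  finally have s: "(\<Sum>l\<in>F. ?A (c l)) = 0" using n by simp
  have "?A (c l) \<in> GE T l" if "l \<in> F" for l
    using GE_commute[OF assms(1) eA com, of "c l" l] insert.prems(1)[of l] that by blast
  then have z: "?A (c l) = 0" if "l \<in> F" for l
    using insert.IH[OF _ s that] by blast
  have cF: "c l = 0" if "l \<in> F" for l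
  proof (rule GE_inter[OF assms(1)])
    show "c l \<in> GE T m" using z[OF that] unfolding GE_def by blast
    show "c l \<in> GE T l" using insert.prems(1) that by auto
    show "m \<noteq> l" using insert.hyps that by auto
  qed
  then have "(\<Sum>l\<in>F. c l) = 0" by (intro sum.neutral) blast
  then have "c m = 0" using insert.prems(2) insert.hyps by simp
  then show ?case using cF insert.prems(3) by auto
qed auto

definition gspec :: "('v \<Rightarrow> 'v) \<Rightarrow> 'a set" where
  "gspec T = {l. GE T l \<noteq> {0}}"

lemma gspec_witness:
  assumes "endo T" "l \<in> gspec T"
  obtains v where "v \<in> GE T l" "v \<noteq> 0"
  using assms(2) GE_0[OF assms(1), of l] unfolding gspec_def by blast

lemma card_eigenvalues_le_dimension:
  assumes F: "finite F" "endo T" "\<And>l. l \<in> F \<Longrightarrow> w l \<noteq> 0 \<and> w l \<in> GE T l"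
  shows "card F \<le> dimension"
proof -
  have inj: "inj_on w F"
    by (rule inj_onI) (metis F(2,3) GE_inter)
  have "independent (w ` F)"
  proof (rule independent_if_scalars_zero)
    fix f x assume s: "(\<Sum>x\<in>w ` F. f x *s x) = 0" and "x \<in> w ` F"
    then obtain l where l: "l \<in> F" "x = w l" by blast
    have "(\<Sum>l\<in>F. f (w l) *s w l) = 0" using s by (simp add: sum.reindex[OF inj])
    moreover have "f (w l) *s w l \<in> GE T l" if "l \<in> F" for l
      using F(3)[OF that] GE_subspace[OF F(2)] by (simp add: subspace_scale)
    ultimately have "f (w l) *s w l = 0"
      using GE_independent[OF F(2,1), of "\<lambda>l. f (w l) *s w l"] l(1) by blast
    then show "f x = 0" using l F(3) by simp
  qed (use F in simp)
  then show ?thesis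
    using independent_card_le_dim[of "w ` F" UNIV] inj by (simp add: card_image dimension_def)
qed

lemma finite_gspec:
  assumes "endo T" shows "finite (gspec T)"
proof (rule ccontr)
  assume "infinite (gspec T)"
  then obtain F where F: "finite F" "card F = Suc dimension" "F \<subseteq> gspec T"
    using infinite_arbitrarily_large by blast
  have "\<exists>w. w \<noteq> 0 \<and> w \<in> GE T l" if "l \<in> F" for l
    using gspec_witness[OF assms subsetD[OF F(3) that]] by metis
  then obtain w where "\<And>l. l \<in> F \<Longrightarrow> w l \<noteq> 0 \<and> w l \<in> GE T l" by metis
  from card_eigenvalues_le_dimension[OF F(1) assms this] F(2) show False by simp
qed

text \<open>\<open>T - l\<close> is invertible on \<open>GE T m\<close>. Keeping the solution in the
  stable subspace \<open>Q\<close> allows \<open>Q\<close> to be decomposed without restricting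
  \<open>T\<close> to it.\<close>

lemma shift_solve:
  assumes T: "endo T" and "l \<noteq> m" and Q: "subspace Q" "\<And>v. v \<in> Q \<Longrightarrow> T v \<in> Q"
    and "(shift T m ^^ n) x = 0" "x \<in> Q"
  shows "\<exists>y \<in> Q \<inter> GE T m. shift T l y = x"
  using assms(5-)
proof (induction n arbitrary: x)
  case 0
  then have "x = 0" by simp
  moreover have "shift T l 0 = 0" by (rule endo_0[OF shift_endo[OF T]])
  ultimately show ?case
    using subspace_0[OF Q(1)] GE_0[OF T] by blast
next
  case (Suc n)
  have "(shift T m ^^ n) (shift T m x) = 0" using Suc.prems(1) by (simp add: funpow_swap1)
  moreover have "shift T m x \<in> Q"
    unfolding shift_def using Suc.prems(2) by (intro subspace_diff subspace_scale Q)
  ultimately obtain y where y: "y \<in> Q" "y \<in> GE T m" "shift T l y = shift T m x"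
    using Suc.IH by blast
  \<comment> \<open>Subtracting \<open>(T - l) y = (T - m) x\<close> from \<open>(T - l) x\<close>
    leaves \<open>(m - l) x\<close>.\<close>
  let ?z = "inverse (m - l) *s (x - y)"
  have "x \<in> GE T m" using Suc.prems(1) unfolding GE_def by blast
  then have "?z \<in> Q \<inter> GE T m"
    using y(1,2) Suc.prems(2) Q(1) GE_subspace[OF T] by (intro IntI subspace_scale subspace_diff)
  moreover have "shift T l (x - y) = shift T l x - shift T m x"
    by (simp only: endo_diff[OF shift_endo[OF T]] y(3))
  then have "shift T l (x - y) = (m - l) *s x"
    by (simp add: shift_def scale_left_diff_distrib)
  then have "shift T l ?z = x"
    using \<open>l \<noteq> m\<close> by (simp add: endo_scale[OF shift_endo[OF T]])
  ultimately show ?case by blast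
qed

text \<open>The components are confined to \<open>Q\<close>; this is what later makes the
  projections preserve every stable subspace.\<close>

definition decomposes :: "('v \<Rightarrow> 'v) \<Rightarrow> 'v set \<Rightarrow> 'v \<Rightarrow> bool" where
  "decomposes T Q v \<longleftrightarrow> (\<exists>c. (\<forall>l. c l \<in> Q \<inter> GE T l) \<and> v = (\<Sum>l\<in>gspec T. c l))"

lemma decomposes_add:
  assumes "endo T" "subspace Q" "decomposes T Q u" "decomposes T Q v"
  shows "decomposes T Q (u + v)"
proof -
  from assms obtain c d where
    "\<forall>l. c l \<in> Q \<inter> GE T l" "u = (\<Sum>l\<in>gspec T. c l)" "\<forall>l. d l \<in> Q \<inter> GE T l" "v = (\<Sum>l\<in>gspec T. d l)"
    by (auto simp: decomposes_def)
  then show ?thesis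
    unfolding decomposes_def using assms GE_subspace[OF assms(1)]
    by (intro exI[of _ "\<lambda>l. c l + d l"]) (auto simp: sum.distrib subspace_add)
qed

lemma decomposes_GE:
  assumes "endo T" "subspace Q" "v \<in> Q" "v \<in> GE T m"
  shows "decomposes T Q v"
proof (cases "v = 0")
  case True
  then show ?thesis unfolding decomposes_def using assms
    by (intro exI[of _ "\<lambda>_. 0"]) (auto simp: subspace_0 GE_0)
next
  case False
  then have "m \<in> gspec T" using assms by (auto simp: gspec_def)
  then show ?thesis unfolding decomposes_def using assms finite_gspec
    by (intro exI[of _ "\<lambda>l. if l = m then v else 0"]) (auto simp: subspace_0 GE_0 sum.delta)
qed

lemma decomposes_sum:
  assumes "endo T" "subspace Q" "\<And>i. i \<in> A \<Longrightarrow> decomposes T Q (g i)"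
  shows "decomposes T Q (sum g A)"
  using assms(3)
proof (induction A rule: infinite_finite_induct)
  case (insert x F)
  then show ?case by (simp add: decomposes_add assms)
qed (use decomposes_GE[OF assms(1,2), of 0] assms in \<open>auto simp: subspace_0 GE_0\<close>)

text \<open>Induction on the degree of a polynomial annihilating \<open>v\<close>: split off a
  factor \<open>T - l\<close>, decompose \<open>(T - l) v\<close>, and lift every component with
  eigenvalue other than \<open>l\<close> through \<open>T - l\<close>. What then remains of
  \<open>v\<close> is killed by a power of \<open>T - l\<close>.\<close>

lemma GE_decomposition:
  assumes T: "endo T" and Q: "subspace Q" "\<And>v. v \<in> Q \<Longrightarrow> T v \<in> Q" and v: "v \<in> Q"
  shows "decomposes T Q v"
proof -
  have "decomposes T Q v" if "p \<noteq> 0" "papp p T v = 0" "v \<in> Q" for p v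
    using that
  proof (induction "degree p" arbitrary: p v rule: less_induct)
    case less
    show ?case
    proof (cases "degree p = 0")
      case True
      then obtain a where a: "p = [:a:]" by (metis degree_eq_zeroE)
      then have "v = 0" using less.prems T by (simp add: papp_pCons endo_0)
      then show ?thesis using decomposes_GE[OF T Q(1)] less.prems GE_0[OF T] by blast
    next
      case False
      then obtain l where "poly p l = 0" using alg_closed by blast
      then obtain r where r: "p = [:-l, 1:] * r" by (metis dvdE poly_eq_0_iff_dvd)
      then have r0: "r \<noteq> 0" using less.prems by auto
      then have "degree r < degree p" unfolding r by (subst degree_mult_eq) auto
      moreover have "papp r T (shift T l v) = 0"
        using less.prems(2) by (simp only: r mult.commute[of _ r] papp_mult[OF T] papp_linear_factor[OF T])
      moreover have "shift T l v \<in> Q"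
        using less.prems Q by (simp add: shift_def subspace_diff subspace_scale)
      ultimately have "decomposes T Q (shift T l v)" using less.hyps r0 by blast
      then obtain c where c: "\<And>m. c m \<in> Q \<inter> GE T m" "shift T l v = (\<Sum>m\<in>gspec T. c m)"
        by (auto simp: decomposes_def)
      have "\<exists>y. y \<in> Q \<inter> GE T m \<and> (m \<noteq> l \<longrightarrow> shift T l y = c m)" for m
      proof (cases "m = l")
        case True
        then show ?thesis using T Q by (auto simp: subspace_0 GE_0 intro: exI[of _ 0])
      next
        case False
        obtain n where "(shift T m ^^ n) (c m) = 0" using c(1)[of m] by (auto simp: GE_def)
        then show ?thesis using shift_solve[OF T False[symmetric] Q] c(1)[of m] by blast
      qed
      then obtain y where y: "\<And>m. y m \<in> Q \<inter> GE T m" "\<And>m. m \<noteq> l \<Longrightarrow> shift T l (y m) = c m"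
        by metis
      define s where "s = (\<Sum>m\<in>gspec T - {l}. y m)"
      have ds: "decomposes T Q s"
        unfolding s_def using y(1) decomposes_GE[OF T Q(1)] by (intro decomposes_sum[OF T Q(1)]) blast
      have sQ: "s \<in> Q" unfolding s_def using y(1) Q(1) by (simp add: subspace_sum)
      have "shift T l (v - s) = (\<Sum>m\<in>gspec T. c m) - (\<Sum>m\<in>gspec T - {l}. c m)"
        using y(2) c(2) unfolding s_def
        by (simp add: endo_diff[OF shift_endo[OF T]] endo_sum[OF shift_endo[OF T]])
      also have "\<dots> \<in> GE T l"
        using c(1)[of l] finite_gspec[OF T] GE_0[OF T] by (simp add: sum_diff1)
      finally have "v - s \<in> GE T l" using GE_shift[OF T] by blast
      then have "decomposes T Q (v - s)"
        using sQ less.prems Q by (intro decomposes_GE[OF T Q(1)]) (auto simp: subspace_diff)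
      then show ?thesis using decomposes_add[OF T Q(1) _ ds] by fastforce
    qed
  qed
  then show ?thesis using annihilating_poly[OF T] v by blast
qed

definition gcomp :: "('v \<Rightarrow> 'v) \<Rightarrow> 'v \<Rightarrow> 'a \<Rightarrow> 'v" where
  "gcomp T v = (SOME c. (\<forall>l. c l \<in> GE T l) \<and> v = (\<Sum>l\<in>gspec T. c l))"

lemma gcomp:
  assumes "endo T"
  shows gcomp_GE: "gcomp T v l \<in> GE T l" and gcomp_sum: "v = (\<Sum>l\<in>gspec T. gcomp T v l)"
proof -
  have "\<exists>c. (\<forall>l. c l \<in> GE T l) \<and> v = (\<Sum>l\<in>gspec T. c l)"
    using GE_decomposition[OF assms, of UNIV v] by (auto simp: decomposes_def)
  from someI_ex[OF this, folded gcomp_def]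
  show "gcomp T v l \<in> GE T l" "v = (\<Sum>l\<in>gspec T. gcomp T v l)" by auto
qed

lemma gcomp_unique:
  assumes "endo T" "\<And>l. c l \<in> GE T l" "v = (\<Sum>l\<in>gspec T. c l)"
  shows "gcomp T v l = c l"
proof (cases "l \<in> gspec T")
  case True
  have "(\<Sum>l\<in>gspec T. gcomp T v l - c l) = 0"
    using gcomp_sum[OF assms(1), of v] assms(3) by (simp add: sum_subtractf)
  from GE_independent[OF assms(1) finite_gspec[OF assms(1)] _ this True]
  show ?thesis using assms by (simp add: gcomp_GE GE_subspace subspace_diff)
next
  case False
  then show ?thesis using gcomp_GE[OF assms(1), of v l] assms(2)[of l] by (auto simp: gspec_def)
qed

text \<open>Uniqueness of the components takes the place of writing the projections as polynomials
  in \<open>T\<close>.\<close>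

lemma gcomp_in_subspace:
  assumes "endo T" "subspace Q" "\<And>v. v \<in> Q \<Longrightarrow> T v \<in> Q" "v \<in> Q"
  shows "gcomp T v l \<in> Q"
proof -
  from GE_decomposition[OF assms] obtain c where
    "\<And>l. c l \<in> Q \<inter> GE T l" "v = (\<Sum>l\<in>gspec T. c l)" by (auto simp: decomposes_def)
  then show ?thesis using gcomp_unique[OF assms(1), of c v l] by auto
qed

lemma gcomp_on_GE:
  assumes "endo T" "v \<in> GE T m"
  shows "gcomp T v l = (if l = m then v else 0)"
proof (rule gcomp_unique[OF assms(1)])
  show "(if l = m then v else 0) \<in> GE T l" for l using assms by (simp add: GE_0)
  show "v = (\<Sum>l\<in>gspec T. if l = m then v else 0)"
    using assms finite_gspec[OF assms(1)] by (auto simp: sum.delta gspec_def)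
qed

lemma gcomp_endo:
  assumes "endo T" shows "endo (\<lambda>v. gcomp T v l)"
proof (rule endoI)
  note G = gcomp_GE[OF assms] and S = gcomp_sum[OF assms, symmetric] and sub = GE_subspace[OF assms]
  show "gcomp T (x + y) l = gcomp T x l + gcomp T y l" for x y
    by (rule gcomp_unique[OF assms, where c = "\<lambda>l. gcomp T x l + gcomp T y l"])
       (use G sub in \<open>auto simp: subspace_add sum.distrib S\<close>)
  show "gcomp T (c *s x) l = c *s gcomp T x l" for c x
    by (rule gcomp_unique[OF assms, where c = "\<lambda>l. c *s gcomp T x l"])
       (use G sub in \<open>auto simp: subspace_scale scale_sum_right[symmetric] S\<close>)
qed

lemma gcomp_commute:
  assumes "endo T" "endo A" "\<And>v. A (T v) = T (A v)"
  shows "gcomp T (A v) l = A (gcomp T v l)"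
  by (rule gcomp_unique[OF assms(1), where c = "\<lambda>l. A (gcomp T v l)"])
     (use GE_commute[OF assms gcomp_GE[OF assms(1)]] assms
       in \<open>auto simp: endo_sum[symmetric] gcomp_sum[OF assms(1), symmetric]\<close>)

lemma endo_eq_on_GE:
  assumes "endo T" "endo A" "endo B" "\<And>l v. v \<in> GE T l \<Longrightarrow> A v = B v"
  shows "A v = B v"
proof -
  have "A v = (\<Sum>l\<in>gspec T. A (gcomp T v l))" "B v = (\<Sum>l\<in>gspec T. B (gcomp T v l))"
    using gcomp_sum[OF assms(1), of v] assms by (metis endo_sum)+
  then show ?thesis by (simp add: assms(4)[OF gcomp_GE[OF assms(1)]])
qed

lemma nilpotent_of_GE:
  assumes T: "endo T" and A: "endo A" and "\<And>l v. v \<in> GE T l \<Longrightarrow> \<exists>n. (A ^^ n) v = 0"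
  shows "\<exists>n. (A ^^ n) v = 0"
proof -
  have "\<forall>l. \<exists>n. (A ^^ n) (gcomp T v l) = 0" using assms(3)[OF gcomp_GE[OF T]] by blast
  then obtain n where n: "\<And>l. (A ^^ n l) (gcomp T v l) = 0" by metis
  let ?m = "Max (insert 0 (n ` gspec T))"
  have "(A ^^ ?m) (gcomp T v l) = 0" if "l \<in> gspec T" for l
    by (rule funpow_0_mono[OF A n]) (use that finite_gspec[OF T] in auto)
  then have "(A ^^ ?m) (\<Sum>l\<in>gspec T. gcomp T v l) = 0"
    by (simp add: endo_sum[OF endo_funpow[OF A]])
  then show ?thesis using gcomp_sum[OF T, of v] by metis
qed

text \<open>This is \<open>\<psi>\<close> applied to the semisimple part of \<open>T\<close>. The
  identity gives the semisimple part itself; other choices give the rational derivation of Cartan's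
  criterion and the action of a root of unity on a grading.\<close>

definition gfun :: "('v \<Rightarrow> 'v) \<Rightarrow> ('a \<Rightarrow> 'a) \<Rightarrow> 'v \<Rightarrow> 'v" where
  "gfun T \<psi> v = (\<Sum>l\<in>gspec T. \<psi> l *s gcomp T v l)"

lemma gfun_endo: "endo T \<Longrightarrow> endo (gfun T \<psi>)"
  unfolding gfun_def by (intro endo_sum_fun endo_smult gcomp_endo)

lemma gfun_on_GE:
  assumes "endo T" "v \<in> GE T l"
  shows "gfun T \<psi> v = \<psi> l *s v"
proof (cases "v = 0")
  case True
  then show ?thesis using gfun_endo[OF assms(1)] by (simp add: endo_0)
next
  case False
  then have "l \<in> gspec T" using assms by (auto simp: gspec_def)
  then show ?thesis unfolding gfun_def using finite_gspec[OF assms(1)]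
    by (simp add: gcomp_on_GE[OF assms] if_distrib sum.delta cong: if_cong)
qed

lemma gfun_in_subspace:
  assumes "endo T" "subspace Q" "\<And>v. v \<in> Q \<Longrightarrow> T v \<in> Q" "v \<in> Q"
  shows "gfun T \<psi> v \<in> Q"
  unfolding gfun_def using gcomp_in_subspace[OF assms] assms(2)
  by (intro subspace_sum subspace_scale) auto

lemma gfun_commute:
  assumes "endo T" "endo A" "\<And>v. A (T v) = T (A v)"
  shows "gfun T \<psi> (A v) = A (gfun T \<psi> v)"
  unfolding gfun_def using assms by (simp add: gcomp_commute endo_sum endo_scale)

text \<open>On \<open>GE T l\<close> the difference acts as \<open>T - l\<close>.\<close>

lemma gfun_diff_nilpotent:
  assumes "endo T"
  shows "\<exists>n. ((\<lambda>v. T v - gfun T (\<lambda>l. l) v) ^^ n) v = 0"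
proof -
  let ?N = "\<lambda>v. T v - gfun T (\<lambda>l. l) v"
  have eN: "endo ?N" by (intro endo_subtract gfun_endo assms)
  have "\<exists>n. (?N ^^ n) v = 0" if "v \<in> GE T l" for v l
  proof -
    have "(?N ^^ n) v = (shift T l ^^ n) v \<and> (shift T l ^^ n) v \<in> GE T l" for n
    proof (induction n)
      case (Suc n)
      let ?u = "(shift T l ^^ n) v"
      have "?N ?u = shift T l ?u"
        using gfun_on_GE[OF assms, of ?u l "\<lambda>l. l"] Suc by (simp add: shift_def)
      moreover have "shift T l ?u \<in> GE T l"
        unfolding shift_def[of T l "?u"] using Suc
        by (intro subspace_diff subspace_scale GE_subspace[OF assms] GE_stable[OF assms]) auto
      ultimately show ?case using Suc by simp
    qed (use that in simp)
    then show ?thesis using that by (auto simp: GE_def)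
  qed
  then show ?thesis by (rule nilpotent_of_GE[OF assms eN])
qed

text \<open>Diagonalizability on a stable \<open>Q\<close> is tested against the semisimple part
  computed on the whole space, so that no restricted operator has to be formed.
  \<open>diag_on_span\<close> translates it into eigenvectors lying in \<open>Q\<close>.\<close>

definition diag_on :: "'v set \<Rightarrow> ('v \<Rightarrow> 'v) \<Rightarrow> bool" where
  "diag_on Q T \<longleftrightarrow> (\<forall>v\<in>Q. T v = gfun T (\<lambda>l. l) v)"

lemma diag_on_subset: "diag_on Q T \<Longrightarrow> R \<subseteq> Q \<Longrightarrow> diag_on R T"
  by (auto simp: diag_on_def)

lemma diag_on_GE: "endo T \<Longrightarrow> diag_on Q T \<Longrightarrow> v \<in> Q \<Longrightarrow> v \<in> GE T l \<Longrightarrow> T v = l *s v"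
  by (simp add: diag_on_def gfun_on_GE)

lemma diag_on_span:
  assumes "endo T" "subspace Q" "\<And>v. v \<in> Q \<Longrightarrow> T v \<in> Q"
  shows "diag_on Q T \<longleftrightarrow> Q \<subseteq> span {y \<in> Q. \<exists>c. T y = c *s y}" (is "_ \<longleftrightarrow> _ \<subseteq> span ?E")
proof
  assume D: "diag_on Q T"
  show "Q \<subseteq> span ?E"
  proof
    fix v assume v: "v \<in> Q"
    have "gcomp T v l \<in> ?E" for l
      using gcomp_in_subspace[OF assms v] gcomp_GE[OF assms(1)] diag_on_GE[OF assms(1) D] by blast
    then have "(\<Sum>l\<in>gspec T. gcomp T v l) \<in> span ?E" by (intro span_sum span_base)
    then show "v \<in> span ?E" by (simp only: gcomp_sum[OF assms(1), symmetric])
  qed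
next
  assume S: "Q \<subseteq> span ?E"
  have "T v - gfun T (\<lambda>l. l) v = 0" if "v \<in> Q" for v
  proof (rule endo_eq_0_on_span[where S = ?E and T = "\<lambda>v. T v - gfun T (\<lambda>l. l) v"])
    show "endo (\<lambda>v. T v - gfun T (\<lambda>l. l) v)" by (intro endo_subtract gfun_endo assms)
    show "T v - gfun T (\<lambda>l. l) v = 0" if "v \<in> ?E" for v
    proof -
      from that obtain c where c: "T v = c *s v" by blast
      then show ?thesis using gfun_on_GE[OF assms(1) eigen_GE[where T = T and v = v and l = c], of "\<lambda>l. l"] by simp
    qed
  qed (use that S in auto)
  then show "diag_on Q T" by (simp add: diag_on_def)
qed

text \<open>On a common eigenvector, with eigenvalues \<open>l\<close> and \<open>m\<close>, the
  difference acts as the scalar \<open>l - m\<close>, and a nilpotent scalar is 0. Commutation makes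
  the components under \<open>T\<close> of an eigenvector of \<open>S\<close> such common
  eigenvectors.\<close>

lemma commuting_diag_diff_nilpotent:
  assumes S: "endo S" and T: "endo T" and com: "\<And>v. S (T v) = T (S v)"
    and dS: "diag_on UNIV S" and dT: "diag_on UNIV T"
    and nil: "\<And>v. \<exists>n. ((\<lambda>v. S v - T v) ^^ n) v = 0"
  shows "S v = T v"
proof (rule endo_eq_on_GE[OF S S T])
  fix l v assume v: "v \<in> GE S l"
  show "S v = T v"
  proof -
    have "S (gcomp T v m) = T (gcomp T v m)" for m
    proof (rule ccontr)
      let ?u = "gcomp T v m"
      assume ne: "S ?u \<noteq> T ?u"
      have "?u \<in> GE S l"
        by (rule gcomp_in_subspace[OF T GE_subspace[OF S]])
           (use v GE_commute[OF S T] com in auto)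
      then have u: "S ?u = l *s ?u" using diag_on_GE[OF S dS] by auto
      have u': "T ?u = m *s ?u" using diag_on_GE[OF T dT] gcomp_GE[OF T] by auto
      have "((\<lambda>v. S v - T v) ^^ n) ?u = (l - m) ^ n *s ?u" for n
        by (rule eigen_funpow[OF endo_subtract[OF S T]]) (simp add: u u' scale_left_diff_distrib)
      then obtain n where "(l - m) ^ n *s ?u = 0" using nil by metis
      then show False using ne u u' by auto
    qed
    then have "(\<Sum>m\<in>gspec T. S (gcomp T v m)) = (\<Sum>m\<in>gspec T. T (gcomp T v m))" by simp
    then show ?thesis using gcomp_sum[OF T, of v] by (metis S T endo_sum)
  qed
qed

section \<open>The trace\<close>

definition tr :: "('v \<Rightarrow> 'v) \<Rightarrow> 'a" where
  "tr A = (\<Sum>b\<in>Basis. representation Basis (A b) b)"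

definition is_basis :: "'v set \<Rightarrow> bool" where
  "is_basis B \<longleftrightarrow> finite B \<and> independent B \<and> span B = UNIV"

lemma Basis_is_basis: "is_basis Basis"
  using finite_Basis independent_Basis span_Basis by (simp add: is_basis_def)

lemma is_basisI: "independent B \<Longrightarrow> span B = UNIV \<Longrightarrow> is_basis B"
  by (simp add: is_basis_def finiteI_independent)

lemma basis_sum:
  assumes "is_basis B"
  shows "(\<Sum>b\<in>B. representation B v b *s b) = v"
  using assms by (intro sum_representation_eq) (auto simp: is_basis_def)

lemma basis_rep:
  assumes "is_basis B"
  shows "representation B (x + y) b = representation B x b + representation B y b"
    "representation B (c *s x) b = c * representation B x b"
    "representation B (sum g A) b = (\<Sum>i\<in>A. representation B (g i) b)"
    "representation B 0 b = 0"
  using assms representation_add[of B y x] representation_scale[of B x c]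
    representation_sum[of B A g] by (auto simp: is_basis_def representation_zero)

text \<open>Two bases serve two purposes: \<open>S\<close> the identity gives independence of the
  basis, equal bases give cyclicity of the trace.\<close>

lemma tr_swap:
  assumes "endo S" "endo T" "is_basis B" "is_basis C"
  shows "(\<Sum>b\<in>B. representation B (S (T b)) b) = (\<Sum>c\<in>C. representation C (T (S c)) c)"
proof -
  have "(\<Sum>b\<in>B. representation B (S (T b)) b)
      = (\<Sum>b\<in>B. \<Sum>c\<in>C. representation C (T b) c * representation B (S c) b)"
  proof (rule sum.cong[OF refl])
    fix b
    have "S (T b) = (\<Sum>c\<in>C. representation C (T b) c *s S c)"
      by (subst basis_sum[OF assms(4), of "T b", symmetric])
         (simp only: endo_sum[OF assms(1)] endo_scale[OF assms(1)])
    then show "representation B (S (T b)) b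
        = (\<Sum>c\<in>C. representation C (T b) c * representation B (S c) b)"
      by (simp add: basis_rep[OF assms(3)])
  qed
  also have "\<dots> = (\<Sum>c\<in>C. \<Sum>b\<in>B. representation B (S c) b * representation C (T b) c)"
    by (subst sum.swap) (simp add: mult.commute)
  also have "\<dots> = (\<Sum>c\<in>C. representation C (T (S c)) c)"
  proof (rule sum.cong[OF refl])
    fix c
    have "T (S c) = (\<Sum>b\<in>B. representation B (S c) b *s T b)"
      by (subst basis_sum[OF assms(3), of "S c", symmetric])
         (simp only: endo_sum[OF assms(2)] endo_scale[OF assms(2)])
    then show "(\<Sum>b\<in>B. representation B (S c) b * representation C (T b) c) = representation C (T (S c)) c"
      by (simp add: basis_rep[OF assms(4)])
  qed
  finally show ?thesis .
qed

lemma tr_basis: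
  assumes "endo T" "is_basis B"
  shows "tr T = (\<Sum>b\<in>B. representation B (T b) b)"
  using tr_swap[OF endo_ident assms(1) Basis_is_basis assms(2)] by (simp add: tr_def)

lemma tr_commute: "endo S \<Longrightarrow> endo T \<Longrightarrow> tr (\<lambda>v. S (T v)) = tr (\<lambda>v. T (S v))"
  unfolding tr_def by (rule tr_swap) (simp_all add: Basis_is_basis)

lemma tr_add: "tr (\<lambda>v. S v + T v) = tr S + tr T"
  by (simp add: tr_def basis_rep[OF Basis_is_basis] sum.distrib)

lemma tr_scale: "tr (\<lambda>v. c *s T v) = c * tr T"
  by (simp add: tr_def basis_rep[OF Basis_is_basis] sum_distrib_left)

lemma tr_diff: "tr (\<lambda>v. S v - T v) = tr S - tr T"
  using tr_add[of S "\<lambda>v. (-1) *s T v"] tr_scale[of "-1" T] by simp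

lemma tr_sum: "tr (\<lambda>v. \<Sum>i\<in>A. T i v) = (\<Sum>i\<in>A. tr (T i))"
  by (simp add: tr_def basis_rep[OF Basis_is_basis]) (rule sum.swap)

text \<open>In a basis adapted to the chain of kernels of the powers of \<open>A\<close>, every
  basis vector is sent into an earlier kernel, so the diagonal is zero.\<close>

lemma tr_nilpotent:
  assumes A: "endo A" and nil: "\<And>v. \<exists>n. (A ^^ n) v = 0"
  shows "tr A = 0"
proof -
  let ?K = "\<lambda>k. {v. (A ^^ k) v = 0}"
  have K: "subspace (?K k)" for k
    using endo_funpow[OF A, of k] by (intro subspaceI) (auto simp: endo_0 endo_add endo_scale)
  have "\<exists>B. independent B \<and> span B = ?K k \<and> (\<forall>b\<in>B. representation B (A b) b = 0)" for k
  proof (induction k)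
    case 0
    show ?case by (rule exI[of _ "{}"]) (auto simp: independent_empty)
  next
    case (Suc k)
    then obtain B where B: "independent B" "span B = ?K k" "\<forall>b\<in>B. representation B (A b) b = 0" by blast
    have sub: "?K k \<subseteq> ?K (Suc k)" using A by (auto simp: endo_0)
    have "B \<subseteq> ?K (Suc k)" using B sub span_superset by blast
    then obtain C where C: "B \<subseteq> C" "C \<subseteq> ?K (Suc k)" "independent C" "?K (Suc k) \<subseteq> span C"
      using maximal_independent_subset_extend[OF _ B(1)] by blast
    have sC: "span C = ?K (Suc k)"
      using C K by (metis span_minimal subset_antisym)
    have "representation C (A b) b = 0" if b: "b \<in> C" for b
    proof -
      have "A b \<in> ?K k" using b C by (auto simp: funpow_swap1)
      then have Ab: "A b \<in> span B" using B by simp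
      then have "representation C (A b) = representation B (A b)"
        by (intro representation_extend[OF C(3) _ C(1)])
      \<comment> \<open>A nonzero coefficient would put \<open>b\<close> into the old basis
        \<open>B\<close>, where the induction hypothesis applies.\<close>
      moreover have "representation B (A b) b = 0"
        using B(3) representation_ne_zero[of B "A b" b] by blast
      ultimately show ?thesis by simp
    qed
    then show ?case using C sC by blast
  qed
  moreover obtain k where "?K k = UNIV"
  proof -
    obtain n where n: "\<And>v. (A ^^ n v) v = 0" using nil by metis
    let ?m = "Max (insert 0 (n ` Basis))"
    have "Basis \<subseteq> ?K ?m"
      using funpow_0_mono[OF A n] finite_Basis by auto
    then have "span Basis \<subseteq> ?K ?m" using K span_minimal by blast
    then have "?K ?m = UNIV" using span_Basis by auto
    then show ?thesis by (rule that)
  qed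
  ultimately obtain B where "independent B" "span B = UNIV" "\<forall>b\<in>B. representation B (A b) b = 0"
    by metis
  then show ?thesis using tr_basis[OF A is_basisI] by simp
qed

lemma representation_basis_elem:
  "is_basis B \<Longrightarrow> b \<in> B \<Longrightarrow> representation B b b = 1"
  by (simp add: is_basis_def representation_basis)

lemma GE_basis:
  assumes "endo T"
  obtains B where "is_basis B" "B \<subseteq> (\<Union>l. GE T l)"
proof -
  obtain B where B: "B \<subseteq> (\<Union>l. GE T l)" "independent B" "(\<Union>l. GE T l) \<subseteq> span B"
    by (rule maximal_independent_subset)
  have "v \<in> span B" for v
    by (subst gcomp_sum[OF assms, of v]) (use B gcomp_GE[OF assms] in \<open>blast intro: span_sum\<close>)
  then show ?thesis using B that is_basisI by blast
qed

lemma nilpotent_basisI: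
  assumes "endo T" "is_basis B" "B \<subseteq> GE T 0"
  shows "\<exists>n. (T ^^ n) v = 0"
proof -
  have "span B \<subseteq> GE T 0" using assms GE_subspace span_minimal by blast
  then have "v \<in> GE T 0" using assms by (auto simp: is_basis_def)
  then show ?thesis by (auto simp: GE_def shift_def[abs_def])
qed

end

section \<open>The Lie bracket, derivations and their gradings\<close>

locale lie_vs = fd_vs scale Basis
  for scale :: "'a::field_char_0 \<Rightarrow> 'v::ab_group_add \<Rightarrow> 'v" (infixr "*s" 75) and Basis +
  fixes br :: "'v \<Rightarrow> 'v \<Rightarrow> 'v"
  assumes lie: "lie_alg (*s) br"
begin

lemma br_add_left: "br (x + y) z = br x z + br y z"
  and br_add_right: "br x (y + z) = br x y + br x z"
  and br_scale_left: "br (c *s x) y = c *s br x y"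
  and br_scale_right: "br x (c *s y) = c *s br x y"
  and br_self: "br x x = 0"
  using lie by (auto simp: lie_alg_def)

lemma ad_endo: "endo (br x)" and ad_endo': "endo (\<lambda>x. br x y)"
  by (rule endoI; simp add: br_add_left br_add_right br_scale_left br_scale_right)+

lemmas br_0_right [simp] = endo_0[OF ad_endo]
lemmas br_0_left [simp] = endo_0[OF ad_endo']
lemmas br_minus_right = endo_minus[OF ad_endo]
lemmas br_minus_left = endo_minus[OF ad_endo']
lemmas br_diff_right = endo_diff[OF ad_endo]
lemmas br_diff_left = endo_diff[OF ad_endo']

lemma br_skew: "br x y = - br y x"
proof -
  have "br (x + y) (x + y) = br x y + br y x"
    unfolding br_add_left br_add_right by (simp add: br_self)
  then have "br x y + br y x = 0" by (simp only: br_self)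
  then show ?thesis by (simp only: eq_neg_iff_add_eq_0)
qed

lemma jacobi: "br x (br y z) = br (br x y) z + br y (br x z)"
proof -
  have "br x (br y z) + br y (br z x) + br z (br x y) = 0"
    using lie by (auto simp: lie_alg_def)
  moreover have "br y (br z x) = - br y (br x z)" by (metis br_skew br_minus_right)
  moreover have "br z (br x y) = - br (br x y) z" by (rule br_skew)
  ultimately show ?thesis by (simp add: algebra_simps)
qed

lemma weight_GE: "br h u = m *s u \<Longrightarrow> u \<in> GE (br h) m"
  by (rule eigen_GE)

definition derivation :: "('v \<Rightarrow> 'v) \<Rightarrow> bool" where
  "derivation D \<longleftrightarrow> endo D \<and> (\<forall>a b. D (br a b) = br (D a) b + br a (D b))"

lemma derivation_endo: "derivation D \<Longrightarrow> endo D"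
  by (simp add: derivation_def)

lemma derivation_ad: "derivation (br x)"
  unfolding derivation_def by (intro conjI allI ad_endo jacobi)

lemma derivation_diff: "derivation D \<Longrightarrow> derivation E \<Longrightarrow> derivation (\<lambda>v. D v - E v)"
  by (simp add: derivation_def endo_subtract br_diff_left br_diff_right)

lemma shift_br:
  assumes "derivation D"
  shows "shift D (l + m) (br a b) = br (shift D l a) b + br a (shift D m b)"
  using assms
  by (simp add: derivation_def shift_def br_diff_left br_diff_right br_scale_left br_scale_right
      scale_left_distrib)

text \<open>Induction on the sum of the exponents that kill \<open>a\<close> and \<open>b\<close>:
  each term of \<open>shift_br\<close> lowers one of them. This replaces the binomial formula for
  powers of \<open>D - (l + m)\<close>.\<close>

lemma GE_br:
  assumes D: "derivation D" and "a \<in> GE D l" "b \<in> GE D m"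
  shows "br a b \<in> GE D (l + m)"
proof -
  note e = derivation_endo[OF D]
  have "br a b \<in> GE D (l + m)"
    if "(shift D l ^^ i) a = 0" "(shift D m ^^ j) b = 0" for i j a b
    using that
  proof (induction "i + j" arbitrary: i j a b)
    case 0
    then show ?case by (simp add: GE_0[OF e])
  next
    case (Suc n)
    have "br (shift D l a) b \<in> GE D (l + m)"
    proof (cases i)
      case 0
      then show ?thesis
        using Suc.prems by (simp add: GE_0[OF e] endo_0[OF shift_endo[OF e]])
    next
      case (Suc i')
      then show ?thesis using Suc.hyps(1)[of i' j "shift D l a" b] \<open>Suc n = i + j\<close> Suc.prems
        by (simp add: funpow_swap1)
    qed
    moreover have "br a (shift D m b) \<in> GE D (l + m)"
    proof (cases j)
      case 0
      then show ?thesis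
        using Suc.prems by (simp add: GE_0[OF e] endo_0[OF shift_endo[OF e]])
    next
      case (Suc j')
      then show ?thesis using Suc.hyps(1)[of i j' a "shift D m b"] \<open>Suc n = i + j\<close> Suc.prems
        by (simp add: funpow_swap1)
    qed
    ultimately have "shift D (l + m) (br a b) \<in> GE D (l + m)"
      unfolding shift_br[OF D] by (rule subspace_add[OF GE_subspace[OF e]])
    then show ?case by (rule GE_shift[OF e])
  qed
  then show ?thesis using assms by (auto simp: GE_def)
qed

text \<open>Brackets add eigenvalues, so additivity of \<open>\<psi>\<close> is the Leibniz rule on
  generalized eigenvectors.\<close>

lemma gfun_derivation:
  assumes D: "derivation D" and add: "\<And>l m. \<psi> (l + m) = \<psi> l + \<psi> m"
  shows "derivation (gfun D \<psi>)"
proof -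
  note e = derivation_endo[OF D]
  note g = gfun_endo[OF e, of \<psi>]
  have "gfun D \<psi> (br a b) = br (gfun D \<psi> a) b + br a (gfun D \<psi> b)" for a b
  proof (rule endo_eq_on_GE[OF e, where v = a])
    show "endo (\<lambda>a. gfun D \<psi> (br a b))" by (rule endo_comp[OF g ad_endo'])
    show "endo (\<lambda>a. br (gfun D \<psi> a) b + br a (gfun D \<psi> b))"
      by (rule endo_plus[OF endo_comp[OF ad_endo' g] ad_endo'])
    fix l a assume a: "a \<in> GE D l"
    show "gfun D \<psi> (br a b) = br (gfun D \<psi> a) b + br a (gfun D \<psi> b)"
    proof (rule endo_eq_on_GE[OF e, where v = b])
      show "endo (\<lambda>b. gfun D \<psi> (br a b))" by (rule endo_comp[OF g ad_endo])
      show "endo (\<lambda>b. br (gfun D \<psi> a) b + br a (gfun D \<psi> b))"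
        by (rule endo_plus[OF ad_endo endo_comp[OF ad_endo g]])
      fix m b assume b: "b \<in> GE D m"
      show "gfun D \<psi> (br a b) = br (gfun D \<psi> a) b + br a (gfun D \<psi> b)"
        using gfun_on_GE[OF e a] gfun_on_GE[OF e b] gfun_on_GE[OF e GE_br[OF D a b]]
        by (simp add: add br_scale_left br_scale_right scale_left_distrib)
    qed
  qed
  then show ?thesis using g by (simp add: derivation_def)
qed

section \<open>Actions of sl2-triples\<close>

text \<open>Membership is left out, so that a triple found inside a subalgebra can be made to act on
  the whole space.\<close>

definition trip :: "'v \<Rightarrow> 'v \<Rightarrow> 'v \<Rightarrow> bool" where
  "trip e h f \<longleftrightarrow> br h e = 2 *s e \<and> br h f = (-2) *s f \<and> br e f = h"

lemma trip_flip: "trip e h f \<Longrightarrow> trip f (- h) e"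
  using br_skew[of f e] by (simp add: trip_def br_minus_left flip: scale_minus_left)

lemma weight_shift:
  assumes "br h x = c *s x" "br h u = m *s u"
  shows "br h (br x u) = (c + m) *s br x u"
  using assms by (simp add: jacobi[of h x u] br_scale_left br_scale_right scale_left_distrib)

lemma weight_funpow:
  assumes "br h x = c *s x" "br h u = m *s u"
  shows "br h ((br x ^^ k) u) = (m + of_nat k * c) *s (br x ^^ k) u"
proof (induction k)
  case (Suc k)
  then show ?case using weight_shift[OF assms(1) Suc] by (simp add: algebra_simps)
qed (use assms in simp)

lemma weight_gspec: "br h u = m *s u \<Longrightarrow> u \<noteq> 0 \<Longrightarrow> m \<in> gspec (br h)"
  using weight_GE[of h u m] unfolding gspec_def by blast

lemma GE_funpow:
  assumes "br h x = c *s x" "u \<in> GE (br h) m"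
  shows "(br x ^^ k) u \<in> GE (br h) (m + of_nat k * c)"
proof (induction k)
  case (Suc k)
  from GE_br[OF derivation_ad weight_GE[OF assms(1)] this]
  show ?case by (simp add: algebra_simps)
qed (use assms in simp)

lemma infinite_arithmetic_progression:
  assumes "c \<noteq> (0::'a)" "\<And>k::nat. m + of_nat k * c \<in> S"
  shows "infinite S"
proof -
  have "inj (\<lambda>k::nat. m + of_nat k * c)" using assms(1) by (auto intro!: injI)
  then have "infinite (range (\<lambda>k::nat. m + of_nat k * c))" by (simp add: finite_image_iff)
  then show ?thesis using assms(2) by (meson finite_subset image_subsetI)
qed

text \<open>Each application of \<open>ad x\<close> moves the eigenvalue by \<open>c\<close>, and in
  characteristic 0 this leaves the finite spectrum of \<open>ad h\<close>.\<close>

lemma weight_nilpotent: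
  assumes "br h x = c *s x" "c \<noteq> 0" "u \<in> GE (br h) m"
  shows "\<exists>k. (br x ^^ k) u = 0"
proof (rule ccontr)
  assume "\<not> ?thesis"
  then have "m + of_nat k * c \<in> gspec (br h)" for k
    using GE_funpow[OF assms(1,3), of k] by (auto simp: gspec_def)
  then show False using infinite_arithmetic_progression[OF assms(2)] finite_gspec[OF ad_endo] by blast
qed

lemma ad_nilpotentI:
  assumes "br h x = c *s x" "c \<noteq> 0"
  shows "\<exists>k. \<forall>u. (br x ^^ k) u = 0"
proof -
  have "\<exists>k. (br x ^^ k) u = 0" for u
    by (rule nilpotent_of_GE[OF ad_endo[of h] ad_endo weight_nilpotent[OF assms]])
  then obtain k where k: "\<And>u. (br x ^^ k u) u = 0" by metis
  let ?m = "Max (insert 0 (k ` Basis))"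
  have "(br x ^^ ?m) b = 0" if "b \<in> Basis" for b
    by (rule funpow_0_mono[OF ad_endo k]) (use that finite_Basis in auto)
  then have "(br x ^^ ?m) u = 0" for u
    using endo_eq_0_on_span[OF endo_funpow[OF ad_endo], of Basis] span_Basis by auto
  then show ?thesis by blast
qed

(* The hypothesis f e u = 0 is weaker than e u = 0; it is also applied to vectors u with e u
   invariant. *)
lemma sl2_chain:
  assumes t: "trip e h f" and u: "br h u = m *s u" "br f (br e u) = 0"
  shows "br e ((br f ^^ Suc k) u) = (of_nat (Suc k) * (m - of_nat k)) *s (br f ^^ k) u"
proof (induction k)
  case 0
  show ?case using t u jacobi[of e f u] by (simp add: trip_def)
next
  case (Suc k)
  let ?w = "(br f ^^ Suc k) u"
  have "br e (br f ?w) = br h ?w + br f (br e ?w)" using t jacobi[of e f ?w] by (simp add: trip_def)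
  also have "br h ?w = (m + of_nat (Suc k) * (-2)) *s ?w"
    using t u by (intro weight_funpow) (auto simp: trip_def)
  also have "br f (br e ?w) = (of_nat (Suc k) * (m - of_nat k)) *s ?w"
    unfolding Suc by (simp add: br_scale_right)
  also have "(m + of_nat (Suc k) * (-2)) *s ?w + (of_nat (Suc k) * (m - of_nat k)) *s ?w
      = (of_nat (Suc (Suc k)) * (m - of_nat (Suc k))) *s ?w"
    unfolding scale_left_distrib[symmetric] by (simp add: algebra_simps)
  finally show ?case by simp
qed

text \<open>At the last nonzero vector of the string under \<open>f\<close>,
  \<open>sl2_chain\<close> makes the product of \<open>k + 1\<close> and \<open>m - k\<close>
  vanish.\<close>

lemma sl2_weight:
  assumes t: "trip e h f" and u: "br h u = m *s u" "br f (br e u) = 0" "u \<noteq> 0"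
  obtains k where "m = of_nat k" "(br f ^^ k) u \<noteq> 0"
proof -
  have "br h f = (-2) *s f" using t by (simp add: trip_def)
  then obtain n where "(br f ^^ n) u = 0"
    using weight_nilpotent[of h f "-2" u m] weight_GE[of h u m] u by auto
  from funpow_last_nonzero[OF this u(3)] obtain k where
    k: "(br f ^^ k) u \<noteq> 0" "br f ((br f ^^ k) u) = 0" by blast
  from sl2_chain[OF t u(1,2), of k] k have "of_nat (Suc k) * (m - of_nat k) = 0"
    by (simp del: of_nat_Suc)
  then have "m = of_nat k" by (simp del: of_nat_Suc)
  then show ?thesis using k that by blast
qed

lemma sl2_weight_flip:
  assumes t: "trip e h f" and u: "br h u = m *s u" "br e (br f u) = 0" "u \<noteq> 0"
  obtains k where "m = - of_nat k" "(br e ^^ k) u \<noteq> 0"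
proof -
  have "br (- h) u = (- m) *s u" using u by (simp add: br_minus_left)
  from sl2_weight[OF trip_flip[OF t] this u(2,3)] that show ?thesis by (metis minus_minus)
qed

text \<open>The enveloping algebra identity [e, f^(k+1)] = (k+1) f^k (h - k). It is needed on
  arbitrary vectors because \<open>h\<close> is not yet known to be diagonalizable.\<close>

lemma sl2_commutator:
  assumes t: "trip e h f"
  shows "br e ((br f ^^ Suc k) v)
    = (br f ^^ Suc k) (br e v) + of_nat (Suc k) *s (br f ^^ k) (shift (br h) (of_nat k) v)"
proof (induction k arbitrary: v)
  case 0
  show ?case using t jacobi[of e f v] by (simp add: trip_def shift_def)
next
  case (Suc k)
  note fe = endo_funpow[OF ad_endo[of f]]
  have hf: "br h (br f v) = br f (br h v) - 2 *s br f v"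
    using t jacobi[of h f v] by (simp add: trip_def br_scale_left br_minus_left)
  have "br e ((br f ^^ Suc (Suc k)) v) = br e ((br f ^^ Suc k) (br f v))"
    by (simp only: funpow_Suc_right comp_apply)
  also have "\<dots> = (br f ^^ Suc k) (br e (br f v))
      + of_nat (Suc k) *s (br f ^^ k) (shift (br h) (of_nat k) (br f v))" by (rule Suc)
  also have "br e (br f v) = br h v + br f (br e v)" using t jacobi[of e f v] by (simp add: trip_def)
  also have "shift (br h) (of_nat k) (br f v) = br f (br h v - (2 + of_nat k) *s v)"
    by (simp add: shift_def hf br_diff_right br_scale_right br_add_right scale_left_distrib algebra_simps)
  also have "(br f ^^ k) (br f (br h v - (2 + of_nat k) *s v))
      = (br f ^^ Suc k) (br h v - (2 + of_nat k) *s v)" by (simp only: funpow_Suc_right comp_apply)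
  also have "(br f ^^ Suc k) (br h v + br f (br e v)) = (br f ^^ Suc k) (br h v) + (br f ^^ Suc (Suc k)) (br e v)"
    unfolding endo_add[OF fe] by (simp only: funpow_Suc_right[of "Suc k" "br f"] comp_apply)
  also have "(br f ^^ Suc k) (br h v) + (br f ^^ Suc (Suc k)) (br e v)
        + of_nat (Suc k) *s (br f ^^ Suc k) (br h v - (2 + of_nat k) *s v)
      = (br f ^^ Suc (Suc k)) (br e v) + (br f ^^ Suc k)
          (br h v + of_nat (Suc k) *s (br h v - (2 + of_nat k) *s v))"
    by (simp only: endo_add[OF fe] endo_scale[OF fe] ac_simps)
  also have "br h v + of_nat (Suc k) *s (br h v - (2 + of_nat k) *s v)
      = of_nat (Suc (Suc k)) *s shift (br h) (of_nat (Suc k)) v"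
  proof -
    have 1: "x + n *s (x - m *s y) = (1 + n) *s x - (n * m) *s y" for x y n m
      by (simp add: scale_right_diff_distrib scale_left_distrib)
    have 2: "2 + of_nat k = (of_nat (Suc (Suc k)) :: 'a)" by simp
    have 3: "1 + of_nat (Suc k) = (of_nat (Suc (Suc k)) :: 'a)" by simp
    show ?thesis unfolding 1 2 3
      by (simp only: shift_def scale_right_diff_distrib scale_scale mult.commute)
  qed
  finally show ?case by (simp only: endo_scale[OF fe])
qed

lemma papp_br_f:
  assumes t: "trip e h f"
  shows "\<exists>w. papp p (br h) (br f v) = br f w"
proof (induction p)
  case 0
  show ?case by (rule exI[of _ 0]) simp
next
  case (pCons a p)
  then obtain w where w: "papp p (br h) (br f v) = br f w" by blast
  have "br h (br f w) = br f (br h w - 2 *s w)"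
    using t jacobi[of h f w] by (simp add: trip_def br_scale_left br_scale_right br_diff_right br_minus_left)
  then have "papp (pCons a p) (br h) (br f v) = br f (a *s v + (br h w - 2 *s w))"
    by (simp add: papp_pCons[OF ad_endo] w br_add_right br_scale_right)
  then show ?case by blast
qed

text \<open>Modulo the image of \<open>f\<close>, e^k f^k acts as k! h (h - 1) ... (h - k + 1). The
  terms involving \<open>e v\<close> disappear because polynomials in \<open>h\<close> preserve that
  image. For k with f^k v = 0 this becomes a polynomial relation for \<open>h\<close> on
  \<open>v\<close>.\<close>

lemma sl2_identity:
  assumes t: "trip e h f"
  shows "\<exists>u. (br e ^^ k) ((br f ^^ k) v)
    = fact k *s papp (\<Prod>i<k. [:- of_nat i, 1:]) (br h) v + br f u"
proof (induction k arbitrary: v)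
  case 0
  show ?case by (rule exI[of _ 0]) simp
next
  case (Suc k)
  let ?P = "\<lambda>k. \<Prod>i<k. [:- of_nat i, 1 :: 'a:]"
  note ee = endo_funpow[OF ad_endo[of e]]
  let ?s = "shift (br h) (of_nat k) v"
  have "(br e ^^ Suc k) ((br f ^^ Suc k) v) = (br e ^^ k) (br e ((br f ^^ Suc k) v))"
    by (simp only: funpow_Suc_right comp_apply)
  also have "\<dots> = (br e ^^ k) ((br f ^^ k) (br f (br e v))) + of_nat (Suc k) *s (br e ^^ k) ((br f ^^ k) ?s)"
    unfolding sl2_commutator[OF t] by (simp only: endo_add[OF ee] endo_scale[OF ee] funpow_Suc_right comp_apply)
  finally have 1: "(br e ^^ Suc k) ((br f ^^ Suc k) v)
    = (br e ^^ k) ((br f ^^ k) (br f (br e v))) + of_nat (Suc k) *s (br e ^^ k) ((br f ^^ k) ?s)" .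
  obtain u1 where u1: "(br e ^^ k) ((br f ^^ k) (br f (br e v)))
      = fact k *s papp (?P k) (br h) (br f (br e v)) + br f u1" using Suc by blast
  obtain w where w: "papp (?P k) (br h) (br f (br e v)) = br f w" using papp_br_f[OF t] by blast
  obtain u2 where u2: "(br e ^^ k) ((br f ^^ k) ?s) = fact k *s papp (?P k) (br h) ?s + br f u2"
    using Suc by blast
  have "papp (?P k) (br h) ?s = papp (?P (Suc k)) (br h) v"
    by (simp only: papp_linear_factor[OF ad_endo, symmetric] papp_mult[OF ad_endo, symmetric] prod.lessThan_Suc)
  then have "(br e ^^ Suc k) ((br f ^^ Suc k) v) = fact (Suc k) *s papp (?P (Suc k)) (br h) v
      + br f (fact k *s w + u1 + of_nat (Suc k) *s u2)"
    unfolding 1 u1 u2 w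
    by (simp add: br_add_right br_scale_right scale_right_distrib algebra_simps)
  then show ?case by blast
qed

lemma gcomp_weight:
  assumes x: "br h x = c *s x"
  shows "gcomp (br h) (br x u) l = br x (gcomp (br h) u (l - c))"
proof (rule endo_eq_on_GE[OF ad_endo, where v = u])
  note g = gcomp_endo[OF ad_endo]
  show "endo (\<lambda>u. gcomp (br h) (br x u) l)" by (rule endo_comp[OF g ad_endo])
  show "endo (\<lambda>u. br x (gcomp (br h) u (l - c)))" by (rule endo_comp[OF ad_endo g])
  fix m u assume u: "u \<in> GE (br h) m"
  from GE_br[OF derivation_ad weight_GE[OF x] u] have xu: "br x u \<in> GE (br h) (c + m)" .
  show "gcomp (br h) (br x u) l = br x (gcomp (br h) u (l - c))"
    unfolding gcomp_on_GE[OF ad_endo xu] gcomp_on_GE[OF ad_endo u]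
    by (auto simp: algebra_simps)
qed

(* A topmost generalized weight vector v that is not an eigenvector would give a primitive
   w = (h - l) v; the identity for e^k f^k puts w in the image of f on true weight vectors of
   weight l + 2 > 0, which is impossible. *)
lemma sl2_h_semisimple:
  assumes t: "trip e h f" and v: "v \<in> GE (br h) l"
  shows "br h v = l *s v"
proof (rule ccontr)
  assume "br h v \<noteq> l *s v"
  define bad where "bad m \<longleftrightarrow> (\<exists>v\<in>GE (br h) m. br h v \<noteq> m *s v)" for m
  have bad_gspec: "m \<in> gspec (br h)" if "bad m" for m
    using that by (auto simp: bad_def gspec_def)
  have "bad l" using v \<open>br h v \<noteq> _\<close> by (auto simp: bad_def)
  have "\<exists>k. bad (l + of_nat k * 2) \<and> \<not> bad (l + of_nat k * 2 + 2)"
  proof (rule ccontr)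
    assume n: "\<not> ?thesis"
    have "bad (l + of_nat k * 2)" for k
    proof (induction k)
      case (Suc k)
      then show ?case using n by (auto simp: algebra_simps)
    qed (use \<open>bad l\<close> in simp)
    then show False
      using infinite_arithmetic_progression[of 2 l "gspec (br h)"] bad_gspec finite_gspec[OF ad_endo] by auto
  qed
  then obtain m where m: "bad m" "\<not> bad (m + 2)" by blast
  then obtain v1 where v1: "v1 \<in> GE (br h) m" "br h v1 \<noteq> m *s v1" by (auto simp: bad_def)
  let ?S = "shift (br h) m"
  note sE = shift_endo[OF ad_endo, of h m]
  have Sv1: "?S v1 \<noteq> 0" using v1(2) by (simp add: shift_def)
  obtain n where "(?S ^^ n) v1 = 0" using v1(1) by (auto simp: GE_def)
  then have "(?S ^^ n) (?S v1) = 0"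
    using endo_0[OF sE] by (metis funpow_swap1)
  from funpow_last_nonzero[OF this Sv1] obtain k where
    k: "(?S ^^ k) (?S v1) \<noteq> 0" "?S ((?S ^^ k) (?S v1)) = 0" by blast
  define v2 where "v2 = (?S ^^ k) v1"
  define w where "w = ?S v2"
  have w: "w \<noteq> 0" "?S w = 0" using k by (simp_all add: w_def v2_def funpow_swap1)
  have v2: "v2 \<in> GE (br h) m"
  proof -
    have "(?S ^^ j) v1 \<in> GE (br h) m" for j
    proof (induction j)
      case (Suc j)
      then show ?case unfolding funpow.simps comp_apply shift_def[of "br h" m]
        by (intro subspace_diff subspace_scale GE_subspace[OF ad_endo] GE_stable[OF ad_endo])
    qed (use v1 in simp)
    then show ?thesis by (simp add: v2_def)
  qed
  have hw: "br h w = m *s w" using w(2) by (simp add: shift_def)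
  have he: "br h e = 2 *s e" using t by (simp add: trip_def)
  have ew: "br e w = 0"
  proof -
    from GE_br[OF derivation_ad weight_GE[OF he] v2] have "br e v2 \<in> GE (br h) (m + 2)"
      by (simp add: add.commute)
    then have "br h (br e v2) = (m + 2) *s br e v2" using m(2) by (auto simp: bad_def)
    moreover have "br h (br e v2) = 2 *s br e v2 + br e (br h v2)"
      using jacobi[of h e v2] he by (simp add: br_scale_left)
    ultimately show ?thesis
      by (simp add: w_def shift_def br_diff_right br_scale_right scale_left_distrib)
  qed
  obtain M where M: "m = of_nat M" using sl2_weight[OF t hw _ w(1)] ew by auto
  have hf: "br h f = (-2) *s f" using t by (simp add: trip_def)
  obtain n where n: "(br f ^^ n) v2 = 0" using weight_nilpotent[OF hf _ v2] by auto
  \<comment> \<open>\<open>K\<close> is at least \<open>n\<close>, so f^K kills \<open>v2\<close>,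
    and exceeds \<open>M\<close>, so \<open>h - m\<close> is among the first \<open>K\<close>
    factors. The remaining factors, collected in \<open>G\<close>, are nonzero at
    \<open>m\<close>.\<close>
  define K where "K = Suc (max n M)"
  have "(br f ^^ K) v2 = 0" by (rule funpow_0_mono[OF ad_endo n]) (simp add: K_def)
  then have "(br e ^^ K) ((br f ^^ K) v2) = 0" by (simp add: endo_0[OF endo_funpow[OF ad_endo]])
  with sl2_identity[OF t, of K v2] obtain u1 where
    u1: "fact K *s papp (\<Prod>i<K. [:- of_nat i, 1:]) (br h) v2 + br f u1 = 0" by metis
  define G where "G = (\<Prod>i\<in>{..<K} - {M}. [:- of_nat i, 1 :: 'a:])"
  have "(\<Prod>i<K. [:- of_nat i, 1 :: 'a:]) = G * [:- m, 1:]"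
    unfolding G_def M by (subst prod.remove[of _ M]) (auto simp: K_def mult.commute)
  then have "papp (\<Prod>i<K. [:- of_nat i, 1:]) (br h) v2 = papp G (br h) w"
    by (simp only: papp_mult[OF ad_endo] papp_linear_factor[OF ad_endo] w_def)
  also have "\<dots> = poly G m *s w" by (rule papp_eigen[OF ad_endo hw])
  finally have fw: "(fact K * poly G m) *s w = br f (- u1)"
    using u1 by (simp add: br_minus_right add_eq_0_iff2)
  have "poly G m \<noteq> 0" unfolding G_def M by (auto simp: poly_prod)
  then have "fact K * poly G m \<noteq> 0" by simp
  then have "w = inverse (fact K * poly G m) *s ((fact K * poly G m) *s w)"
    by (simp only: scale_scale left_inverse scale_one not_False_eq_True)
  also have "\<dots> = br f (inverse (fact K * poly G m) *s (- u1))"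
    by (simp only: fw br_scale_right)
  finally have wf: "w = br f (inverse (fact K * poly G m) *s (- u1))" .
  define u where "u = gcomp (br h) (inverse (fact K * poly G m) *s (- u1)) (m + 2)"
  have "w = gcomp (br h) w m" using gcomp_on_GE[OF ad_endo weight_GE[OF hw]] by simp
  also have "\<dots> = br f u" by (subst wf) (simp add: gcomp_weight[OF hf] u_def)
  finally have wu: "w = br f u" .
  have "u \<in> GE (br h) (m + 2)" unfolding u_def by (rule gcomp_GE[OF ad_endo])
  then have hu: "br h u = (m + 2) *s u" using m(2) by (auto simp: bad_def)
  have "u \<noteq> 0" using wu w(1) by auto
  \<comment> \<open>\<open>e (f u) = e w = 0\<close> forces the weight of \<open>u\<close> to be
    nonpositive, whereas \<open>m + 2 = M + 2\<close> is positive.\<close>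
  then obtain j where "m + 2 = - of_nat j"
    using sl2_weight_flip[OF t hu] ew wu by metis
  moreover have "of_nat (M + 2 + j) = (m + 2) + of_nat j" by (simp add: M)
  ultimately have "of_nat (M + 2 + j) = (0::'a)" by simp
  then show False unfolding of_nat_eq_0_iff by simp
qed

text \<open>Applying \<open>e\<close> repeatedly ends at a vector killed by \<open>e\<close>, whose
  weight is a natural number; the weight of \<open>v\<close> differs from it by an even
  integer.\<close>

lemma sl2_integral:
  assumes t: "trip e h f" and v: "v \<in> GE (br h) l" "v \<noteq> 0"
  obtains j where "l = of_int j"
proof -
  have he: "br h e = 2 *s e" using t by (simp add: trip_def)
  have hv: "br h v = l *s v" using sl2_h_semisimple[OF t v(1)] .
  obtain n where "(br e ^^ n) v = 0" using weight_nilpotent[OF he _ v(1)] by auto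
  from funpow_last_nonzero[OF this v(2)] obtain k where
    k: "(br e ^^ k) v \<noteq> 0" "br e ((br e ^^ k) v) = 0" by blast
  have "br f (br e ((br e ^^ k) v)) = 0" using k by simp
  from sl2_weight[OF t weight_funpow[OF he hv] this k(1)] obtain i where
    "l + of_nat k * 2 = of_nat i" by blast
  then have "l = of_int (int i - 2 * int k)" by (simp add: algebra_simps)
  then show ?thesis by (rule that)
qed


section \<open>Semisimplicity of cyclic elements\<close>

text \<open>With d = 2n, a root of 1 + z^2 + ... + z^(2n) is taken. Multiplication by z^2 - 1 gives
  z^(d+2) = 1, and z^2 = 1 would turn the sum into n + 1, which is nonzero in characteristic
  0.\<close>

lemma exists_root_of_unity:
  assumes "even d" "d > 0"
  obtains \<zeta> :: 'a where "\<zeta> ^ (d + 2) = 1" "\<zeta> ^ 2 \<noteq> 1" "\<zeta> \<noteq> 0"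
proof -
  obtain n where n: "d = 2 * n" using assms(1) by blast
  let ?p = "\<Sum>i\<le>n. Polynomial.monom 1 (2 * i) :: 'a poly"
  have "coeff ?p (2 * n) = (\<Sum>i\<le>n. if i = n then 1 else 0)"
    by (simp add: coeff_sum)
  also have "\<dots> = 1" by (simp add: sum.delta)
  finally have "2 * n \<le> degree ?p" by (intro le_degree) simp
  then have "degree ?p > 0" using n assms(2) by auto
  then obtain z where "poly ?p z = 0" using alg_closed by blast
  then have z: "(\<Sum>i\<le>n. (z ^ 2) ^ i) = 0" by (simp add: poly_sum poly_monom power_mult)
  have "(z ^ 2 - 1) * (\<Sum>i<Suc n. (z ^ 2) ^ i) = (z ^ 2) ^ Suc n - 1"
    by (simp only: power_diff_1_eq[symmetric])
  then have "z ^ (d + 2) = 1"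
    using z n by (simp add: lessThan_Suc_atMost power_mult[symmetric] del: sum.lessThan_Suc power_Suc)
  moreover have "z ^ 2 \<noteq> 1"
  proof
    assume "z ^ 2 = 1"
    with z have "of_nat (Suc n) = (0::'a)" by simp
    then show False unfolding of_nat_eq_0_iff by simp
  qed
  moreover have "z \<noteq> 0" using calculation(1) by (auto simp: power_0_left)
  ultimately show ?thesis by (rule that)
qed

(* The nilpotent part N of ad (e + F) is a derivation killing Q, so it commutes with ad h and
   preserves the grading; but ad (e + F) is homogeneous of degree 2 modulo d + 2, hence so is N,
   and thus N = 0. *)
lemma cyclic_diag_extends:
  assumes t: "trip e h f" and Q: "subspace Q" "\<And>x y. x \<in> Q \<Longrightarrow> y \<in> Q \<Longrightarrow> br x y \<in> Q"
    and "h \<in> Q"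
    and F: "br h F = (- of_nat d) *s F" and d: "even d" "d > 0"
    and diag: "diag_on Q (br (e + F))"
  shows "diag_on UNIV (br (e + F))"
proof -
  obtain z :: 'a where z: "z ^ (d + 2) = 1" "z ^ 2 \<noteq> 1" "z \<noteq> 0"
    using exists_root_of_unity[OF d] .
  define T where "T = br (e + F)"
  have T: "endo T" unfolding T_def by (rule ad_endo)
  have dT: "derivation T" unfolding T_def by (rule derivation_ad)
  define S where "S = gfun T (\<lambda>l. l)"
  have S: "endo S" unfolding S_def by (rule gfun_endo[OF T])
  define N where "N = (\<lambda>v. T v - S v)"
  have N: "endo N" unfolding N_def by (rule endo_subtract[OF T S])
  have dN: "derivation N"
    unfolding N_def S_def by (intro derivation_diff dT gfun_derivation[OF dT] refl)
  have "N h = 0" using diag \<open>h \<in> Q\<close> by (simp add: diag_on_def N_def S_def T_def)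
  then have Nh: "N (br h v) = br h (N v)" for v using dN by (simp add: derivation_def)
  \<comment> \<open>All weights are integers embedded in the field; the choice recovers the
    exponent, which is unique in characteristic 0.\<close>
  define \<psi> where "\<psi> l = z powi (SOME j. l = of_int j)" for l :: 'a
  have \<psi>: "\<psi> (of_int j) = z powi j" for j
  proof -
    have "(SOME i. (of_int j :: 'a) = of_int i) = j" by (rule some_equality) auto
    then show ?thesis by (simp add: \<psi>_def)
  qed
  define \<sigma> where "\<sigma> = gfun (br h) \<psi>"
  have \<sigma>: "endo \<sigma>" unfolding \<sigma>_def by (rule gfun_endo[OF ad_endo])
  have \<sigma>w: "\<sigma> v = z powi j *s v" if "br h v = of_int j *s v" for v j
    unfolding \<sigma>_def using gfun_on_GE[OF ad_endo weight_GE[OF that]] by (simp add: \<psi>)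
  have \<sigma>T: "\<sigma> (T v) = z ^ 2 *s T (\<sigma> v)" for v
  proof (rule endo_eq_on_GE[OF ad_endo[of h], where A = "\<lambda>v. \<sigma> (T v)" and B = "\<lambda>v. z ^ 2 *s T (\<sigma> v)"])
    show "endo (\<lambda>v. \<sigma> (T v))" by (rule endo_comp[OF \<sigma> T])
    show "endo (\<lambda>v. z ^ 2 *s T (\<sigma> v))" by (rule endo_smult[OF endo_comp[OF T \<sigma>]])
    fix l v assume v: "v \<in> GE (br h) l"
    show "\<sigma> (T v) = z ^ 2 *s T (\<sigma> v)"
    proof (cases "v = 0")
      case True
      then show ?thesis by (simp add: endo_0 \<sigma> T)
    next
      case False
      then obtain j where j: "l = of_int j" using sl2_integral[OF t v] by blast
      have hv: "br h v = of_int j *s v" using sl2_h_semisimple[OF t v] j by simp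
      have he: "br h e = 2 *s e" using t by (simp add: trip_def)
      have "br h (br e v) = of_int (j + 2) *s br e v"
        using weight_shift[OF he hv] by (simp add: add.commute)
      then have 1: "\<sigma> (br e v) = z powi (j + 2) *s br e v" by (rule \<sigma>w)
      have "br h (br F v) = of_int (j - int d) *s br F v"
        using weight_shift[OF F hv] by simp
      then have 2: "\<sigma> (br F v) = z powi (j - int d) *s br F v" by (rule \<sigma>w)
      have "z powi (j + 2) = z powi (j - int d) * z powi (int (d + 2))"
        using z(3) by (subst power_int_add[symmetric]) auto
      also have "z powi (int (d + 2)) = 1" using z(1) by (simp only: power_int_of_nat)
      finally have 3: "z powi (j - int d) = z powi (j + 2)" by simp
      have "\<sigma> (T v) = z powi (j + 2) *s T v"
        unfolding T_def br_add_left endo_add[OF \<sigma>] 1 2 3 by (simp add: scale_right_distrib)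
      also have "z powi (j + 2) = z ^ 2 * z powi j"
        using z(3) by (simp add: power_int_add mult.commute)
      finally show ?thesis by (simp add: \<sigma>w[OF hv] endo_scale[OF T])
    qed
  qed
  \<comment> \<open>\<open>\<sigma>\<close> maps the generalized eigenspace for \<open>l\<close>
    into the one for \<open>l / z ^ 2\<close>, so the semisimple part inherits the relation of
    \<open>T\<close>.\<close>
  have \<sigma>S: "\<sigma> (S v) = z ^ 2 *s S (\<sigma> v)" for v
  proof (rule endo_eq_on_GE[OF T, where A = "\<lambda>v. \<sigma> (S v)" and B = "\<lambda>v. z ^ 2 *s S (\<sigma> v)"])
    show "endo (\<lambda>v. \<sigma> (S v))" by (rule endo_comp[OF \<sigma> S])
    show "endo (\<lambda>v. z ^ 2 *s S (\<sigma> v))" by (rule endo_smult[OF endo_comp[OF S \<sigma>]])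
    fix l v assume v: "v \<in> GE T l"
    then obtain n where n: "(shift T l ^^ n) v = 0" by (auto simp: GE_def)
    let ?l = "l / z ^ 2"
    have "shift T ?l (\<sigma> u) = inverse (z ^ 2) *s \<sigma> (shift T l u)" for u
    proof -
      have "T (\<sigma> u) = inverse (z ^ 2) *s \<sigma> (T u)" using z(3) by (simp add: \<sigma>T)
      then show ?thesis
        by (simp add: shift_def endo_diff[OF \<sigma>] endo_scale[OF \<sigma>] scale_right_diff_distrib
            divide_inverse mult.commute)
    qed
    then have "(shift T ?l ^^ k) (\<sigma> v) = inverse (z ^ 2) ^ k *s \<sigma> ((shift T l ^^ k) v)" for k
      by (induction k) (simp_all add: endo_scale[OF shift_endo[OF T]] mult.commute)
    then have "(shift T ?l ^^ n) (\<sigma> v) = 0" by (simp only: n endo_0[OF \<sigma>] scale_zero_right)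
    then have "\<sigma> v \<in> GE T ?l" unfolding GE_def by blast
    then have "S (\<sigma> v) = ?l *s \<sigma> v" unfolding S_def by (rule gfun_on_GE[OF T])
    moreover have "S v = l *s v" unfolding S_def by (rule gfun_on_GE[OF T v])
    ultimately show "\<sigma> (S v) = z ^ 2 *s S (\<sigma> v)" using z(3) by (simp add: endo_scale[OF \<sigma>])
  qed
  have "N v = 0" for v
  proof (rule endo_eq_on_GE[OF ad_endo[of h] N endo_zero])
    fix l v assume v: "v \<in> GE (br h) l"
    show "N v = 0"
    proof (cases "v = 0")
      case True
      then show ?thesis by (simp add: endo_0 N)
    next
      case False
      then obtain j where j: "l = of_int j" using sl2_integral[OF t v] by blast
      have hv: "br h v = of_int j *s v" using sl2_h_semisimple[OF t v] j by simp
      then have "br h (N v) = of_int j *s N v" by (simp add: endo_scale[OF N] flip: Nh)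
      then have "\<sigma> (N v) = z powi j *s N v" by (rule \<sigma>w)
      moreover have "\<sigma> (N v) = z ^ 2 *s N (\<sigma> v)"
        by (simp add: N_def endo_diff[OF \<sigma>] \<sigma>S \<sigma>T scale_right_diff_distrib)
      ultimately have "(z ^ 2 * z powi j) *s N v = z powi j *s N v"
        by (simp add: \<sigma>w[OF hv] endo_scale[OF N])
      then show "N v = 0" using z(2,3) by (auto simp only: scale_cancel_right) auto
    qed
  qed
  then show ?thesis by (simp add: diag_on_def N_def S_def T_def)
qed

section \<open>The trace form\<close>

text \<open>The Killing form of the whole algebra. On a subalgebra its restriction is used, not the
  Killing form of that subalgebra.\<close>

definition kf :: "'v \<Rightarrow> 'v \<Rightarrow> 'a" where
  "kf a b = tr (\<lambda>v. br a (br b v))"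

lemma kf_sym: "kf a b = kf b a"
  unfolding kf_def by (rule tr_commute[OF ad_endo ad_endo])

lemma kf_add_left: "kf (a + b) c = kf a c + kf b c"
  by (simp add: kf_def br_add_left tr_add)

lemma kf_scale_left: "kf (s *s a) c = s * kf a c"
  by (simp add: kf_def br_scale_left tr_scale)

lemma kf_diff_left: "kf (a - b) c = kf a c - kf b c"
  by (simp add: kf_def br_diff_left tr_diff)

lemma kf_add_right: "kf c (a + b) = kf c a + kf c b"
  and kf_scale_right: "kf c (s *s a) = s * kf c a"
  by (simp_all add: kf_sym[of c] kf_add_left kf_scale_left)

lemma kf_0_left [simp]: "kf 0 c = 0"
  using kf_scale_left[of 0 0 c] by simp

lemma kf_0_right [simp]: "kf c 0 = 0"
  by (simp add: kf_sym[of c])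

text \<open>Cyclicity turns the trace of D [ad a, ad b] into that of [D, ad a] ad b, and [D, ad a]
  is ad (D a). This extends invariance of the form from inner derivations to the one built in
  Cartan's criterion.\<close>

lemma tr_derivation_br:
  assumes D: "derivation D"
  shows "tr (\<lambda>v. D (br (br a b) v)) = kf (D a) b"
proof -
  note e = derivation_endo[OF D]
  have "D (br (br a b) v) = D (br a (br b v)) - D (br b (br a v))" for v
    using jacobi[of a b v] by (simp add: endo_diff[OF e, symmetric])
  then have "tr (\<lambda>v. D (br (br a b) v))
      = tr (\<lambda>v. D (br a (br b v))) - tr (\<lambda>v. (\<lambda>v. D (br b v)) (br a v))"
    by (simp add: tr_diff)
  also have "tr (\<lambda>v. (\<lambda>v. D (br b v)) (br a v)) = tr (\<lambda>v. br a (D (br b v)))"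
    by (rule tr_commute[OF endo_comp[OF e ad_endo] ad_endo])
  also have "tr (\<lambda>v. D (br a (br b v))) - tr (\<lambda>v. br a (D (br b v))) = kf (D a) b"
    unfolding kf_def using D by (simp add: derivation_def flip: tr_diff)
  finally show ?thesis .
qed

lemma kf_invariant: "kf c (br a b) = kf (br c a) b"
  using tr_derivation_br[OF derivation_ad, of c a b] by (simp add: kf_def)

section \<open>Cartan's criterion\<close>

text \<open>Takes the place of complex conjugation over a general field of characteristic 0: the
  field is a vector space over the rationals, so rational functionals detect nonzero elements, and a
  vanishing sum of rational squares has only zero terms.\<close>

lemma rat_functional:
  assumes "(c::'a) \<noteq> 0"
  obtains \<phi> :: "'a \<Rightarrow> rat" where
    "\<And>x y. \<phi> (x + y) = \<phi> x + \<phi> y" "\<And>r x. \<phi> (of_rat r * x) = r * \<phi> x" "\<phi> c \<noteq> 0"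
proof -
  interpret p: vector_space_pair "\<lambda>r (x::'a). of_rat r * x" "(*) :: rat \<Rightarrow> rat \<Rightarrow> rat"
    by unfold_locales (simp_all add: of_rat_add of_rat_mult distrib_left distrib_right)
  have "p.vs1.independent {c}" using assms by (simp add: p.vs1.dependent_single)
  then obtain g where g: "Vector_Spaces.linear (\<lambda>r (x::'a). of_rat r * x) ((*) :: rat \<Rightarrow> rat \<Rightarrow> rat) g"
    "\<forall>x\<in>{c}. g x = 1"
    using p.linear_independent_extend[of "{c}" "\<lambda>_. 1"] by blast
  show ?thesis
    by (rule that[of g]) (use g in \<open>auto simp: Vector_Spaces.linear_iff\<close>)
qed

lemma rat_functional_sum:
  fixes \<phi> :: "'a \<Rightarrow> rat"
  assumes "\<And>x y. \<phi> (x + y) = \<phi> x + \<phi> y"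
  shows "\<phi> (sum g A) = (\<Sum>i\<in>A. \<phi> (g i))"
proof -
  have "\<phi> 0 = 0" using assms[of 0 0] by simp
  then show ?thesis by (induction A rule: infinite_finite_induct) (auto simp: assms)
qed

(* For a Q-linear functional phi on the field let D act by phi l on the generalized eigenspace of
   ad x for l. Then D is a derivation and the sum of phi l * l over the eigenvalues l is the trace
   of D o ad x, which vanishes; applying phi gives a vanishing sum of rational squares. *)
lemma cartan_nilpotent:
  assumes Q: "subspace Q" "\<And>x y. x \<in> Q \<Longrightarrow> y \<in> Q \<Longrightarrow> br x y \<in> Q"
    and P: "P \<subseteq> Q" "\<And>b c. b \<in> P \<Longrightarrow> c \<in> Q \<Longrightarrow> kf c b = 0"
    and x: "x \<in> Q" "x \<in> span {br a b | a b. a \<in> P \<and> b \<in> P}"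
  shows "\<exists>n. (br x ^^ n) v = 0"
proof -
  note e = ad_endo[of x]
  obtain B where B: "is_basis B" "B \<subseteq> (\<Union>l. GE (br x) l)" using GE_basis[OF e] .
  then have "\<forall>b\<in>B. \<exists>l. b \<in> GE (br x) l" by blast
  then obtain L where L: "\<And>b. b \<in> B \<Longrightarrow> b \<in> GE (br x) (L b)" by metis
  have "L b0 = 0" if b0: "b0 \<in> B" for b0
  proof (rule ccontr)
    assume "L b0 \<noteq> 0"
    then obtain \<phi> :: "'a \<Rightarrow> rat" where
      \<phi>: "\<And>x y. \<phi> (x + y) = \<phi> x + \<phi> y" "\<And>r x. \<phi> (of_rat r * x) = r * \<phi> x" "\<phi> (L b0) \<noteq> 0"
      using rat_functional by metis
    define D where "D = gfun (br x) (\<lambda>l. of_rat (\<phi> l))"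
    define S where "S = gfun (br x) (\<lambda>l. l)"
    have D: "derivation D" unfolding D_def
      by (rule gfun_derivation[OF derivation_ad]) (simp add: \<phi> of_rat_add)
    have eD: "endo D" by (rule derivation_endo[OF D])
    have eS: "endo S" unfolding S_def by (rule gfun_endo[OF e])
    have DQ: "D a \<in> Q" if "a \<in> Q" for a
      unfolding D_def by (rule gfun_in_subspace[OF e Q(1) _ that]) (use Q x in auto)
    have z: "tr (\<lambda>v. D (br y v)) = 0" if "y \<in> span {br a b | a b. a \<in> P \<and> b \<in> P}" for y
      using that
    proof (induction rule: span_induct_alt)
      case base
      show ?case by (simp add: endo_0[OF eD] tr_def basis_rep[OF Basis_is_basis])
    next
      case (step c u w)
      then obtain a b where ab: "u = br a b" "a \<in> P" "b \<in> P" by blast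
      then have "tr (\<lambda>v. D (br u v)) = 0"
        using tr_derivation_br[OF D, of a b] P DQ by auto
      then show ?case using step
        by (simp add: br_add_left br_scale_left endo_add[OF eD] endo_scale[OF eD] tr_add tr_scale)
    qed
    have "S (br x v) = br x (S v)" for v unfolding S_def by (rule gfun_commute[OF e e refl])
    then have DS: "D (S v) = S (D v)" for v unfolding D_def by (rule gfun_commute[OF e eS])
    have Dx: "D (br x v) = br x (D v)" for v unfolding D_def by (rule gfun_commute[OF e e refl])
    let ?N = "\<lambda>v. br x v - S v"
    have eN: "endo ?N" by (rule endo_subtract[OF e eS])
    have DN: "?N (D v) = D (?N v)" for v by (simp add: endo_diff[OF eD] Dx DS)
    \<comment> \<open>Since \<open>D\<close> commutes with the nilpotent part of
      \<open>ad x\<close>, their product is nilpotent and has trace 0. So only the semisimple part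
      \<open>S\<close> contributes to the trace of \<open>D\<close> after
      \<open>ad x\<close>.\<close>
    have "((\<lambda>v. D (?N v)) ^^ n) v = (D ^^ n) ((?N ^^ n) v)" for n v
    proof (induction n)
      case (Suc n)
      have "?N ((D ^^ n) ((?N ^^ n) v)) = (D ^^ n) (?N ((?N ^^ n) v))"
        by (rule funpow_commute[of ?N D n "(?N ^^ n) v", OF DN])
      then show ?case using Suc by simp
    qed simp
    moreover have "\<exists>n. (?N ^^ n) v = 0" for v unfolding S_def by (rule gfun_diff_nilpotent[OF e])
    ultimately have "\<exists>n. ((\<lambda>v. D (?N v)) ^^ n) v = 0" for v
      using endo_0[OF endo_funpow[OF eD]] by metis
    then have "tr (\<lambda>v. D (?N v)) = 0" by (rule tr_nilpotent[OF endo_comp[OF eD eN]])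
    then have "tr (\<lambda>v. D (S v)) = 0"
      using z[OF x(2)] by (simp add: endo_diff[OF eD] tr_diff)
    moreover have "representation B (D (S b)) b = of_rat (\<phi> (L b)) * L b" if "b \<in> B" for b
    proof -
      have "S b = L b *s b" unfolding S_def by (rule gfun_on_GE[OF e L[OF that]])
      moreover have "D b = of_rat (\<phi> (L b)) *s b" unfolding D_def by (rule gfun_on_GE[OF e L[OF that]])
      ultimately show ?thesis
        by (simp add: endo_scale[OF eD] basis_rep[OF B(1)] representation_basis_elem[OF B(1) that])
    qed
    ultimately have "(\<Sum>b\<in>B. of_rat (\<phi> (L b)) * L b) = 0"
      using tr_basis[OF endo_comp[OF eD eS] B(1)] by simp
    then have "\<phi> (\<Sum>b\<in>B. of_rat (\<phi> (L b)) * L b) = 0" using \<phi>(2)[of 0 0] by simp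
    then have "(\<Sum>b\<in>B. \<phi> (L b) * \<phi> (L b)) = 0"
      unfolding rat_functional_sum[OF \<phi>(1)] \<phi>(2) .
    then have "\<phi> (L b0) * \<phi> (L b0) = 0"
      using B(1) b0 by (subst (asm) sum_nonneg_eq_0_iff) (auto simp: is_basis_def)
    then show False using \<phi>(3) by simp
  qed
  then have "B \<subseteq> GE (br x) 0" using L by force
  then show ?thesis by (rule nilpotent_basisI[OF e B(1)])
qed

section \<open>Engel's theorem\<close>

definition sub_alg :: "'v set \<Rightarrow> bool" where
  "sub_alg M \<longleftrightarrow> subspace M \<and> (\<forall>x\<in>M. \<forall>y\<in>M. br x y \<in> M)"

lemma max_dim_subspace:
  assumes "R A0" "\<And>A. R A \<Longrightarrow> subspace A"
  shows "\<exists>A. R A \<and> (\<forall>A'. R A' \<longrightarrow> A \<subseteq> A' \<longrightarrow> A' = A)"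
proof -
  have "\<exists>A. R A \<and> (\<forall>A'. R A' \<longrightarrow> dim A' \<le> dim A)"
    by (rule ex_has_greatest_nat[of R A0 dim "Suc dimension"])
       (use assms(1) dim_subset_UNIV in \<open>auto simp: less_Suc_eq_le\<close>)
  then obtain A where A: "R A" "\<And>A'. R A' \<Longrightarrow> dim A' \<le> dim A" by blast
  then have "A' = A" if "R A'" "A \<subseteq> A'" for A'
    using subspace_dim_equal[of A A'] assms(2) that by blast
  then show ?thesis using A(1) by blast
qed

lemma span_insert_subspace:
  "subspace A \<Longrightarrow> span (insert y A) = {x. \<exists>k. x - k *s y \<in> A}"
  unfolding span_insert by (metis span_eq_iff)

text \<open>A form of Engel's theorem without quotients: \<open>y\<close> represents a nonzero
  invariant vector of \<open>B / A\<close>. The induction uses it for \<open>M'\<close> acting on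
  \<open>M / M'\<close> and on \<open>B / A\<close>.\<close>

lemma engel:
  assumes "sub_alg M" "\<And>x v. x \<in> M \<Longrightarrow> \<exists>n. (br x ^^ n) v = 0"
    and "subspace A" "subspace B" "A \<subset> B"
    and "\<And>x a. x \<in> M \<Longrightarrow> a \<in> A \<Longrightarrow> br x a \<in> A" "\<And>x b. x \<in> M \<Longrightarrow> b \<in> B \<Longrightarrow> br x b \<in> B"
  shows "\<exists>y\<in>B - A. \<forall>x\<in>M. br x y \<in> A"
  using assms
proof (induction "dim M" arbitrary: M A B rule: less_induct)
  case less
  note sM = \<open>sub_alg M\<close>
  have subM: "subspace M" and brM: "\<And>x y. x \<in> M \<Longrightarrow> y \<in> M \<Longrightarrow> br x y \<in> M"
    using sM by (auto simp: sub_alg_def)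
  show ?case
  proof (cases "M = {0}")
    case True
    obtain y where "y \<in> B - A" using less.prems(5) by blast
    then show ?thesis using True subspace_0[OF less.prems(3)] by auto
  next
    case False
    define R where "R M' \<longleftrightarrow> sub_alg M' \<and> M' \<subset> M" for M'
    have "R {0}"
      using False subspace_0[OF subM] by (auto simp: R_def sub_alg_def subspace_def)
    moreover have "subspace A" if "R A" for A using that by (simp add: R_def sub_alg_def)
    ultimately have "\<exists>A. R A \<and> (\<forall>A'. R A' \<longrightarrow> A \<subseteq> A' \<longrightarrow> A' = A)"
      by (rule max_dim_subspace[of R "{0}"])
    then obtain M' where M': "sub_alg M'" "M' \<subset> M"
      and max: "\<And>M''. sub_alg M'' \<Longrightarrow> M'' \<subset> M \<Longrightarrow> M' \<subseteq> M'' \<Longrightarrow> M'' = M'"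
      unfolding R_def by blast
    have subM': "subspace M'" and brM': "\<And>x y. x \<in> M' \<Longrightarrow> y \<in> M' \<Longrightarrow> br x y \<in> M'"
      using M'(1) by (auto simp: sub_alg_def)
    have "span M' \<subset> span M" using M'(2) subM subM' by (simp add: span_eq_iff[THEN iffD2])
    then have dimM': "dim M' < dim M" by (rule dim_psubset)
    have nilM': "\<exists>n. (br x ^^ n) v = 0" if "x \<in> M'" for x v
      using less.prems(2) that M'(2) by blast
    \<comment> \<open>An element outside \<open>M'\<close> that normalizes it enlarges
      \<open>M'\<close> to a subalgebra, which by maximality is \<open>M\<close>. So
      \<open>M'\<close> is an ideal of codimension one.\<close>
    have "\<exists>y\<in>M - M'. \<forall>x\<in>M'. br x y \<in> M'"
      by (rule less.hyps[OF dimM' M'(1) nilM' subM' subM M'(2)]) (use brM' brM M'(2) in auto)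
    then obtain y where y: "y \<in> M" "y \<notin> M'" "\<And>x. x \<in> M' \<Longrightarrow> br x y \<in> M'" by blast
    let ?N = "span (insert y M')"
    have N: "?N = {x. \<exists>k. x - k *s y \<in> M'}" by (rule span_insert_subspace[OF subM'])
    have NM: "?N \<subseteq> M" using subM y(1) M'(2) by (intro span_minimal) auto
    have "sub_alg ?N"
      unfolding sub_alg_def
    proof (intro conjI ballI)
      fix a b assume "a \<in> ?N" "b \<in> ?N"
      then obtain j k where j: "a - j *s y \<in> M'" and k: "b - k *s y \<in> M'" unfolding N by blast
      let ?a = "a - j *s y" and ?b = "b - k *s y"
      have "br (?a + j *s y) (?b + k *s y) = br ?a ?b + k *s br ?a y + (- j) *s br ?b y"
        by (simp only: br_add_left br_add_right br_scale_left br_scale_right br_self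
            br_skew[of y ?b]) simp
      moreover have "\<dots> \<in> M'"
        by (intro subspace_add[OF subM'] subspace_scale[OF subM'] brM' j k y(3))
      ultimately have "br a b \<in> M'" by simp
      then show "br a b \<in> ?N" by (simp add: span_base)
    qed simp
    moreover have "M' \<subseteq> ?N" "?N \<noteq> M'" using y(2) span_superset[of "insert y M'"] by blast+
    ultimately have NeqM: "?N = M" using max NM by blast
    have "\<exists>w\<in>B - A. \<forall>x\<in>M'. br x w \<in> A"
      by (rule less.hyps[OF dimM' M'(1) nilM' less.prems(3,4,5)]) (use less.prems(6,7) M'(2) in auto)
    then obtain w where w: "w \<in> B" "w \<notin> A" "\<And>x. x \<in> M' \<Longrightarrow> br x w \<in> A" by blast
    \<comment> \<open>\<open>W\<close> modulo \<open>A\<close> consists of the invariants of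
      \<open>M'\<close> in \<open>B / A\<close>. It is stable under \<open>y\<close> because
      \<open>y\<close> normalizes \<open>M'\<close>, so the last vector of the
      \<open>y\<close>-orbit of \<open>w\<close> outside \<open>A\<close> is invariant under
      both.\<close>
    define W where "W = {w \<in> B. \<forall>x\<in>M'. br x w \<in> A}"
    have yW: "br y u \<in> W" if "u \<in> W" for u
    proof -
      have "br x (br y u) \<in> A" if "x \<in> M'" for x
        unfolding jacobi[of x y u] using \<open>u \<in> W\<close> that y less.prems(6)
        by (intro subspace_add[OF less.prems(3)]) (auto simp: W_def)
      then show ?thesis using that less.prems(7) y(1) by (auto simp: W_def)
    qed
    have powW: "(br y ^^ k) w \<in> W" for k
      by (induction k) (use w yW in \<open>auto simp: W_def\<close>)
    obtain n where "(br y ^^ n) w = 0" using less.prems(2) y(1) by blast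
    then have nA: "(br y ^^ n) w \<in> A" using subspace_0[OF less.prems(3)] by simp
    define m where "m = (LEAST n. (br y ^^ n) w \<in> A)"
    have mA: "(br y ^^ m) w \<in> A" unfolding m_def using nA by (rule LeastI)
    then obtain k where k: "m = Suc k" using w(2) by (cases m) auto
    have kA: "(br y ^^ k) w \<notin> A"
      using not_less_Least[of k "\<lambda>n. (br y ^^ n) w \<in> A"] k m_def by auto
    let ?u = "(br y ^^ k) w"
    have "br x ?u \<in> A" if "x \<in> M" for x
    proof -
      from that obtain j where j: "x - j *s y \<in> M'" unfolding NeqM[symmetric] N by blast
      have "br x ?u = br (x - j *s y) ?u + j *s br y ?u"
        by (simp add: br_diff_left br_scale_left)
      moreover have "br (x - j *s y) ?u \<in> A" using powW[of k] j by (auto simp: W_def)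
      moreover have "br y ?u \<in> A" using mA k by simp
      ultimately show ?thesis using less.prems(3) by (simp add: subspace_add subspace_scale)
    qed
    then show ?thesis using powW[of k] kA by (auto simp: W_def)
  qed
qed

text \<open>For a maximal proper ideal \<open>A\<close>, Engel's theorem gives \<open>y\<close>
  outside \<open>A\<close> with \<open>[L, y]\<close> inside \<open>A\<close>. Adjoining
  \<open>y\<close> to \<open>A\<close> gives an ideal, hence all of \<open>L\<close>, and then
  \<open>[L, L]\<close> lies in \<open>A\<close>, contradicting perfectness.\<close>

lemma perfect_nilpotent:
  assumes L: "sub_alg L" and nil: "\<And>x v. x \<in> L \<Longrightarrow> \<exists>n. (br x ^^ n) v = 0"
    and perf: "L \<subseteq> span {br a b | a b. a \<in> L \<and> b \<in> L}"
  shows "L = {0}"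
proof (rule ccontr)
  assume ne: "L \<noteq> {0}"
  have subL: "subspace L" and brL: "\<And>x y. x \<in> L \<Longrightarrow> y \<in> L \<Longrightarrow> br x y \<in> L"
    using L by (auto simp: sub_alg_def)
  define R where "R A \<longleftrightarrow> subspace A \<and> A \<subset> L \<and> (\<forall>x\<in>L. \<forall>a\<in>A. br x a \<in> A)" for A
  have "R {0}" using ne subspace_0[OF subL] by (auto simp: R_def subspace_def)
  moreover have "subspace A" if "R A" for A using that by (simp add: R_def)
  ultimately have "\<exists>A. R A \<and> (\<forall>A'. R A' \<longrightarrow> A \<subseteq> A' \<longrightarrow> A' = A)"
    by (rule max_dim_subspace[of R "{0}"])
  then obtain A where RA: "R A" and max: "\<And>A'. R A' \<Longrightarrow> A \<subseteq> A' \<Longrightarrow> A' = A" by blast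
  from RA have A: "subspace A" "A \<subset> L" "\<And>x a. x \<in> L \<Longrightarrow> a \<in> A \<Longrightarrow> br x a \<in> A"
    by (auto simp: R_def)
  from engel[OF L nil A(1) subL A(2) A(3) brL]
  obtain y where y: "y \<in> L" "y \<notin> A" "\<And>x. x \<in> L \<Longrightarrow> br x y \<in> A" by blast
  let ?N = "span (insert y A)"
  have N: "?N = {x. \<exists>k. x - k *s y \<in> A}" by (rule span_insert_subspace[OF A(1)])
  have NL: "?N \<subseteq> L" using subL y(1) A(2) by (intro span_minimal) auto
  have brA: "br x n \<in> A" if "x \<in> L" "n \<in> ?N" for x n
  proof -
    from that(2) obtain k where k: "n - k *s y \<in> A" unfolding N by blast
    have "br x n = br x (n - k *s y) + k *s br x y" by (simp add: br_diff_right br_scale_right)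
    then show ?thesis using A(3)[OF that(1) k] y(3)[OF that(1)] A(1)
      by (simp add: subspace_add subspace_scale)
  qed
  have AN: "A \<subseteq> ?N" "?N \<noteq> A" using y(2) span_superset[of "insert y A"] by blast+
  have "?N = L"
  proof (rule ccontr)
    assume "?N \<noteq> L"
    then have "R ?N" using NL brA AN(1) by (auto simp: R_def)
    then show False using max AN by blast
  qed
  then have "{br a b | a b. a \<in> L \<and> b \<in> L} \<subseteq> A" using brA by auto
  then have "L \<subseteq> A" using perf span_minimal[OF _ A(1)] by blast
  then show False using A(2) by blast
qed

section \<open>Semisimple subalgebras\<close>

lemma lin_span_eq: "lin_span (*s) S = span S"
  unfolding lin_span_def span_explicit by auto

lemma subsp_eq: "subsp (*s) L = subspace L"
  by (auto simp: subsp_def subspace_def)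

lemma semisimple_sub_alg: "semisimple_lie (*s) br Q \<Longrightarrow> sub_alg Q"
  by (auto simp: semisimple_lie_def lie_subalg_def sub_alg_def subsp_eq)

text \<open>The centre is an abelian, hence solvable, ideal.\<close>

lemma semisimple_center:
  assumes ss: "semisimple_lie (*s) br Q" and z: "z \<in> Q" "\<And>y. y \<in> Q \<Longrightarrow> br z y = 0"
  shows "z = 0"
proof -
  have Q: "subspace Q" "\<And>x y. x \<in> Q \<Longrightarrow> y \<in> Q \<Longrightarrow> br x y \<in> Q"
    using semisimple_sub_alg[OF ss] by (auto simp: sub_alg_def)
  let ?I = "{z \<in> Q. \<forall>y\<in>Q. br z y = 0}"
  have "subspace ?I"
    using Q(1) by (auto simp: subspace_def br_add_left br_scale_left)
  moreover have "br x y \<in> ?I" if x: "x \<in> Q" and y: "y \<in> ?I" for x y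
  proof -
    have "br x y = 0" using br_skew[of x y] x y by simp
    then show ?thesis using Q(1) by (simp add: subspace_0)
  qed
  ultimately have "lie_ideal (*s) br Q ?I" by (auto simp: lie_ideal_def subsp_eq)
  moreover have "{br x y |x y. x \<in> ?I \<and> y \<in> ?I} = {0}"
    using Q(1) by (auto simp: subspace_0 intro!: exI[of _ 0])
  then have "derived (*s) br ?I 1 = {0}" by (simp add: lin_span_eq)
  then have "solvable_lie (*s) br ?I" unfolding solvable_lie_def by blast
  ultimately have "?I = {0}" using ss by (auto simp: semisimple_lie_def)
  then show ?thesis using z by blast
qed

text \<open>The radical of the form on \<open>Q\<close> is an ideal. Its derived series becomes
  stationary at a perfect algebra, whose elements act nilpotently on the whole space by Cartan's
  criterion. \<open>perfect_nilpotent\<close> makes that algebra zero, so the radical is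
  solvable.\<close>

lemma semisimple_nondegenerate:
  assumes ss: "semisimple_lie (*s) br Q" and z: "z \<in> Q" "\<And>y. y \<in> Q \<Longrightarrow> kf z y = 0"
  shows "z = 0"
proof -
  have Q: "subspace Q" "\<And>x y. x \<in> Q \<Longrightarrow> y \<in> Q \<Longrightarrow> br x y \<in> Q"
    using semisimple_sub_alg[OF ss] by (auto simp: sub_alg_def)
  define r where "r = {z \<in> Q. \<forall>y\<in>Q. kf z y = 0}"
  have sr: "subspace r"
    using Q(1) by (auto simp: r_def subspace_def kf_add_left kf_scale_left)
  have ir: "br x y \<in> r" if "x \<in> Q" "y \<in> r" for x y
  proof -
    have "kf (br x y) w = - kf y (br x w)" for w
    proof -
      have "kf (br x y) w = kf x (br y w)" by (rule kf_invariant[symmetric])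
      also have "\<dots> = kf (br y w) x" by (rule kf_sym)
      also have "br y w = - br w y" by (rule br_skew)
      also have "kf (- br w y) x = - kf (br w y) x" using kf_diff_left[of 0 "br w y" x] by simp
      also have "kf (br w y) x = kf w (br y x)" by (rule kf_invariant[symmetric])
      also have "\<dots> = kf (br y x) w" by (rule kf_sym)
      also have "\<dots> = kf y (br x w)" by (rule kf_invariant[symmetric])
      finally show ?thesis .
    qed
    then show ?thesis using that Q(2) by (auto simp: r_def)
  qed
  define P where "P n = derived (*s) br r n" for n
  have P0: "P 0 = r" and PS: "P (Suc n) = span {br a b | a b. a \<in> P n \<and> b \<in> P n}" for n
    by (simp_all add: P_def lin_span_eq)
  have sP: "subspace (P n)" for n by (cases n) (simp_all add: P0 PS sr)
  have dec: "P (Suc n) \<subseteq> P n" for n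
  proof (induction n)
    case 0
    show ?case unfolding P0 PS using sr ir by (intro span_minimal) (auto simp: r_def)
  next
    case (Suc n)
    then show ?case unfolding PS[of "Suc n"] PS[of n] by (intro span_mono) auto
  qed
  have Pr: "P n \<subseteq> r" for n by (induction n) (use P0 dec in auto)
  \<comment> \<open>A term of least dimension; its successor is contained in it and cannot be
    smaller.\<close>
  obtain n where n: "\<And>k. dim (P n) \<le> dim (P k)"
    using ex_has_least_nat[of "\<lambda>_. True" 0 "\<lambda>k. dim (P k)"] by auto
  have eq: "P (Suc n) = P n" by (rule subspace_dim_equal[OF sP sP dec n])
  have PQ: "P n \<subseteq> Q" using Pr by (auto simp: r_def)
  have "P n = {0}"
  proof (rule perfect_nilpotent)
    show perf: "P n \<subseteq> span {br a b | a b. a \<in> P n \<and> b \<in> P n}" using eq PS by auto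
    show "sub_alg (P n)" unfolding sub_alg_def
    proof (intro conjI ballI sP)
      fix x y assume "x \<in> P n" "y \<in> P n"
      then have "br x y \<in> P (Suc n)" unfolding PS by (intro span_base) blast
      then show "br x y \<in> P n" by (simp add: eq)
    qed
    fix x v assume x: "x \<in> P n"
    show "\<exists>k. (br x ^^ k) v = 0"
    proof (rule cartan_nilpotent[OF Q PQ])
      show "kf c b = 0" if "b \<in> P n" "c \<in> Q" for b c
        using that Pr kf_sym[of c b] by (auto simp: r_def)
      show "x \<in> span {br a b |a b. a \<in> P n \<and> b \<in> P n}" using x perf by blast
      show "x \<in> Q" using x PQ by blast
    qed
  qed
  then have "solvable_lie (*s) br r" unfolding solvable_lie_def P_def by blast
  moreover have "lie_ideal (*s) br Q r"
    using sr ir by (auto simp: lie_ideal_def subsp_eq r_def)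
  ultimately have "r = {0}" using ss by (auto simp: semisimple_lie_def)
  then show ?thesis using z by (auto simp: r_def)
qed

text \<open>If \<open>x - u\<close> is orthogonal to \<open>Q\<close>, it maps \<open>Q\<close> into
  \<open>Q\<close> and, by invariance of the form, into the orthogonal space of \<open>Q\<close>,
  hence to zero.\<close>

lemma semisimple_split:
  assumes ss: "semisimple_lie (*s) br Q" and x: "\<And>y. y \<in> Q \<Longrightarrow> br x y \<in> Q"
  obtains u where "u \<in> Q" "\<And>y. y \<in> Q \<Longrightarrow> br (x - u) y = 0"
proof -
  have Q: "subspace Q" "\<And>x y. x \<in> Q \<Longrightarrow> y \<in> Q \<Longrightarrow> br x y \<in> Q"
    using semisimple_sub_alg[OF ss] by (auto simp: sub_alg_def)
  obtain B where B: "B \<subseteq> Q" "independent B" "Q \<subseteq> span B"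
    by (rule maximal_independent_subset)
  have fB: "finite B" using B(2) by (rule finiteI_independent)
  \<comment> \<open>\<open>T v\<close> stores the functional \<open>kf v\<close> on \<open>Q\<close>
    as an element of \<open>Q\<close>. Nondegeneracy makes it injective on \<open>Q\<close>, hence
    onto \<open>Q\<close>, so some \<open>u\<close> in \<open>Q\<close> induces the same functional
    as \<open>x\<close>.\<close>
  define T where "T v = (\<Sum>b\<in>B. kf v b *s b)" for v
  have T: "endo T" unfolding T_def
    by (rule endoI)
       (simp_all add: kf_add_left kf_scale_left scale_left_distrib sum.distrib scale_sum_right)
  have TQ: "T v \<in> Q" for v
    unfolding T_def using B(1) by (intro subspace_sum subspace_scale Q(1)) auto
  have T0: "kf v y = 0" if "T v = 0" "y \<in> Q" for v y
  proof -
    have k0: "kf v b = 0" if "b \<in> B" for b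
      using B(2) fB \<open>T v = 0\<close> that unfolding T_def independent_explicit by blast
    have "y \<in> span B" using B(3) that(2) by blast
    then show ?thesis
      by (induction rule: span_induct_alt) (simp_all add: kf_add_right kf_scale_right k0)
  qed
  have inj: "inj_on T (span Q)"
  proof (rule inj_onI)
    fix a b assume "a \<in> span Q" "b \<in> span Q" "T a = T b"
    then have ab: "a \<in> Q" "b \<in> Q" "T (a - b) = 0"
      using Q(1) by (simp_all add: span_eq_iff[THEN iffD2] endo_diff[OF T])
    then have "a - b = 0"
      using semisimple_nondegenerate[OF ss] T0 Q(1) by (meson subspace_diff)
    then show "a = b" by simp
  qed
  interpret pair: finite_dimensional_vector_space_pair_1 "(*s)" Basis "(*s)" ..
  have "dim (T ` Q) = dim Q" by (rule pair.dim_image_eq[OF T inj])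
  moreover have "subspace (T ` Q)" using T Q(1) by (rule pair.linear_subspace_image)
  ultimately have "T ` Q = Q" using TQ Q(1) by (intro subspace_dim_equal) auto
  then obtain u where u: "u \<in> Q" "T u = T x" using TQ[of x] by (metis imageE)
  have kfz: "kf (x - u) y = 0" if "y \<in> Q" for y
    by (rule T0[OF _ that]) (simp add: endo_diff[OF T] u)
  have "br (x - u) y = 0" if "y \<in> Q" for y
  proof (rule semisimple_nondegenerate[OF ss])
    show "br (x - u) y \<in> Q"
      unfolding br_diff_left by (intro subspace_diff[OF Q(1)] x Q(2) u that)
    show "kf (br (x - u) y) w = 0" if "w \<in> Q" for w
      using kfz[OF Q(2)[OF \<open>y \<in> Q\<close> that]] by (simp add: kf_invariant)
  qed
  then show ?thesis using u(1) that by blast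
qed


section \<open>Automorphisms\<close>

definition autom :: "('v \<Rightarrow> 'v) \<Rightarrow> bool" where
  "autom \<phi> \<longleftrightarrow> endo \<phi> \<and> bij \<phi> \<and> (\<forall>a b. \<phi> (br a b) = br (\<phi> a) (\<phi> b))"

lemma autom_endo: "autom \<phi> \<Longrightarrow> endo \<phi>"
  and autom_inj: "autom \<phi> \<Longrightarrow> inj \<phi>"
  and autom_surj: "autom \<phi> \<Longrightarrow> surj \<phi>"
  and autom_br: "autom \<phi> \<Longrightarrow> \<phi> (br a b) = br (\<phi> a) (\<phi> b)"
  by (auto simp: autom_def bij_def)

lemma autom_id: "autom id"
  by (auto simp: autom_def intro!: endoI)

lemma autom_comp: "autom \<phi> \<Longrightarrow> autom \<psi> \<Longrightarrow> autom (\<phi> \<circ> \<psi>)"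
  unfolding autom_def by (auto simp: bij_comp intro!: endoI simp: endo_add endo_scale)

lemma autom_inv:
  assumes "autom \<phi>" shows "autom (inv_into UNIV \<phi>)"
proof -
  note s = surj_f_inv_f[OF autom_surj[OF assms]] and i = inv_f_f[OF autom_inj[OF assms]]
  have *: "inv_into UNIV \<phi> x = y" if "x = \<phi> y" for x y using that i by simp
  have "endo (inv_into UNIV \<phi>)"
    by (rule endoI; rule *) (simp_all add: endo_add[OF autom_endo[OF assms]]
        endo_scale[OF autom_endo[OF assms]] s)
  moreover have "bij (inv_into UNIV \<phi>)" using assms by (simp add: autom_def bij_imp_bij_inv)
  moreover have "inv_into UNIV \<phi> (br a b) = br (inv_into UNIV \<phi> a) (inv_into UNIV \<phi> b)" for a b
    by (rule *) (simp add: autom_br[OF assms] s)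
  ultimately show ?thesis by (simp add: autom_def)
qed

text \<open>Divided powers of \<open>ad x\<close> turn the Leibniz formula into a convolution
  without binomial coefficients.\<close>

definition dpow :: "'v \<Rightarrow> nat \<Rightarrow> 'v \<Rightarrow> 'v" where
  "dpow x k y = inverse (fact k) *s (br x ^^ k) y"

lemma dpow_endo: "endo (dpow x k)"
  unfolding dpow_def by (rule endo_smult[OF endo_funpow[OF ad_endo]])

lemma dpow_0: "dpow x 0 y = y"
  by (simp add: dpow_def)

lemma br_dpow: "br x (dpow x k y) = of_nat (Suc k) *s dpow x (Suc k) y"
  by (simp add: dpow_def br_scale_right fact_Suc del: of_nat_Suc)

lemma dpow_br: "dpow x n (br u v) = (\<Sum>i\<le>n. br (dpow x i u) (dpow x (n - i) v))"
proof (induction n)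
  case 0
  show ?case by (simp add: dpow_0)
next
  case (Suc n)
  let ?g = "\<lambda>i. br (dpow x i u) (dpow x (Suc n - i) v)"
  have "of_nat (Suc n) *s dpow x (Suc n) (br u v)
      = br x (\<Sum>i\<le>n. br (dpow x i u) (dpow x (n - i) v))"
    by (simp only: br_dpow[symmetric] Suc)
  also have "\<dots> = (\<Sum>i\<le>n. of_nat (Suc i) *s ?g (Suc i) + of_nat (Suc n - i) *s ?g i)"
    unfolding endo_sum[OF ad_endo] jacobi[of x]
    by (intro sum.cong refl) (simp add: br_dpow br_scale_left br_scale_right Suc_diff_le del: of_nat_Suc)
  also have "\<dots> = (\<Sum>i\<le>n. of_nat (Suc i) *s ?g (Suc i)) + (\<Sum>i\<le>n. of_nat (Suc n - i) *s ?g i)"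
    by (rule sum.distrib)
  also have "(\<Sum>i\<le>n. of_nat (Suc i) *s ?g (Suc i)) = (\<Sum>i\<le>Suc n. of_nat i *s ?g i)"
    by (subst sum.atMost_Suc_shift) simp
  also have "(\<Sum>i\<le>n. of_nat (Suc n - i) *s ?g i) = (\<Sum>i\<le>Suc n. of_nat (Suc n - i) *s ?g i)"
    by simp
  \<comment> \<open>The coefficients \<open>i\<close> and \<open>n + 1 - i\<close> add up to
    \<open>n + 1\<close>, which is cancelled at the end.\<close>
  also have "(\<Sum>i\<le>Suc n. of_nat i *s ?g i) + (\<Sum>i\<le>Suc n. of_nat (Suc n - i) *s ?g i)
      = (\<Sum>i\<le>Suc n. of_nat (Suc n) *s ?g i)"
    unfolding sum.distrib[symmetric]
    by (intro sum.cong refl) (simp add: scale_left_distrib[symmetric] of_nat_add[symmetric] del: of_nat_Suc of_nat_add)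
  also have "\<dots> = of_nat (Suc n) *s (\<Sum>i\<le>Suc n. ?g i)" by (rule scale_sum_right[symmetric])
  finally show ?case by (simp only: scale_cancel_left of_nat_eq_0_iff nat.distinct simp_thms)
qed

text \<open>Any exponent that kills everything may bound the series, so one exponential can be
  written with several lengths.\<close>

lemma exp_ad_eq:
  assumes "\<And>y. (br x ^^ K) y = 0"
  shows "exp_ad (*s) br UNIV x y = (\<Sum>k<K. dpow x k y)"
proof -
  let ?M = "nil_index br UNIV x"
  have ex: "\<exists>n. \<forall>y\<in>UNIV. (br x ^^ n) y = 0" using assms by auto
  have M: "\<forall>y\<in>UNIV. (br x ^^ ?M) y = 0" unfolding nil_index_def by (rule LeastI_ex[OF ex])
  have "?M \<le> K" unfolding nil_index_def by (rule Least_le) (use assms in auto)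
  have "dpow x k y = 0" if "k \<ge> ?M" for k
    using funpow_0_mono[OF ad_endo, where m = ?M and n = k] M that by (simp add: dpow_def)
  then have "(\<Sum>k<K. dpow x k y) = (\<Sum>k<?M. dpow x k y)"
    using \<open>?M \<le> K\<close> by (intro sum.mono_neutral_right) auto
  then show ?thesis by (simp add: exp_ad_def dpow_def)
qed

lemma autom_exp:
  assumes "ad_nilpotent br UNIV x"
  shows "autom (exp_ad (*s) br UNIV x)"
proof -
  let ?E = "exp_ad (*s) br UNIV x"
  obtain M where M: "\<And>y. (br x ^^ M) y = 0" using assms by (auto simp: ad_nilpotent_def)
  have z: "dpow x k y = 0" if "k \<ge> M" for k y
    using funpow_0_mono[OF ad_endo M that] by (simp add: dpow_def)
  \<comment> \<open>At twice the length the triangle of index pairs contains the square of side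
    \<open>M\<close>, and each pair outside the square has a vanishing factor.\<close>
  have M2: "(br x ^^ (2 * M)) y = 0" for y by (rule funpow_0_mono[OF ad_endo M]) simp
  have eE: "endo ?E"
    unfolding exp_ad_eq[OF M] by (rule endo_sum_fun[OF dpow_endo])
  have hom: "?E (br u v) = br (?E u) (?E v)" for u v
  proof -
    have "?E (br u v) = (\<Sum>n<2 * M. \<Sum>i\<le>n. br (dpow x i u) (dpow x (n - i) v))"
      by (simp only: exp_ad_eq[OF M2] dpow_br)
    also have "\<dots> = (\<Sum>(i, j)\<in>{(i, j). i + j < 2 * M}. br (dpow x i u) (dpow x j v))"
      by (rule sum.triangle_reindex[symmetric])
    also have "\<dots> = (\<Sum>(i, j)\<in>{..<M} \<times> {..<M}. br (dpow x i u) (dpow x j v))"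
    proof (rule sum.mono_neutral_right)
      have "{(i, j). i + j < 2 * M} \<subseteq> {..2 * M} \<times> {..2 * M}" by auto
      then show "finite {(i, j). i + j < 2 * M}" by (rule finite_subset) simp
      show "{..<M} \<times> {..<M} \<subseteq> {(i, j). i + j < 2 * M}" by auto
      show "\<forall>p\<in>{(i, j). i + j < 2 * M} - {..<M} \<times> {..<M}.
          (case p of (i, j) \<Rightarrow> br (dpow x i u) (dpow x j v)) = 0"
      proof
        fix p assume "p \<in> {(i, j). i + j < 2 * M} - {..<M} \<times> {..<M}"
        then obtain i j where "p = (i, j)" "i \<ge> M \<or> j \<ge> M" by (cases p) (auto simp: not_less)
        then show "(case p of (i, j) \<Rightarrow> br (dpow x i u) (dpow x j v)) = 0" by (auto simp: z)
      qed
    qed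
    also have "\<dots> = (\<Sum>i<M. \<Sum>j<M. br (dpow x i u) (dpow x j v))"
      by (rule sum.cartesian_product[symmetric])
    also have "\<dots> = br (?E u) (?E v)"
      by (simp only: exp_ad_eq[OF M] endo_sum[OF ad_endo'] endo_sum[OF ad_endo]) (rule sum.swap)
    finally show ?thesis .
  qed
  \<comment> \<open>The highest power of \<open>ad x\<close> not killing \<open>v\<close>
    annihilates every term of the series but the zeroth.\<close>
  have "v = 0" if "?E v = 0" for v
  proof (rule ccontr)
    assume "v \<noteq> 0"
    from funpow_last_nonzero[OF M this] obtain k where
      k: "(br x ^^ k) v \<noteq> 0" "br x ((br x ^^ k) v) = 0" by blast
    have "(br x ^^ k) (dpow x i v) = (if i = 0 then (br x ^^ k) v else 0)" for i
    proof (cases i)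
      case 0
      then show ?thesis by (simp add: dpow_0)
    next
      case (Suc j)
      have "(br x ^^ k) ((br x ^^ i) v) = (br x ^^ (i + k)) v"
        by (simp add: funpow_add add.commute[of i k])
      also have "\<dots> = (br x ^^ i) ((br x ^^ k) v)" by (simp add: funpow_add)
      also have "\<dots> = (br x ^^ j) (br x ((br x ^^ k) v))"
        by (simp only: Suc funpow_Suc_right comp_apply)
      finally have "(br x ^^ k) ((br x ^^ i) v) = 0"
        by (simp only: k(2) endo_0[OF endo_funpow[OF ad_endo]])
      then show ?thesis using Suc
        by (simp add: dpow_def endo_scale[OF endo_funpow[OF ad_endo]] del: funpow.simps)
    qed
    then have "(br x ^^ k) (?E v) = (\<Sum>i<M. if i = 0 then (br x ^^ k) v else 0)"
      by (simp only: exp_ad_eq[OF M] endo_sum[OF endo_funpow[OF ad_endo]])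
    also have "\<dots> = (br x ^^ k) v" using M[of v] \<open>v \<noteq> 0\<close> by (cases M) (auto simp: sum.delta)
    finally show False using k that by (simp add: endo_0[OF endo_funpow[OF ad_endo]])
  qed
  then have "inj ?E"
    by (intro injI) (metis endo_diff[OF eE] eq_iff_diff_eq_0)
  then have "bij ?E" using linear_inj_imp_surj[OF eE] by (simp add: bij_def)
  then show ?thesis using eE hom by (simp add: autom_def)
qed

lemma autom_adj_group: "\<phi> \<in> adj_group (*s) br UNIV \<Longrightarrow> autom \<phi>"
  by (induction rule: adj_group.induct) (simp_all only: autom_id autom_comp autom_exp)

lemma autom_image_subspace:
  assumes "autom \<phi>" "subspace Q" "\<And>v. v \<in> Q \<Longrightarrow> \<phi> v \<in> Q"
  shows "\<phi> ` Q = Q"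
proof -
  interpret pair: finite_dimensional_vector_space_pair_1 "(*s)" Basis "(*s)" ..
  note e = autom_endo[OF assms(1)]
  have "dim (\<phi> ` Q) = dim Q"
    by (rule pair.dim_image_eq[OF e]) (use autom_inj[OF assms(1)] in \<open>auto intro: inj_on_subset\<close>)
  moreover have "subspace (\<phi> ` Q)" using e assms(2) by (rule pair.linear_subspace_image)
  ultimately show ?thesis using assms by (intro subspace_dim_equal) auto
qed

section \<open>Conjugacy of sl2-triples with a common nilpositive element\<close>

definition weights_ge :: "'v \<Rightarrow> nat \<Rightarrow> 'v \<Rightarrow> bool" where
  "weights_ge h k v \<longleftrightarrow> (\<forall>l. gcomp (br h) v l \<noteq> 0 \<longrightarrow> (\<exists>j\<ge>k. l = of_nat j))"

lemma weights_ge_add: "weights_ge h k u \<Longrightarrow> weights_ge h k v \<Longrightarrow> weights_ge h k (u + v)"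
  unfolding weights_ge_def endo_add[OF gcomp_endo[OF ad_endo]] by (metis add.left_neutral)

lemma weights_ge_scale: "weights_ge h k v \<Longrightarrow> weights_ge h k (c *s v)"
  unfolding weights_ge_def endo_scale[OF gcomp_endo[OF ad_endo]] by auto

lemma weights_ge_0: "weights_ge h k 0"
  unfolding weights_ge_def endo_0[OF gcomp_endo[OF ad_endo]] by auto

lemma weights_ge_sum: "(\<And>i. i \<in> A \<Longrightarrow> weights_ge h k (g i)) \<Longrightarrow> weights_ge h k (sum g A)"
  by (induction A rule: infinite_finite_induct) (auto simp: weights_ge_0 weights_ge_add)

lemma weights_ge_br:
  assumes "br h x = of_nat m *s x" "weights_ge h k v"
  shows "weights_ge h (k + m) (br x v)"
  unfolding weights_ge_def gcomp_weight[OF assms(1)]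
proof (intro allI impI)
  fix l assume "br x (gcomp (br h) v (l - of_nat m)) \<noteq> 0"
  then have "gcomp (br h) v (l - of_nat m) \<noteq> 0" by auto
  then obtain j where "j \<ge> k" "l - of_nat m = of_nat j" using assms(2) by (auto simp: weights_ge_def)
  then show "\<exists>j\<ge>k + m. l = of_nat j" by (intro exI[of _ "j + m"]) (auto simp: algebra_simps)
qed

lemma weights_ge_mono: "weights_ge h k v \<Longrightarrow> k' \<le> k \<Longrightarrow> weights_ge h k' v"
  unfolding weights_ge_def by (meson le_trans)

lemma weights_ge_funpow:
  assumes "br h x = of_nat m *s x" "weights_ge h k v"
  shows "weights_ge h (k + i * m) ((br x ^^ i) v)"
proof (induction i)
  case (Suc i)
  from weights_ge_br[OF assms(1) this] show ?case by (simp add: algebra_simps)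
qed (use assms in simp)

text \<open>\<open>h1 - h = e (f1 - f)\<close> lies in the image of \<open>e\<close> and is killed
  by \<open>e\<close>, so its components are primitive of natural weight. A component of weight 0 is
  killed by \<open>f\<close> too, yet it is \<open>e u\<close> with \<open>u\<close> of weight -2;
  this contradicts \<open>sl2_weight\<close>, which asks only for
  \<open>f (e u) = 0\<close>.\<close>

lemma triple_diff_weights:
  assumes t: "trip e h f" and t1: "trip e h1 f1"
  shows "weights_ge h 1 (h1 - h)"
  unfolding weights_ge_def
proof (intro allI impI)
  fix l assume "gcomp (br h) (h1 - h) l \<noteq> 0" (is "?w \<noteq> 0")
  note w0 = this
  have he: "br h e = 2 *s e" using t by (simp add: trip_def)
  have "h1 - h = br e (f1 - f)" using t t1 by (simp add: trip_def br_diff_right)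
  then have we: "?w = br e (gcomp (br h) (f1 - f) (l - 2))" (is "_ = br e ?u")
    by (simp only: gcomp_weight[OF he])
  have "br (h1 - h) e = 0" using t t1 by (simp add: trip_def br_diff_left)
  then have "br e (h1 - h) = 0" using br_skew[of e "h1 - h"] by simp
  then have ew: "br e ?w = 0"
    using gcomp_weight[OF he, of "h1 - h" "l + 2"] by (simp add: endo_0[OF gcomp_endo[OF ad_endo]])
  have hw: "br h ?w = l *s ?w" by (rule sl2_h_semisimple[OF t gcomp_GE[OF ad_endo]])
  have hu: "br h ?u = (l - 2) *s ?u" by (rule sl2_h_semisimple[OF t gcomp_GE[OF ad_endo]])
  have u0: "?u \<noteq> 0" using w0 we by auto
  obtain j where j: "l = of_nat j" using sl2_weight[OF t hw _ w0] ew by auto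
  have neg: "- 2 \<noteq> (of_nat k :: 'a)" for k
  proof
    assume "- 2 = (of_nat k :: 'a)"
    then have "of_nat (k + 2) = (0::'a)" by (simp add: add_eq_0_iff)
    then show False unfolding of_nat_eq_0_iff by simp
  qed
  have "j \<noteq> 0"
  proof
    assume "j = 0"
    then have l: "l = 0" using j by simp
    have "br h ?w = 0 *s ?w" using hw l by simp
    from sl2_chain[OF t this, of 0] ew have efw: "br e (br f ?w) = 0" by simp
    have hf: "br h f = (-2) *s f" using t by (simp add: trip_def)
    have "br f ?w = 0"
    proof (rule ccontr)
      assume n: "br f ?w \<noteq> 0"
      have "br h (br f ?w) = (- 2) *s br f ?w" using weight_shift[OF hf hw] l by simp
      from sl2_weight[OF t this _ n] efw neg show False by (metis br_0_right)
    qed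
    then have "br f (br e ?u) = 0" using we by simp
    moreover have "br h ?u = (- 2) *s ?u" using hu l by simp
    ultimately show False using sl2_weight[OF t _ _ u0] neg by metis
  qed
  then show "\<exists>j\<ge>1. l = of_nat j" using j by auto
qed

(* exp (ad x) with x = v_k / k moves h + v_k + (higher terms) to h + (higher terms), where v_k is
   the component of weight k of h1 - h. *)
lemma triple_conjugate_step:
  assumes t: "trip e h f" and Q: "subspace Q" "\<And>x y. x \<in> Q \<Longrightarrow> y \<in> Q \<Longrightarrow> br x y \<in> Q" "h \<in> Q"
    and h1: "h1 \<in> Q" "br h1 e = 2 *s e" and k: "k \<ge> 1" "weights_ge h k (h1 - h)"
  obtains \<phi> where "autom \<phi>" "\<phi> ` Q = Q" "\<phi> e = e" "weights_ge h (Suc k) (\<phi> h1 - h)"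
proof -
  define v where "v = h1 - h"
  define vk where "vk = gcomp (br h) v (of_nat k)"
  define x where "x = inverse (of_nat k) *s vk"
  have k0: "of_nat k \<noteq> (0::'a)" using k by auto
  have vk: "vk = of_nat k *s x" using k0 by (simp add: x_def)
  have he: "br h e = 2 *s e" using t by (simp add: trip_def)
  have "v \<in> Q" unfolding v_def by (intro subspace_diff Q h1)
  then have "vk \<in> Q" unfolding vk_def by (intro gcomp_in_subspace[OF ad_endo] Q)
  then have xQ: "x \<in> Q" unfolding x_def by (intro subspace_scale Q)
  have hvk: "br h vk = of_nat k *s vk"
    unfolding vk_def by (rule sl2_h_semisimple[OF t gcomp_GE[OF ad_endo]])
  then have hx: "br h x = of_nat k *s x" by (simp add: x_def br_scale_right mult.commute)
  have "br e v = 0" using he h1(2) br_skew[of e v] by (simp add: v_def br_diff_left)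
  then have "br e vk = 0"
    unfolding vk_def using gcomp_weight[OF he, of v "of_nat k + 2"]
    by (simp add: endo_0[OF gcomp_endo[OF ad_endo]])
  then have "br e x = 0" by (simp add: x_def br_scale_right)
  then have xe: "br x e = 0" using br_skew[of x e] by simp
  obtain K where K: "\<And>u. (br x ^^ K) u = 0" using ad_nilpotentI[OF hx k0] by blast
  \<comment> \<open>A length of at least 2 lets the terms of order 0 and 1 be split off.\<close>
  then have K: "(br x ^^ Suc (Suc K)) u = 0" for u
    by (intro funpow_0_mono[OF ad_endo K]) auto
  let ?K = "Suc (Suc K)"
  define \<phi> where "\<phi> = exp_ad (*s) br UNIV x"
  have \<phi>: "\<phi> u = (\<Sum>i<?K. dpow x i u)" for u unfolding \<phi>_def by (rule exp_ad_eq[OF K])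
  have a: "autom \<phi>" unfolding \<phi>_def by (rule autom_exp) (use K in \<open>unfold ad_nilpotent_def, blast\<close>)
  have "\<phi> u \<in> Q" if "u \<in> Q" for u
  proof -
    have "(br x ^^ i) u \<in> Q" for i by (induction i) (use that Q xQ in auto)
    then show ?thesis unfolding \<phi> dpow_def using Q(1) by (intro subspace_sum subspace_scale) auto
  qed
  then have \<phi>Q: "\<phi> ` Q = Q" by (rule autom_image_subspace[OF a Q(1)])
  have split: "\<phi> u = u + (\<Sum>i<Suc K. dpow x (Suc i) u)" for u
    unfolding \<phi> by (subst sum.lessThan_Suc_shift) (simp only: dpow_0)
  have pow_Suc: "(br x ^^ Suc i) u = (br x ^^ i) (br x u)" for i u
    by (simp only: funpow_Suc_right comp_apply)
  have "dpow x (Suc i) e = 0" for i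
    by (simp only: dpow_def pow_Suc xe endo_0[OF endo_funpow[OF ad_endo]] scale_zero_right)
  then have \<phi>e: "\<phi> e = e" by (simp only: split sum.neutral_const add_0_right)
  \<comment> \<open>\<open>[x, h] = - k x\<close> is a multiple of \<open>x\<close>, so the series
    at \<open>h\<close> stops after its linear term. The factor \<open>1 / k\<close> in
    \<open>x\<close> makes that term exactly \<open>- vk\<close>.\<close>
  have xh: "br x h = - vk" using br_skew[of x h] hx vk by simp
  have xxh: "br x (br x h) = 0" by (simp add: xh vk br_minus_right br_scale_right br_self)
  have "dpow x (Suc i) h = (if i = 0 then - vk else 0)" for i
  proof (cases i)
    case 0
    then show ?thesis by (simp add: dpow_def xh)
  next
    case (Suc i')
    then show ?thesis
      by (simp only: dpow_def pow_Suc xxh endo_0[OF endo_funpow[OF ad_endo]] scale_zero_right nat.distinct if_False)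
  qed
  then have \<phi>h: "\<phi> h = h - vk" by (simp only: split) (simp add: sum.delta del: sum.lessThan_Suc)
  have "h1 = h + v" by (simp add: v_def)
  then have "\<phi> h1 = \<phi> h + \<phi> v" by (simp only: endo_add[OF autom_endo[OF a]])
  then have eq: "\<phi> h1 - h = (v + (-1) *s vk) + (\<Sum>i<Suc K. dpow x (Suc i) v)"
    by (simp only: \<phi>h split[of v]) simp
  have v: "weights_ge h k v" using k(2) by (simp add: v_def)
  have w1: "weights_ge h (Suc k) (v + (-1) *s vk)"
    unfolding weights_ge_def
  proof (intro allI impI)
    fix l assume l: "gcomp (br h) (v + (-1) *s vk) l \<noteq> 0"
    have g: "gcomp (br h) (v + (-1) *s vk) l
        = gcomp (br h) v l - (if l = of_nat k then vk else 0)"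
      using gcomp_on_GE[OF ad_endo weight_GE[OF hvk], of l]
      by (simp only: endo_add[OF gcomp_endo[OF ad_endo]] endo_scale[OF gcomp_endo[OF ad_endo]]) simp
    have "l \<noteq> of_nat k" using l unfolding g by (auto simp: vk_def)
    then have "gcomp (br h) v l \<noteq> 0" using l unfolding g by simp
    then obtain j where "j \<ge> k" "l = of_nat j" using v by (auto simp: weights_ge_def)
    moreover have "j \<noteq> k" using \<open>l \<noteq> _\<close> calculation(2) by auto
    ultimately show "\<exists>j\<ge>Suc k. l = of_nat j" by (intro exI[of _ j]) auto
  qed
  have w2: "weights_ge h (Suc k) (dpow x (Suc i) v)" for i
  proof -
    have "Suc k \<le> k + Suc i * k" using k(1) by simp
    then show ?thesis unfolding dpow_def
      by (intro weights_ge_scale weights_ge_mono[OF weights_ge_funpow[OF hx v]])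
  qed
  have "weights_ge h (Suc k) (\<phi> h1 - h)"
    unfolding eq by (rule weights_ge_add[OF w1 weights_ge_sum[OF w2]])
  then show ?thesis using that a \<phi>Q \<phi>e by blast
qed

text \<open>Each step raises the least weight of the difference, and only finitely many weights
  occur. Matching \<open>e\<close> and \<open>h\<close> is the aim, since grading and depth are read
  off from \<open>h\<close>. The subalgebra \<open>Q\<close> is kept stable so that the result
  serves both the whole algebra and \<open>q\<close>.\<close>

lemma triple_conjugate:
  assumes t: "trip e h f" and t1: "trip e h1 f1"
    and Q: "subspace Q" "\<And>x y. x \<in> Q \<Longrightarrow> y \<in> Q \<Longrightarrow> br x y \<in> Q" "h \<in> Q" "h1 \<in> Q"
  obtains \<phi> where "autom \<phi>" "\<phi> ` Q = Q" "\<phi> e = e" "\<phi> h1 = h"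
proof -
  have "\<exists>\<phi>. autom \<phi> \<and> \<phi> ` Q = Q \<and> \<phi> e = e \<and> weights_ge h (Suc k) (\<phi> h1 - h)" for k
  proof (induction k)
    case 0
    show ?case using triple_diff_weights[OF t t1] by (intro exI[of _ id]) (simp add: autom_id[unfolded id_def])
  next
    case (Suc k)
    then obtain \<phi> where \<phi>: "autom \<phi>" "\<phi> ` Q = Q" "\<phi> e = e" "weights_ge h (Suc k) (\<phi> h1 - h)" by blast
    have "br h1 e = 2 *s e" using t1 by (simp add: trip_def)
    then have "br (\<phi> h1) e = 2 *s e"
      using autom_br[OF \<phi>(1), of h1 e] \<phi>(3) by (simp add: endo_scale[OF autom_endo[OF \<phi>(1)]])
    moreover have "\<phi> h1 \<in> Q" using \<phi>(2) Q(4) by blast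
    ultimately obtain \<psi> where \<psi>: "autom \<psi>" "\<psi> ` Q = Q" "\<psi> e = e" "weights_ge h (Suc (Suc k)) (\<psi> (\<phi> h1) - h)"
      using triple_conjugate_step[OF t Q(1-3) _ _ _ \<phi>(4)] by auto
    moreover have "(\<psi> \<circ> \<phi>) ` Q = Q" using \<phi>(2) \<psi>(2) by (metis image_comp)
    moreover have "(\<psi> \<circ> \<phi>) e = e" using \<phi>(3) \<psi>(3) by simp
    moreover have "weights_ge h (Suc (Suc k)) ((\<psi> \<circ> \<phi>) h1 - h)" using \<psi>(4) by simp
    ultimately show ?case using autom_comp[OF \<psi>(1) \<phi>(1)] by blast
  qed
  moreover obtain k where k: "\<And>j. j \<ge> k \<Longrightarrow> of_nat j \<notin> gspec (br h)"
  proof -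
    have "finite (of_nat -` gspec (br h) :: nat set)"
      by (rule finite_vimageI[OF finite_gspec[OF ad_endo]]) (simp add: inj_def)
    then obtain m where "\<forall>j\<in>of_nat -` gspec (br h). j \<le> m" using finite_nat_set_iff_bounded_le by blast
    then show ?thesis by (intro that[of "Suc m"]) force
  qed
  ultimately obtain \<phi> where \<phi>: "autom \<phi>" "\<phi> ` Q = Q" "\<phi> e = e" "weights_ge h (Suc k) (\<phi> h1 - h)" by metis
  have "gcomp (br h) (\<phi> h1 - h) l = 0" for l
  proof (rule ccontr)
    assume n: "gcomp (br h) (\<phi> h1 - h) l \<noteq> 0"
    then obtain j where j: "j \<ge> Suc k" "l = of_nat j" using \<phi>(4) by (auto simp: weights_ge_def)
    moreover have "l \<in> gspec (br h)"
      using n gcomp_GE[OF ad_endo, of h "\<phi> h1 - h" l] unfolding gspec_def by blast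
    ultimately show False using k[of j] by auto
  qed
  then have "\<phi> h1 - h = 0" using gcomp_sum[OF ad_endo, of "\<phi> h1 - h" h] by simp
  then show ?thesis using that \<phi> by simp
qed

section \<open>Transport along automorphisms\<close>

lemma poly_fun_comp:
  assumes "p \<in> poly_fun (*s)" "endo \<phi>"
  shows "(\<lambda>x. p (\<phi> x)) \<in> poly_fun (*s)"
  using assms(1)
proof (induction rule: poly_fun.induct)
  case (pf_lin l)
  then show ?case by (intro poly_fun.pf_lin) (auto simp: endo_add[OF assms(2)] endo_scale[OF assms(2)])
qed (auto intro: poly_fun.intros)

lemma ad_semisimple_iff:
  assumes "sub_alg Q"
  shows "ad_semisimple (*s) br Q x \<longleftrightarrow> x \<in> Q \<and> diag_on Q (br x)"
proof (cases "x \<in> Q")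
  case True
  then show ?thesis using assms unfolding ad_semisimple_def lin_span_eq
    by (subst diag_on_span[OF ad_endo]) (auto simp: sub_alg_def)
qed (simp add: ad_semisimple_def)

lemma ad_semisimple_autom:
  assumes \<phi>: "autom \<phi>" "\<phi> ` Q = Q" and x: "ad_semisimple (*s) br Q x"
  shows "ad_semisimple (*s) br Q (\<phi> x)"
proof -
  interpret pair: vector_space_pair "(*s)" "(*s)" ..
  let ?E = "\<lambda>x. {y \<in> Q. \<exists>c. br x y = c *s y}"
  have "Q \<subseteq> span (?E x)" using x by (simp add: ad_semisimple_def lin_span_eq)
  then have "\<phi> ` Q \<subseteq> \<phi> ` span (?E x)" by (rule image_mono)
  also have "\<dots> = span (\<phi> ` ?E x)" using autom_endo[OF \<phi>(1)] by (rule pair.linear_span_image[symmetric])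
  also have "\<dots> \<subseteq> span (?E (\<phi> x))"
  proof (rule span_mono, rule image_subsetI)
    fix y assume "y \<in> ?E x"
    then obtain c where "y \<in> Q" "br x y = c *s y" by blast
    moreover from this have "br (\<phi> x) (\<phi> y) = c *s \<phi> y"
      using autom_br[OF \<phi>(1), of x y] endo_scale[OF autom_endo[OF \<phi>(1)], of c y] by simp
    ultimately show "\<phi> y \<in> ?E (\<phi> x)" using \<phi>(2) by blast
  qed
  finally have "Q \<subseteq> span (?E (\<phi> x))" using \<phi>(2) by simp
  moreover have "\<phi> x \<in> Q" using x \<phi>(2) by (auto simp: ad_semisimple_def)
  ultimately show ?thesis by (simp add: ad_semisimple_def lin_span_eq)
qed

text \<open>The defining equations of the complement are composed with the inverse
  automorphism.\<close>

lemma zopen_in_image: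
  assumes \<phi>: "autom \<phi>" and U: "zopen_in (*s) W U"
  shows "zopen_in (*s) (\<phi> ` W) (\<phi> ` U)"
proof -
  obtain P where P: "P \<subseteq> poly_fun (*s)" "W - U = {w \<in> W. \<forall>p\<in>P. p w = 0}" and UW: "U \<subseteq> W"
    using U by (auto simp: zopen_in_def zclosed_in_def)
  let ?P = "(\<lambda>p x. p (inv_into UNIV \<phi> x)) ` P"
  have a: "?P \<subseteq> poly_fun (*s)"
    using P(1) poly_fun_comp[OF _ autom_endo[OF autom_inv[OF \<phi>]]] by blast
  have b: "\<phi> ` W - \<phi> ` U = \<phi> ` (W - U)"
    by (rule image_set_diff[OF autom_inj[OF \<phi>], symmetric])
  have c: "\<phi> ` (W - U) = {w \<in> \<phi> ` W. \<forall>p\<in>?P. p w = 0}"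
    unfolding P(2) using inv_f_f[OF autom_inj[OF \<phi>]] by auto
  have "zclosed_in (*s) (\<phi> ` W) (\<phi> ` W - \<phi> ` U)"
    unfolding zclosed_in_def by (intro conjI Diff_subset exI[of _ ?P] a) (simp only: b c)
  then show ?thesis using UW by (auto simp: zopen_in_def)
qed

lemma ss_type_wrt_autom:
  assumes \<phi>: "autom \<phi>" "\<phi> ` Q = Q" "\<phi> e = e" "\<phi> h1 = h"
    and ss: "ss_type_wrt (*s) br Q e h1 f1"
  shows "ss_type_wrt (*s) br Q e h f"
proof -
  note en = autom_endo[OF \<phi>(1)]
  have g: "grade (*s) br Q h j = \<phi> ` grade (*s) br Q h1 j" for j
  proof (intro subset_antisym subsetI)
    fix z assume z: "z \<in> grade (*s) br Q h j"
    then obtain y where y: "y \<in> Q" "z = \<phi> y" using \<phi>(2) by (auto simp: grade_def)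
    have "\<phi> (br h1 y) = \<phi> (of_int j *s y)"
      using z y by (simp add: autom_br[OF \<phi>(1)] \<phi>(4) endo_scale[OF en] grade_def)
    then have "br h1 y = of_int j *s y" using autom_inj[OF \<phi>(1)] by (simp add: inj_eq)
    then show "z \<in> \<phi> ` grade (*s) br Q h1 j" using y by (auto simp: grade_def)
  next
    fix z assume "z \<in> \<phi> ` grade (*s) br Q h1 j"
    then obtain y where y: "y \<in> Q" "z = \<phi> y" "br h1 y = of_int j *s y" by (auto simp: grade_def)
    have "br h z = of_int j *s z"
      using autom_br[OF \<phi>(1), of h1 y] y by (simp add: \<phi>(4) endo_scale[OF en])
    then show "z \<in> grade (*s) br Q h j" using y \<phi>(2) by (auto simp: grade_def)
  qed
  have "\<phi> ` X = {0} \<longleftrightarrow> X = {0}" for X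
    using inj_image_eq_iff[OF autom_inj[OF \<phi>(1)], of X "{0}"] by (simp add: endo_0[OF en])
  then have d: "depth (*s) br Q h = depth (*s) br Q h1" by (simp add: depth_def g)
  let ?V = "grade (*s) br Q h1 (- depth (*s) br Q h1)"
  obtain U where U: "U \<noteq> {}" "zopen_in (*s) ?V U" "\<And>F. F \<in> U \<Longrightarrow> ad_semisimple (*s) br Q (e + F)"
    using ss by (auto simp: ss_type_wrt_def Let_def)
  have s: "ad_semisimple (*s) br Q (e + G)" if "G \<in> \<phi> ` U" for G
  proof -
    from that obtain F where "F \<in> U" "G = \<phi> F" by blast
    then show ?thesis using ad_semisimple_autom[OF \<phi>(1,2) U(3)[of F]]
      by (simp add: endo_add[OF en] \<phi>(3))
  qed
  have "\<phi> ` U \<noteq> {}" using U(1) by simp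
  then show ?thesis
    unfolding ss_type_wrt_def Let_def d g
    by (intro exI[of _ "\<phi> ` U"] conjI ballI zopen_in_image[OF \<phi>(1) U(2)] s)
qed


section \<open>Polynomial functions\<close>

lemma poly_fun_line:
  assumes "p \<in> poly_fun (*s)"
  shows "\<exists>q. \<forall>t. p (u + t *s w) = poly q t"
  using assms
proof (induction rule: poly_fun.induct)
  case (pf_const c)
  show ?case by (rule exI[of _ "[:c:]"]) simp
next
  case (pf_lin l)
  then show ?case by (intro exI[of _ "[:l u, l w:]"]) (simp add: mult.commute)
next
  case (pf_add p q)
  then show ?case by (metis poly_add)
next
  case (pf_mult p q)
  then show ?case by (metis poly_mult)
qed

lemma poly_fun_sum: "(\<And>i. i \<in> A \<Longrightarrow> (\<lambda>x. g i x) \<in> poly_fun (*s)) \<Longrightarrow> (\<lambda>x. \<Sum>i\<in>A. g i x) \<in> poly_fun (*s)"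
  by (induction A rule: infinite_finite_induct) (auto intro: poly_fun.intros)

lemma poly_fun_prod: "(\<And>i. i \<in> A \<Longrightarrow> (\<lambda>x. g i x) \<in> poly_fun (*s)) \<Longrightarrow> (\<lambda>x. \<Prod>i\<in>A. g i x) \<in> poly_fun (*s)"
  by (induction A rule: infinite_finite_induct) (auto intro: poly_fun.intros)

lemma poly_fun_cmult: "p \<in> poly_fun (*s) \<Longrightarrow> (\<lambda>x. c * p x) \<in> poly_fun (*s)"
  by (intro poly_fun.pf_mult poly_fun.pf_const)

text \<open>Irreducibility of a linear space: on the line through \<open>u\<close> and
  \<open>w\<close> the product becomes a product of polynomials in one variable, and the factor from
  \<open>g\<close> is nonzero at parameter 0. The value at \<open>w\<close> is read off at parameter
  1.\<close>

lemma poly_fun_zero_on_subspace: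
  assumes W: "subspace W" and p: "p \<in> poly_fun (*s)" and g: "g \<in> poly_fun (*s)"
    and pg: "\<And>w. w \<in> W \<Longrightarrow> p w * g w = 0" and u: "u \<in> W" "g u \<noteq> 0" and w: "w \<in> W"
  shows "p w = 0"
proof -
  obtain p' where p': "\<And>t. p (u + t *s (w - u)) = poly p' t" using poly_fun_line[OF p] by metis
  obtain g' where g': "\<And>t. g (u + t *s (w - u)) = poly g' t" using poly_fun_line[OF g] by metis
  have "poly (p' * g') t = 0" for t
  proof -
    have "u + t *s (w - u) \<in> W" using W u(1) w by (intro subspace_add subspace_scale subspace_diff)
    from pg[OF this] show ?thesis by (simp add: p' g')
  qed
  then have "p' * g' = 0" using poly_all_0_iff_0 by blast
  moreover have "g' \<noteq> 0" using g'[of 0] u(2) by auto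
  ultimately have "p' = 0" by simp
  then show ?thesis using p'[of 1] by simp
qed

lemma poly_fun_zero_on_open:
  assumes W: "subspace W" and U: "zopen_in (*s) W U" "U \<noteq> {}"
    and p: "p \<in> poly_fun (*s)" "\<And>u. u \<in> U \<Longrightarrow> p u = 0" and w: "w \<in> W"
  shows "p w = 0"
proof -
  obtain P where P: "P \<subseteq> poly_fun (*s)" "W - U = {w \<in> W. \<forall>p\<in>P. p w = 0}" and UW: "U \<subseteq> W"
    using U by (auto simp: zopen_in_def zclosed_in_def)
  obtain u where u: "u \<in> U" using U(2) by blast
  then obtain g where g: "g \<in> P" "g u \<noteq> 0" using P(2) UW by blast
  show ?thesis
  proof (rule poly_fun_zero_on_subspace[where W = W and p = p and g = g and u = u])
    show "subspace W" "p \<in> poly_fun (*s)" "g u \<noteq> 0" "w \<in> W" by (fact W p(1) g(2) w)+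
    show "g \<in> poly_fun (*s)" using g P by blast
    show "u \<in> W" using u UW by blast
    show "p v * g v = 0" if "v \<in> W" for v
    proof (cases "v \<in> U")
      case True
      then show ?thesis using p(2) by simp
    next
      case False
      then have "g v = 0" using that P(2) g(1) by blast
      then show ?thesis by simp
    qed
  qed
qed

lemma poly_fun_zero_on_dense:
  assumes "zdense_in (*s) W X" and p: "p \<in> poly_fun (*s)" "\<And>x. x \<in> X \<Longrightarrow> p x = 0" and "w \<in> W"
  shows "p w = 0"
proof -
  have "zclosed_in (*s) W {w \<in> W. p w = 0}"
    unfolding zclosed_in_def using p(1) by (auto intro!: exI[of _ "{p}"])
  then have "{w \<in> W. p w = 0} = W" using assms unfolding zdense_in_def by blast
  then show ?thesis using assms(4) by blast
qed

section \<open>Hankel matrices of power traces\<close>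

lemma papp_power: "endo T \<Longrightarrow> papp (p ^ n) T v = (papp p T ^^ n) v"
  by (induction n) (simp_all add: papp_mult)

text \<open>The radical of the characteristic polynomial; it is the minimal polynomial when
  \<open>T\<close> is diagonalizable.\<close>

definition radpoly :: "('v \<Rightarrow> 'v) \<Rightarrow> 'a poly" where
  "radpoly T = (\<Prod>l\<in>gspec T. [:- l, 1:])"

lemma radpoly_degree: "degree (radpoly T) = card (gspec T)"
  unfolding radpoly_def by (subst degree_prod_eq_sum_degree) auto

lemma radpoly_monic: "coeff (radpoly T) (card (gspec T)) = 1"
proof -
  have "lead_coeff (radpoly T) = 1" unfolding radpoly_def by (simp add: lead_coeff_prod)
  then show ?thesis by (simp add: radpoly_degree)
qed

text \<open>Every eigenvalue is a root of \<open>radpoly T\<close>, so its value at \<open>T\<close>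
  is nilpotent even if \<open>T\<close> is not diagonalizable, and so is the product with a
  polynomial in \<open>T\<close>.\<close>

lemma tr_papp_radpoly:
  assumes "endo T"
  shows "tr (papp (g * radpoly T) T) = 0"
proof (rule tr_nilpotent[OF papp_endo[OF assms]])
  fix v show "\<exists>n. (papp (g * radpoly T) T ^^ n) v = 0"
  proof (rule nilpotent_of_GE[OF assms papp_endo[OF assms]])
    fix l v assume v: "v \<in> GE T l"
    show "\<exists>n. (papp (g * radpoly T) T ^^ n) v = 0"
    proof (cases "v = 0")
      case True
      then show ?thesis by (intro exI[of _ 0]) simp
    next
      case False
      then have l: "l \<in> gspec T" using v by (auto simp: gspec_def)
      obtain n where n: "(shift T l ^^ n) v = 0" using v by (auto simp: GE_def)
      define s where "s = g * (\<Prod>m\<in>gspec T - {l}. [:- m, 1:])"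
      have "g * radpoly T = s * [:- l, 1:]"
        unfolding radpoly_def s_def using prod.remove[OF finite_gspec[OF assms] l, of "\<lambda>l. [:- l, 1:]"]
        by (simp only: ac_simps)
      then have "(papp (g * radpoly T) T ^^ n) v = papp (s ^ n) T (papp ([:- l, 1:] ^ n) T v)"
        by (simp only: papp_power[OF assms, symmetric] power_mult_distrib papp_mult[OF assms])
      also have "\<dots> = 0"
        by (simp only: papp_linear_factor_power[OF assms] n endo_0[OF papp_endo[OF assms]])
      finally show ?thesis by blast
    qed
  qed
qed

lemma diag_radpoly:
  assumes T: "endo T" and d: "diag_on UNIV T"
  shows "papp (radpoly T) T v = 0"
proof (rule endo_eq_on_GE[OF T papp_endo[OF T] endo_zero])
  fix l v assume v: "v \<in> GE T l"
  show "papp (radpoly T) T v = 0"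
  proof (cases "v = 0")
    case True
    then show ?thesis using endo_0[OF papp_endo[OF T]] by simp
  next
    case False
    then have "l \<in> gspec T" using v by (auto simp: gspec_def)
    then have "poly (radpoly T) l = 0"
      unfolding radpoly_def poly_prod using finite_gspec[OF T] by (auto intro: prod_zero)
    then show ?thesis using papp_eigen[OF T diag_on_GE[OF T d UNIV_I v]] by simp
  qed
qed

lemma tr_papp_monom:
  assumes T: "endo T" and "degree p \<le> n"
  shows "tr (papp (Polynomial.monom 1 i * p) T) = (\<Sum>j\<le>n. coeff p j * tr (T ^^ (i + j)))"
proof -
  have "papp (Polynomial.monom 1 i * p) T v = (\<Sum>j\<le>n. coeff p j *s (T ^^ (i + j)) v)" for v
    by (simp add: papp_mult[OF T] papp_monom[OF T] papp_ge[OF assms(2)]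
        endo_sum[OF endo_funpow[OF T]] endo_scale[OF endo_funpow[OF T]] funpow_add)
  then have "papp (Polynomial.monom 1 i * p) T = (\<lambda>v. \<Sum>j\<le>n. coeff p j *s (T ^^ (i + j)) v)" by auto
  then show ?thesis by (simp only: tr_sum tr_scale)
qed

lemma tr_papp_vanish:
  assumes T: "endo T" and z: "\<And>i. i < m \<Longrightarrow> tr (papp (Polynomial.monom 1 i * p) T) = 0"
    and g: "degree g < m"
  shows "tr (papp (g * p) T) = 0"
proof -
  have "papp (g * p) T v = (\<Sum>i\<le>degree g. coeff g i *s papp (Polynomial.monom 1 i * p) T v)" for v
    by (simp add: papp_mult[OF T] papp_monom[OF T] papp_def[of g])
  then have "papp (g * p) T = (\<lambda>v. \<Sum>i\<le>degree g. coeff g i *s papp (Polynomial.monom 1 i * p) T v)"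
    by auto
  then have "tr (papp (g * p) T) = (\<Sum>i\<le>degree g. coeff g i * tr (papp (Polynomial.monom 1 i * p) T))"
    by (simp only: tr_sum tr_scale)
  then show ?thesis using z g by simp
qed

text \<open>The Gram matrix, in the monomial basis of polynomials of degree less than
  \<open>m\<close>, of the bilinear form sending g and p to the trace of (g p)(T).\<close>

definition hankel :: "('v \<Rightarrow> 'v) \<Rightarrow> nat \<Rightarrow> 'a mat" where
  "hankel T m = mat m m (\<lambda>(i, j). tr (T ^^ (i + j)))"

lemma hankel_carrier: "hankel T m \<in> carrier_mat m m"
  by (simp add: hankel_def)

lemma hankel_singularI:
  assumes T: "endo T" and p: "p \<noteq> 0" "degree p < m"
    and z: "\<And>i. i < m \<Longrightarrow> tr (papp (Polynomial.monom 1 i * p) T) = 0"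
  shows "det (hankel T m) = 0"
proof -
  define x where "x = vec m (coeff p)"
  have "x \<noteq> 0\<^sub>v m"
  proof
    assume "x = 0\<^sub>v m"
    then have "coeff p (degree p) = 0" using p(2) by (metis index_vec index_zero_vec(1) x_def)
    then show False using p(1) by simp
  qed
  moreover have "hankel T m *\<^sub>v x = 0\<^sub>v m"
  proof (rule eq_vecI)
    fix i assume "i < dim_vec (0\<^sub>v m :: 'a vec)"
    then have i: "i < m" by simp
    have dp: "degree p \<le> m - 1" using p(2) by simp
    have m: "{..m - 1} = {0..<m}" using p(2) by auto
    have "(hankel T m *\<^sub>v x) $ i = (\<Sum>j\<in>{0..<m}. tr (T ^^ (i + j)) * coeff p j)"
      using i by (simp add: hankel_def x_def scalar_prod_def)
    also have "\<dots> = 0"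
      using z[OF i] unfolding tr_papp_monom[OF T dp] m by (simp add: mult.commute)
    finally show "(hankel T m *\<^sub>v x) $ i = 0\<^sub>v m $ i" using i by simp
  qed (simp add: hankel_def)
  moreover have "x \<in> carrier_vec m" by (simp add: x_def)
  ultimately show ?thesis using det_0_iff_vec_prod_zero_field[OF hankel_carrier] by blast
qed

lemma hankel_singularE:
  assumes T: "endo T" and "det (hankel T m) = 0"
  obtains p where "p \<noteq> 0" "degree p < m" "\<And>i. i < m \<Longrightarrow> tr (papp (Polynomial.monom 1 i * p) T) = 0"
proof -
  obtain x where x: "x \<in> carrier_vec m" "x \<noteq> 0\<^sub>v m" "hankel T m *\<^sub>v x = 0\<^sub>v m"
    using assms(2) det_0_iff_vec_prod_zero_field[OF hankel_carrier] by blast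
  have dx: "dim_vec x = m" using x(1) by simp
  obtain k where k: "k < m" "x $ k \<noteq> 0" using x(1,2) dx by (metis eq_vecI index_zero_vec)
  define p where "p = (\<Sum>j<m. Polynomial.monom (x $ j) j)"
  have c: "coeff p j = (if j < m then x $ j else 0)" for j
    by (simp add: p_def coeff_sum if_distrib sum.delta cong: if_cong)
  have "p \<noteq> 0" using k c[of k] by auto
  moreover have dp: "degree p \<le> m - 1" by (rule degree_le) (use k c in auto)
  then have "degree p < m" using k(1) by simp
  moreover have "tr (papp (Polynomial.monom 1 i * p) T) = 0" if i: "i < m" for i
  proof -
    have m: "{..m - 1} = {0..<m}" using i by auto
    have "(hankel T m *\<^sub>v x) $ i = (\<Sum>j\<in>{0..<m}. tr (T ^^ (i + j)) * x $ j)"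
      using i dx by (simp add: hankel_def scalar_prod_def)
    then have "(\<Sum>j\<in>{0..<m}. tr (T ^^ (i + j)) * x $ j) = 0" using x(3) i by simp
    then show ?thesis unfolding tr_papp_monom[OF T dp] m by (simp add: c mult.commute)
  qed
  ultimately show ?thesis by (rule that)
qed

text \<open>\<open>N\<close> is the multiplicity of \<open>l\<close>; its positivity makes the trace
  detect the value \<open>poly p l\<close> in characteristic 0.\<close>

lemma tr_papp_diag:
  assumes T: "endo T" and d: "diag_on UNIV T" and l: "l \<in> gspec T"
    and p: "\<And>m. m \<in> gspec T \<Longrightarrow> m \<noteq> l \<Longrightarrow> poly p m = 0"
  obtains N :: nat where "N > 0" "tr (papp p T) = of_nat N * poly p l"
proof -
  obtain B where B: "is_basis B" "B \<subseteq> (\<Union>l. GE T l)" using GE_basis[OF T] .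
  then have "\<forall>b\<in>B. \<exists>l. b \<in> GE T l" by blast
  then obtain L where L: "\<And>b. b \<in> B \<Longrightarrow> b \<in> GE T (L b)" by metis
  have b0: "b \<noteq> 0" if "b \<in> B" for b
    using B(1) that dependent_zero by (auto simp: is_basis_def)
  let ?N = "card {b \<in> B. L b = l}"
  have fB: "finite B" using B(1) by (simp add: is_basis_def)
  have r: "representation B (papp p T b) b = (if L b = l then poly p l else 0)" if b: "b \<in> B" for b
  proof -
    have Tb: "T b = L b *s b" by (rule diag_on_GE[OF T d UNIV_I L[OF b]])
    have "representation B (papp p T b) b = poly p (L b)"
      by (simp add: papp_eigen[OF T Tb] basis_rep[OF B(1)] representation_basis_elem[OF B(1) b])
    moreover have "L b \<in> gspec T" using L[OF b] b0[OF b] by (auto simp: gspec_def)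
    ultimately show ?thesis using p by auto
  qed
  have "tr (papp p T) = (\<Sum>b\<in>B. if L b = l then poly p l else 0)"
    unfolding tr_basis[OF papp_endo[OF T] B(1)] using r by (intro sum.cong) auto
  also have "\<dots> = of_nat ?N * poly p l"
    using fB by (simp add: sum.inter_filter[symmetric])
  finally have t: "tr (papp p T) = of_nat ?N * poly p l" .
  have "{b \<in> B. L b = l} \<noteq> {}"
  proof
    assume e: "{b \<in> B. L b = l} = {}"
    have "gcomp T b l = 0" if "b \<in> B" for b
      using gcomp_on_GE[OF T L[OF that], of l] e that by auto
    then have z: "gcomp T v l = 0" for v
      using endo_eq_0_on_span[OF gcomp_endo[OF T], of B l v] B(1) by (auto simp: is_basis_def)
    obtain v where "v \<in> GE T l" "v \<noteq> 0" using gspec_witness[OF T l] .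
    then show False using z[of v] gcomp_on_GE[OF T, of v l l] by simp
  qed
  then have "?N > 0" using fB by (simp add: card_gt_0_iff)
  then show ?thesis using t that by blast
qed

text \<open>A kernel vector is a polynomial \<open>p\<close> orthogonal to all polynomials of
  smaller degree than the number of eigenvalues. Testing it against the product of linear factors at
  all eigenvalues but one shows that \<open>p\<close> vanishes at each eigenvalue, which is more
  roots than its degree allows.\<close>

lemma hankel_nonsingular:
  assumes T: "endo T" and d: "diag_on UNIV T"
  shows "det (hankel T (card (gspec T))) \<noteq> 0"
proof
  assume "det (hankel T (card (gspec T))) = 0"
  then obtain p where p: "p \<noteq> 0" "degree p < card (gspec T)"
    "\<And>i. i < card (gspec T) \<Longrightarrow> tr (papp (Polynomial.monom 1 i * p) T) = 0"
    using hankel_singularE[OF T] by metis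
  have fin: "finite (gspec T)" by (rule finite_gspec[OF T])
  have "poly p l = 0" if l: "l \<in> gspec T" for l
  proof -
    let ?g = "\<Prod>m\<in>gspec T - {l}. [:- m, 1:]"
    have "degree ?g = card (gspec T - {l})" by (subst degree_prod_eq_sum_degree) auto
    also have "\<dots> < card (gspec T)" using l fin by (rule card_Diff1_less[rotated])
    finally have dg: "degree ?g < card (gspec T)" .
    have t: "tr (papp (?g * p) T) = 0" by (rule tr_papp_vanish[OF T _ dg]) (rule p(3))
    have "poly (?g * p) m = 0" if "m \<in> gspec T" "m \<noteq> l" for m
      using that fin by (auto simp: poly_prod)
    then obtain N :: nat where "N > 0" "tr (papp (?g * p) T) = of_nat N * poly (?g * p) l"
      using tr_papp_diag[OF T d l] by metis
    then have "poly (?g * p) l = 0" using t by simp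
    moreover have "poly ?g l \<noteq> 0" using fin by (auto simp: poly_prod)
    ultimately show ?thesis by simp
  qed
  then have "gspec T \<subseteq> {x. poly p x = 0}" by blast
  then have "card (gspec T) \<le> card {x. poly p x = 0}"
    using poly_roots_finite[OF p(1)] by (rule card_mono[rotated])
  also have "\<dots> \<le> degree p" using p(1) by (rule card_poly_roots_bound)
  finally show False using p(2) by simp
qed

text \<open>With fewer than \<open>m\<close> eigenvalues, \<open>radpoly T\<close> would give a
  kernel vector of the Hankel matrix. So the annihilator \<open>q\<close> of degree \<open>m\<close>
  has at least \<open>m\<close> distinct roots, all of them simple, and no generalized eigenvector
  of higher rank can exist.\<close>

lemma diag_of_annihilator:
  assumes T: "endo T" and q: "degree q = m" "q \<noteq> 0" "\<And>v. papp q T v = 0"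
    and H: "det (hankel T m) \<noteq> 0"
  shows "diag_on UNIV T"
proof -
  have fin: "finite (gspec T)" by (rule finite_gspec[OF T])
  have root: "poly q l = 0" if "l \<in> gspec T" for l
  proof -
    from gspec_witness[OF T that] obtain v where "v \<in> GE T l" "v \<noteq> 0" by blast
    from GE_eigenvector[OF T this] obtain u where u: "u \<noteq> 0" "T u = l *s u" by metis
    then have "poly q l *s u = 0" using q(3)[of u] papp_eigen[OF T u(2)] by simp
    then show ?thesis using u(1) by simp
  qed
  have card: "m \<le> card (gspec T)"
  proof (rule ccontr)
    assume "\<not> ?thesis"
    then have "degree (radpoly T) < m" by (simp add: radpoly_degree)
    moreover have "radpoly T \<noteq> 0" using radpoly_monic[of T] by auto
    ultimately have "det (hankel T m) = 0"
      using hankel_singularI[OF T, of "radpoly T" m] tr_papp_radpoly[OF T] by blast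
    then show False using H by simp
  qed
  have eig: "T v = l *s v" if v: "v \<in> GE T l" for v l
  proof (rule ccontr)
    assume ne: "T v \<noteq> l *s v"
    then have "v \<noteq> 0" using endo_0[OF T] by auto
    then have l: "l \<in> gspec T" using v by (auto simp: gspec_def)
    obtain s where s: "q = [:- l, 1:] * s" using root[OF l] by (metis dvdE poly_eq_0_iff_dvd)
    have s0: "s \<noteq> 0" using s q(2) by auto
    have ds: "m = Suc (degree s)" using q(1) s s0 by (simp add: degree_mult_eq del: mult_pCons_left)
    have "poly s l \<noteq> 0"
    proof
      assume sl: "poly s l = 0"
      have "poly s k = 0" if "k \<in> gspec T" for k
        using root[OF that] sl unfolding s poly_mult by (cases "k = l") auto
      then have "card (gspec T) \<le> card {x. poly s x = 0}"
        using poly_roots_finite[OF s0] by (intro card_mono) auto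
      also have "\<dots> \<le> degree s" using s0 by (rule card_poly_roots_bound)
      finally show False using card ds by simp
    qed
    define w where "w = shift T l v"
    have w0: "w \<noteq> 0" using ne by (simp add: w_def shift_def)
    have "w \<in> GE T l"
      unfolding w_def shift_def
      by (intro subspace_diff subspace_scale GE_subspace[OF T] GE_stable[OF T] v)
    then obtain k where k: "(shift T l ^^ k) w \<noteq> 0" "T ((shift T l ^^ k) w) = l *s (shift T l ^^ k) w"
      using GE_eigenvector[OF T _ w0] by metis
    have "papp s T w = papp q T v"
      by (simp only: s w_def papp_linear_factor[OF T, symmetric] papp_mult[OF T, symmetric] mult.commute)
    then have "papp s T w = 0" using q(3) by simp
    then have "papp s T ((shift T l ^^ k) w) = 0"
      by (simp only: papp_linear_factor_power[OF T, symmetric] papp_commute[OF T, of s]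
          endo_0[OF papp_endo[OF T]])
    then have "poly s l *s (shift T l ^^ k) w = 0" by (simp only: papp_eigen[OF T k(2)])
    then show False using k(1) \<open>poly s l \<noteq> 0\<close> by simp
  qed
  have "T v = gfun T (\<lambda>l. l) v" for v
    by (rule endo_eq_on_GE[OF T T gfun_endo[OF T]]) (simp add: eig gfun_on_GE[OF T])
  then show ?thesis by (simp add: diag_on_def)
qed

section \<open>Diagonalizability is generic\<close>

lemma poly_fun_det:
  assumes "\<And>F. M F \<in> carrier_mat n n" "\<And>i j. i < n \<Longrightarrow> j < n \<Longrightarrow> (\<lambda>F. M F $$ (i, j)) \<in> poly_fun (*s)"
  shows "(\<lambda>F. det (M F)) \<in> poly_fun (*s)"
proof -
  have "(\<lambda>F. det (M F))
      = (\<lambda>F. \<Sum>p\<in>{p. p permutes {0..<n}}. signof p * (\<Prod>i = 0..<n. M F $$ (i, p i)))"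
    using det_def'[OF assms(1)] by blast
  also have "\<dots> \<in> poly_fun (*s)"
  proof (rule poly_fun_sum, rule poly_fun_cmult, rule poly_fun_prod)
    fix p i assume "p \<in> {p. p permutes {0..<n}}" "i \<in> {0..<n}"
    then have "i < n" "p i < n" using permutes_in_image[of p "{0..<n}" i] by auto
    then show "(\<lambda>F. M F $$ (i, p i)) \<in> poly_fun (*s)" by (rule assms(2))
  qed
  finally show ?thesis .
qed

lemma poly_fun_pow_ad:
  "(\<lambda>F. representation Basis ((br (e + F) ^^ k) u) b) \<in> poly_fun (*s)"
proof (induction k arbitrary: b)
  case 0
  show ?case by (simp add: poly_fun.pf_const)
next
  case (Suc k)
  let ?r = "\<lambda>v b. representation Basis v b"
  note R = basis_rep[OF Basis_is_basis]
  have "(br (e + F) ^^ Suc k) u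
      = br (e + F) (\<Sum>c\<in>Basis. ?r ((br (e + F) ^^ k) u) c *s c)" for F
    by (simp add: basis_sum[OF Basis_is_basis])
  then have "?r ((br (e + F) ^^ Suc k) u) b
      = (\<Sum>c\<in>Basis. ?r ((br (e + F) ^^ k) u) c * (?r (br e c) b + ?r (br F c) b))" for F
    by (simp add: endo_sum[OF ad_endo] br_scale_right R br_add_left scale_right_distrib
        distrib_left sum.distrib)
  moreover have "(\<lambda>F. \<Sum>c\<in>Basis. ?r ((br (e + F) ^^ k) u) c * (?r (br e c) b + ?r (br F c) b))
      \<in> poly_fun (*s)"
  proof (intro poly_fun_sum poly_fun.pf_mult poly_fun.pf_add poly_fun.pf_const Suc)
    fix c
    show "(\<lambda>F. ?r (br F c) b) \<in> poly_fun (*s)"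
      by (rule poly_fun.pf_lin) (simp_all add: br_add_left br_scale_left R)
  qed
  ultimately show ?case by simp
qed

lemma poly_fun_tr_pow_ad: "(\<lambda>F. tr (br (e + F) ^^ k)) \<in> poly_fun (*s)"
  unfolding tr_def by (intro poly_fun_sum poly_fun_pow_ad)

lemma poly_fun_det_hankel: "(\<lambda>F. det (hankel (br (e + F)) m)) \<in> poly_fun (*s)"
  by (rule poly_fun_det[OF hankel_carrier]) (simp add: hankel_def poly_fun_tr_pow_ad)

lemma poly_fun_adj_hankel:
  assumes "i < m" "j < m"
  shows "(\<lambda>F. adj_mat (hankel (br (e + F)) m) $$ (i, j)) \<in> poly_fun (*s)"
proof -
  have "(\<lambda>F. det (mat_delete (hankel (br (e + F)) m) j i)) \<in> poly_fun (*s)"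
  proof (rule poly_fun_det)
    show "mat_delete (hankel (br (e + F)) m) j i \<in> carrier_mat (m - 1) (m - 1)" for F
      by (rule mat_delete_carrier[OF hankel_carrier])
    show "(\<lambda>F. mat_delete (hankel (br (e + F)) m) j i $$ (k, l)) \<in> poly_fun (*s)"
      if "k < m - 1" "l < m - 1" for k l
      using that by (simp add: mat_delete_def hankel_def poly_fun_tr_pow_ad del: funpow.simps)
  qed
  then show ?thesis
    using assms by (simp add: adj_mat_def cofactor_def hankel_def poly_fun_cmult)
qed

(* The coefficients c_j = - (adj A b)_j, with A the Hankel matrix and b its last column, express
   the minimal polynomial up to the factor det A whenever ad (e + F) is diagonalizable with at
   most m eigenvalues. *)
lemma diag_generic:
  assumes D: "D \<noteq> {}" "D \<subseteq> W" "\<And>F. F \<in> D \<Longrightarrow> diag_on UNIV (br (e + F))"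
    and dense: "\<And>p F. p \<in> poly_fun (*s) \<Longrightarrow> (\<And>F. F \<in> D \<Longrightarrow> p F = 0) \<Longrightarrow> F \<in> W \<Longrightarrow> p F = 0"
  shows "\<exists>P\<in>poly_fun (*s). (\<exists>F\<in>W. P F \<noteq> 0)
    \<and> (\<forall>F\<in>W. P F \<noteq> 0 \<longrightarrow> diag_on UNIV (br (e + F)))"
proof -
  let ?T = "\<lambda>F. br (e + F)"
  have bound: "card (gspec (?T F)) \<le> dimension" for F
  proof -
    have "\<exists>w. w \<noteq> 0 \<and> w \<in> GE (?T F) l" if "l \<in> gspec (?T F)" for l
      using gspec_witness[OF ad_endo that] by metis
    then obtain w where "\<And>l. l \<in> gspec (?T F) \<Longrightarrow> w l \<noteq> 0 \<and> w l \<in> GE (?T F) l" by metis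
    then show ?thesis using card_eigenvalues_le_dimension[OF finite_gspec[OF ad_endo] ad_endo] by blast
  qed
  \<comment> \<open>Maximality lets one degree \<open>m\<close> serve every element of
    \<open>D\<close>; attaining the maximum makes the Hankel determinant nonzero at
    \<open>F0\<close>.\<close>
  obtain F0 where F0: "F0 \<in> D" "\<And>F. F \<in> D \<Longrightarrow> card (gspec (?T F)) \<le> card (gspec (?T F0))"
    using ex_has_greatest_nat[of "\<lambda>F. F \<in> D" _ "\<lambda>F. card (gspec (?T F))" "Suc dimension"] D(1) bound
    by (metis all_not_in_conv less_Suc_eq_le)
  define m where "m = card (gspec (?T F0))"
  define P where "P F = det (hankel (?T F) m)" for F
  define c where "c F k = - (\<Sum>i<m. adj_mat (hankel (?T F) m) $$ (k, i) * tr (?T F ^^ (i + m)))" for F k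
  define Q where "Q F v = P F *s (?T F ^^ m) v + (\<Sum>j<m. c F j *s (?T F ^^ j) v)" for F v
  have P: "P \<in> poly_fun (*s)" unfolding P_def by (rule poly_fun_det_hankel)
  have c: "(\<lambda>F. c F k) \<in> poly_fun (*s)" if "k < m" for k
  proof -
    have "(\<lambda>F. (-1) * (\<Sum>i<m. adj_mat (hankel (?T F) m) $$ (k, i) * tr (?T F ^^ (i + m)))) \<in> poly_fun (*s)"
      by (intro poly_fun_cmult poly_fun_sum poly_fun.pf_mult poly_fun_adj_hankel poly_fun_tr_pow_ad that) simp
    then show ?thesis by (simp add: c_def)
  qed
  have QD: "Q F v = 0" if F: "F \<in> D" for F v
  proof -
    let ?k = "card (gspec (?T F))"
    \<comment> \<open>With fewer than \<open>m\<close> eigenvalues, a power of the variable pads the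
      radical to a monic annihilator of degree exactly \<open>m\<close>.\<close>
    define p where "p = Polynomial.monom 1 (m - ?k) * radpoly (?T F)"
    have km: "?k \<le> m" using F0(2)[OF F] by (simp add: m_def)
    have rp: "radpoly (?T F) \<noteq> 0" using radpoly_monic[of "?T F"] by auto
    have dp: "degree p = m" unfolding p_def
      using km rp by (subst degree_mult_eq) (simp_all add: degree_monom_eq radpoly_degree monom_eq_0_iff)
    have lp: "coeff p m = 1"
      unfolding p_def coeff_monom_mult using km radpoly_monic[of "?T F"] by simp
    have tp: "tr (papp (Polynomial.monom 1 i * p) (?T F)) = 0" for i
      unfolding p_def mult.assoc[symmetric] by (rule tr_papp_radpoly[OF ad_endo])
    have Aa: "(\<Sum>j<m. tr (?T F ^^ (i + j)) * coeff p j) = - tr (?T F ^^ (i + m))" for i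
    proof -
      have "(\<Sum>j\<le>m. coeff p j * tr (?T F ^^ (i + j))) = 0"
        using tp[of i] tr_papp_monom[OF ad_endo, of p m i "e + F"] dp by simp
      then have "(\<Sum>j<m. coeff p j * tr (?T F ^^ (i + j))) + tr (?T F ^^ (i + m)) = 0"
        using lp by (simp add: lessThan_Suc_atMost[symmetric])
      then show ?thesis by (simp add: mult.commute eq_neg_iff_add_eq_0)
    qed
    let ?A = "hankel (?T F) m"
    have adj: "(\<Sum>i<m. adj_mat ?A $$ (k, i) * tr (?T F ^^ (i + j))) = (if k = j then P F else 0)"
      if "k < m" "j < m" for k j
    proof -
      have C: "adj_mat ?A \<in> carrier_mat m m" by (rule adj_mat(1)[OF hankel_carrier])
      have "(adj_mat ?A * ?A) $$ (k, j) = (det ?A \<cdot>\<^sub>m 1\<^sub>m m) $$ (k, j)"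
        by (simp only: adj_mat(3)[OF hankel_carrier])
      moreover have "(adj_mat ?A * ?A) $$ (k, j) = (\<Sum>i<m. adj_mat ?A $$ (k, i) * tr (?T F ^^ (i + j)))"
        using that C by (simp add: hankel_def scalar_prod_def atLeast0LessThan)
      ultimately show ?thesis using that by (simp add: P_def)
    qed
    have ck: "c F k = P F * coeff p k" if k: "k < m" for k
    proof -
      have "c F k = (\<Sum>i<m. adj_mat ?A $$ (k, i) * (\<Sum>j<m. tr (?T F ^^ (i + j)) * coeff p j))"
        unfolding c_def Aa by (simp add: sum_negf)
      also have "\<dots> = (\<Sum>i<m. \<Sum>j<m. adj_mat ?A $$ (k, i) * tr (?T F ^^ (i + j)) * coeff p j)"
        by (simp add: sum_distrib_left mult.assoc)
      also have "\<dots> = (\<Sum>j<m. \<Sum>i<m. adj_mat ?A $$ (k, i) * tr (?T F ^^ (i + j)) * coeff p j)"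
        by (rule sum.swap)
      also have "\<dots> = (\<Sum>j<m. (if k = j then P F else 0) * coeff p j)"
        by (intro sum.cong refl) (simp add: adj[OF k] sum_distrib_right[symmetric])
      also have "\<dots> = (\<Sum>j<m. if j = k then P F * coeff p j else 0)"
        by (intro sum.cong) auto
      also have "\<dots> = P F * coeff p k" using k by (simp add: sum.delta)
      finally show ?thesis .
    qed
    have "Q F v = P F *s (coeff p m *s (?T F ^^ m) v + (\<Sum>j<m. coeff p j *s (?T F ^^ j) v))"
      unfolding Q_def lp by (simp add: ck scale_right_distrib scale_sum_right)
    also have "\<dots> = P F *s papp p (?T F) v"
      by (simp add: papp_ge[of p m] dp lessThan_Suc_atMost[symmetric] add.commute)
    also have "papp p (?T F) v = 0"
      unfolding p_def papp_mult[OF ad_endo] diag_radpoly[OF ad_endo D(3)[OF F]]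
      by (rule endo_0[OF papp_endo[OF ad_endo]])
    finally show ?thesis by simp
  qed
  \<comment> \<open>Each coordinate of \<open>Q F v\<close> is polynomial in \<open>F\<close>, so
    the relation spreads from \<open>D\<close> to \<open>W\<close>.\<close>
  have QW: "Q F v = 0" if F: "F \<in> W" for F v
  proof -
    note R = basis_rep[OF Basis_is_basis]
    have "representation Basis (Q F v) b = 0" for b
    proof (rule dense[OF _ _ F])
      have "(\<lambda>F. P F * representation Basis ((?T F ^^ m) v) b
          + (\<Sum>j<m. c F j * representation Basis ((?T F ^^ j) v) b)) \<in> poly_fun (*s)"
        by (intro poly_fun.pf_add poly_fun.pf_mult poly_fun_sum P c poly_fun_pow_ad) simp
      then show "(\<lambda>F. representation Basis (Q F v) b) \<in> poly_fun (*s)"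
        by (simp add: Q_def R)
      show "representation Basis (Q F v) b = 0" if "F \<in> D" for F
        by (simp add: QD[OF that] R)
    qed
    then show ?thesis using basis_sum[OF Basis_is_basis, of "Q F v"] by simp
  qed
  have "diag_on UNIV (?T F)" if F: "F \<in> W" "P F \<noteq> 0" for F
  proof -
    define q where "q = Polynomial.monom (P F) m + (\<Sum>j<m. Polynomial.monom (c F j) j)"
    have cq: "coeff q j = (if j = m then P F else if j < m then c F j else 0)" for j
      by (auto simp: q_def coeff_sum)
    have "degree q \<le> m" by (rule degree_le) (auto simp: cq)
    moreover have "coeff q m \<noteq> 0" using F(2) by (simp add: cq)
    then have "m \<le> degree q" by (rule le_degree)
    ultimately have dq: "degree q = m" by simp
    have "papp q (?T F) v = Q F v" for v
      unfolding papp_def dq Q_def by (simp add: lessThan_Suc_atMost[symmetric] cq add.commute)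
    then have "papp q (?T F) v = 0" for v using QW[OF F(1)] by simp
    moreover have "q \<noteq> 0" using cq[of m] F(2) by auto
    ultimately show ?thesis
      using diag_of_annihilator[OF ad_endo dq] F(2) by (simp add: P_def)
  qed
  moreover have "P F0 \<noteq> 0"
    unfolding P_def m_def by (rule hankel_nonsingular[OF ad_endo D(3)[OF F0(1)]])
  ultimately show ?thesis using P F0(1) D(2) by blast
qed


section \<open>Depth\<close>

lemma sl2_triple_iff: "sl2_triple (*s) br L e h f \<longleftrightarrow> e \<in> L \<and> h \<in> L \<and> f \<in> L \<and> trip e h f"
  by (auto simp: sl2_triple_def trip_def)

lemma grade_iff: "y \<in> grade (*s) br L h j \<longleftrightarrow> y \<in> L \<and> br h y = of_int j *s y"
  by (simp add: grade_def)

lemma grade_subspace: "subspace L \<Longrightarrow> subspace (grade (*s) br L h j)"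
  by (auto simp: subspace_def grade_iff br_add_right br_scale_right scale_right_distrib mult.commute)

lemma grade_nonzero_iff:
  assumes "subspace L"
  shows "grade (*s) br L h j \<noteq> {0} \<longleftrightarrow> (\<exists>v. v \<in> grade (*s) br L h j \<and> v \<noteq> 0)"
  using subspace_0[OF grade_subspace[OF assms, of h j]] by blast

text \<open>The spectrum is finite, so a greatest weight exists. A vector of that weight is killed
  by \<open>e\<close>, and its string under \<open>f\<close> reaches the opposite weight; the same
  argument upwards from the least weight gives the symmetric bound.\<close>

lemma depth_props:
  assumes t: "trip e h f" and e: "e \<noteq> 0"
  defines "d \<equiv> depth (*s) br UNIV h"
  shows "d \<ge> 2"
    and "grade (*s) br UNIV h (- d) \<noteq> {0}"
    and "\<And>j. grade (*s) br UNIV h j \<noteq> {0} \<Longrightarrow> - d \<le> j \<and> j \<le> d"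
proof -
  let ?g = "grade (*s) br UNIV h"
  note nz = grade_nonzero_iff[OF subspace_UNIV]
  have he: "br h e = 2 *s e" and hf: "br h f = (-2) *s f" using t by (auto simp: trip_def)
  let ?J = "{j. ?g j \<noteq> {0}}"
  have J: "j \<in> ?J" if "br h v = of_int j *s v" "v \<noteq> 0" for j v
    using that nz by (auto simp: grade_iff)
  have Jv: "\<exists>v. br h v = of_int j *s v \<and> v \<noteq> 0" if "j \<in> ?J" for j
    using that nz by (auto simp: grade_iff)
  have "of_int ` ?J \<subseteq> gspec (br h)" using Jv weight_gspec by blast
  then have "finite (of_int ` ?J :: 'a set)" using finite_gspec[OF ad_endo] finite_subset by blast
  then have fin: "finite ?J" by (rule finite_imageD) (simp add: inj_on_def)
  have "2 \<in> ?J" using J[of e 2] he e by simp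
  then have ne: "?J \<noteq> {}" by blast
  define m where "m = Max ?J"
  have m: "m \<in> ?J" "\<And>j. j \<in> ?J \<Longrightarrow> j \<le> m"
    unfolding m_def using Max_in[OF fin ne] Max_ge[OF fin] by auto
  have "depth (*s) br UNIV h = m"
    unfolding depth_def by (rule Greatest_equality) (use m in auto)
  then have d: "d = m" by (simp add: d_def)
  show "d \<ge> 2" using m(2) \<open>2 \<in> ?J\<close> d by blast
  obtain v where v: "br h v = of_int m *s v" "v \<noteq> 0" using Jv[OF m(1)] by blast
  have "br h (br e v) = of_int (m + 2) *s br e v"
    using weight_shift[OF he v(1)] by (simp add: add.commute)
  then have "br e v = 0" using J[of "br e v" "m + 2"] m(2)[of "m + 2"] by fastforce
  then obtain k where k: "of_int m = (of_nat k :: 'a)" "(br f ^^ k) v \<noteq> 0"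
    using sl2_weight[OF t v(1) _ v(2)] by auto
  have mk: "m = int k" using k(1) by (metis of_int_eq_iff of_int_of_nat_eq)
  have "br h ((br f ^^ k) v) = of_int (- m) *s (br f ^^ k) v"
    using weight_funpow[OF hf v(1), of k] mk by simp
  then show "?g (- d) \<noteq> {0}" using J[OF _ k(2)] d by blast
  define l where "l = Min ?J"
  have l: "l \<in> ?J" "\<And>j. j \<in> ?J \<Longrightarrow> l \<le> j"
    unfolding l_def using Min_in[OF fin ne] Min_le[OF fin] by auto
  obtain w where w: "br h w = of_int l *s w" "w \<noteq> 0" using Jv[OF l(1)] by blast
  have "br h (br f w) = of_int (l - 2) *s br f w"
    using weight_shift[OF hf w(1)] by simp
  then have "br f w = 0" using J[of "br f w" "l - 2"] l(2)[of "l - 2"] by fastforce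
  then obtain i where i: "of_int l = (- of_nat i :: 'a)" "(br e ^^ i) w \<noteq> 0"
    using sl2_weight_flip[OF t w(1) _ w(2)] by auto
  have li: "l = - int i" using i(1) by (metis of_int_eq_iff of_int_of_nat_eq of_int_minus)
  have "br h ((br e ^^ i) w) = of_int (- l) *s (br e ^^ i) w"
    using weight_funpow[OF he w(1), of i] li by simp
  then have "- l \<le> m" using J[OF _ i(2)] m(2) by blast
  then show "- d \<le> j \<and> j \<le> d" if "?g j \<noteq> {0}" for j
    using that m(2)[of j] l(2)[of j] d by auto
qed

text \<open>A vector of weight \<open>- d\<close> is killed by \<open>f\<close>, and its string
  under \<open>e\<close>, which stays in \<open>q\<close>, reaches a nonzero vector of weight
  \<open>d\<close>.\<close>

lemma depth_subalgebra:
  assumes t: "trip e h f" and e: "e \<noteq> 0" and q: "sub_alg q" "e \<in> q"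
    and w: "w \<in> q" "w \<in> grade (*s) br UNIV h (- depth (*s) br UNIV h)" "w \<noteq> 0"
  shows "depth (*s) br q h = depth (*s) br UNIV h"
proof -
  define d where "d = depth (*s) br UNIV h"
  note D = depth_props[OF t e, folded d_def]
  have sq: "subspace q" using q by (simp add: sub_alg_def)
  have he: "br h e = 2 *s e" and hf: "br h f = (-2) *s f" using t by (auto simp: trip_def)
  have hw: "br h w = of_int (- d) *s w" using w(2) by (simp add: grade_iff d_def)
  have "br h (br f w) = of_int (- d - 2) *s br f w"
    using weight_shift[OF hf hw] by simp
  then have "br f w \<in> grade (*s) br UNIV h (- d - 2)" by (simp only: grade_iff UNIV_I simp_thms)
  then have "br f w = 0"
    using D(3)[of "- d - 2"] grade_nonzero_iff[OF subspace_UNIV, of h "- d - 2"] by auto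
  then obtain k where k: "of_int (- d) = (- of_nat k :: 'a)" "(br e ^^ k) w \<noteq> 0"
    using sl2_weight_flip[OF t hw _ w(3)] by auto
  have dk: "d = int k"
  proof -
    have "of_int d = (of_int (int k) :: 'a)" using k(1) by simp
    then show ?thesis by (simp only: of_int_eq_iff)
  qed
  have "br h ((br e ^^ k) w) = of_int d *s (br e ^^ k) w"
    using weight_funpow[OF he hw, of k] dk by simp
  moreover have "(br e ^^ k) w \<in> q"
    by (induction k) (use w(1) q in \<open>auto simp: sub_alg_def\<close>)
  ultimately have "grade (*s) br q h d \<noteq> {0}"
    using k(2) grade_nonzero_iff[OF sq] by (auto simp: grade_iff)
  moreover have "j \<le> d" if "grade (*s) br q h j \<noteq> {0}" for j
    using that D(3)[of j] grade_nonzero_iff[OF sq, of h j] grade_nonzero_iff[OF subspace_UNIV, of h j]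
    by (auto simp: grade_iff)
  ultimately have "depth (*s) br q h = d"
    unfolding depth_def by (intro Greatest_equality) auto
  then show ?thesis by (simp add: d_def)
qed

section \<open>Reducing subalgebras\<close>

text \<open>\<open>diag_on\<close> refers to semisimple parts on the whole space, which may differ;
  the description by eigenvectors in \<open>Q\<close> sees only the restrictions.\<close>

lemma diag_on_cong:
  assumes "endo S" "endo T" "subspace Q" "\<And>v. v \<in> Q \<Longrightarrow> S v \<in> Q" "\<And>v. v \<in> Q \<Longrightarrow> S v = T v"
    and "diag_on Q S"
  shows "diag_on Q T"
proof -
  have "Q \<subseteq> span {y \<in> Q. \<exists>c. S y = c *s y}" using assms diag_on_span by blast
  also have "{y \<in> Q. \<exists>c. S y = c *s y} = {y \<in> Q. \<exists>c. T y = c *s y}" using assms(5) by auto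
  finally show ?thesis using assms by (subst diag_on_span) auto
qed

text \<open>Taking the \<open>Q\<close>-component is a homomorphism on the normalizer of
  \<open>Q\<close>: the defect \<open>br a b - c\<close> lies in \<open>Q\<close> and commutes with
  \<open>Q\<close>, so it is zero.\<close>

lemma split_br:
  assumes ss: "semisimple_lie (*s) br Q" and Q: "a \<in> Q" "b \<in> Q" "c \<in> Q"
    and z: "\<And>y. y \<in> Q \<Longrightarrow> br (x - a) y = 0" "\<And>y. y \<in> Q \<Longrightarrow> br (u - b) y = 0"
      "\<And>y. y \<in> Q \<Longrightarrow> br (w - c) y = 0"
    and xu: "br x u = w"
  shows "br a b = c"
proof -
  have sQ: "subspace Q" "\<And>x y. x \<in> Q \<Longrightarrow> y \<in> Q \<Longrightarrow> br x y \<in> Q"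
    using semisimple_sub_alg[OF ss] by (auto simp: sub_alg_def)
  have "br (br a b - c) y = 0" if y: "y \<in> Q" for y
  proof -
    have "br (u - b) a = 0" using z(2) Q(1) .
    then have "br a (u - b) = 0" using br_skew[of a "u - b"] by simp
    then have 1: "br a b = br a u" by (simp add: br_diff_right)
    have "br (br (x - a) u) y = br (x - a) (br u y) - br u (br (x - a) y)"
      using jacobi[of "x - a" u y] by simp
    moreover have "br u y = br b y" using z(2)[OF y] by (simp add: br_diff_left)
    ultimately have "br (br (x - a) u) y = 0" using z(1) sQ(2)[OF Q(2) y] z(1)[OF y] by simp
    then have "br (br a u) y = br (br x u) y" by (simp add: br_diff_left)
    also have "\<dots> = br c y" using z(3)[OF y] xu by (simp add: br_diff_left)
    finally show ?thesis by (simp add: 1 br_diff_left)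
  qed
  then have "br a b - c = 0"
    using semisimple_center[OF ss] sQ Q by (meson subspace_diff)
  then show ?thesis by simp
qed

lemma split_trip:
  assumes ss: "semisimple_lie (*s) br Q" and t: "trip e h f"
    and st: "\<And>y. y \<in> Q \<Longrightarrow> br e y \<in> Q" "\<And>y. y \<in> Q \<Longrightarrow> br h y \<in> Q" "\<And>y. y \<in> Q \<Longrightarrow> br f y \<in> Q"
  obtains e' h' f' where "e' \<in> Q" "h' \<in> Q" "f' \<in> Q" "trip e' h' f'"
    "\<And>y. y \<in> Q \<Longrightarrow> br (e - e') y = 0" "\<And>y. y \<in> Q \<Longrightarrow> br (h - h') y = 0"
    "\<And>y. y \<in> Q \<Longrightarrow> br (f - f') y = 0"
proof -
  have sQ: "subspace Q" using semisimple_sub_alg[OF ss] by (auto simp: sub_alg_def)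
  obtain e' where e': "e' \<in> Q" "\<And>y. y \<in> Q \<Longrightarrow> br (e - e') y = 0"
    using semisimple_split[OF ss st(1)] by metis
  obtain h' where h': "h' \<in> Q" "\<And>y. y \<in> Q \<Longrightarrow> br (h - h') y = 0"
    using semisimple_split[OF ss st(2)] by metis
  obtain f' where f': "f' \<in> Q" "\<And>y. y \<in> Q \<Longrightarrow> br (f - f') y = 0"
    using semisimple_split[OF ss st(3)] by metis
  have sc: "br (c *s x - c *s x') y = 0" if "br (x - x') y = 0" for c x x' y
    using that by (simp add: scale_right_diff_distrib[symmetric] br_scale_left)
  have "br h' e' = 2 *s e'"
    by (rule split_br[OF ss h'(1) e'(1) subspace_scale[OF sQ e'(1)] h'(2) e'(2) sc[OF e'(2)]])
       (use t in \<open>simp_all add: trip_def\<close>)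
  moreover have "br h' f' = (-2) *s f'"
    by (rule split_br[OF ss h'(1) f'(1) subspace_scale[OF sQ f'(1)] h'(2) f'(2) sc[OF f'(2)]])
       (use t in \<open>simp_all add: trip_def\<close>)
  moreover have "br e' f' = h'"
    by (rule split_br[OF ss e'(1) f'(1) h'(1) e'(2) f'(2) h'(2)])
       (use t in \<open>simp_all add: trip_def\<close>)
  ultimately have "trip e' h' f'" by (simp add: trip_def)
  then show ?thesis using that e' h' f' by metis
qed

text \<open>Once \<open>e\<close> is in \<open>Q\<close> it is its own component, and
  \<open>f - f'\<close> commutes with \<open>e\<close>. Hence \<open>[e, f'] = [e, f] = h\<close>,
  which puts \<open>h\<close> into \<open>Q\<close>.\<close>

lemma triple_in_subalgebra:
  assumes ss: "semisimple_lie (*s) br Q" and t: "trip e h f" and e: "e \<in> Q"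
    and st: "\<And>y. y \<in> Q \<Longrightarrow> br h y \<in> Q" "\<And>y. y \<in> Q \<Longrightarrow> br f y \<in> Q"
  obtains f' where "h \<in> Q" "f' \<in> Q" "trip e h f'"
proof -
  have sQ: "subspace Q" "\<And>x y. x \<in> Q \<Longrightarrow> y \<in> Q \<Longrightarrow> br x y \<in> Q"
    using semisimple_sub_alg[OF ss] by (auto simp: sub_alg_def)
  obtain e' h' f' where s: "e' \<in> Q" "h' \<in> Q" "f' \<in> Q" "trip e' h' f'"
    "\<And>y. y \<in> Q \<Longrightarrow> br (e - e') y = 0" "\<And>y. y \<in> Q \<Longrightarrow> br (f - f') y = 0"
    using split_trip[OF ss t sQ(2)[OF e] st] by metis
  have "e - e' = 0"
    by (rule semisimple_center[OF ss subspace_diff[OF sQ(1) e s(1)] s(5)])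
  then have e': "e' = e" by simp
  have "br (f - f') e = 0" by (rule s(6)[OF e])
  then have "br e (f - f') = 0" using br_skew[of e "f - f'"] by simp
  then have "br e f' = h" using t by (simp add: br_diff_right trip_def)
  then have "h' = h" using s(4) e' by (simp add: trip_def)
  then show ?thesis using s that e' by simp
qed

lemma reducing_iff:
  "reducing (*s) br e h f q \<longleftrightarrow> semisimple_lie (*s) br q
    \<and> (\<forall>y\<in>q. br e y \<in> q \<and> br h y \<in> q \<and> br f y \<in> q)
    \<and> zdense_in (*s) (grade (*s) br UNIV h (- depth (*s) br UNIV h))
        {\<phi> y | \<phi> y. \<phi> \<in> centralizer_triple (*s) br UNIV e h f
          \<and> y \<in> q \<inter> grade (*s) br UNIV h (- depth (*s) br UNIV h)}"
  by (auto simp: reducing_def Let_def)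

lemma reducing_semisimple_type:
  assumes ss: "semisimple_lie (*s) br UNIV" and e0: "e \<noteq> 0"
    and triple: "sl2_triple (*s) br UNIV e h f"
    and d_even: "even (depth (*s) br UNIV h)"
    and red: "reducing (*s) br e h f q"
  shows "ss_type (*s) br UNIV e \<longleftrightarrow> e \<in> q \<and> ss_type (*s) br q e"
proof -
  have t: "trip e h f" using triple by (simp add: sl2_triple_iff)
  define d where "d = depth (*s) br UNIV h"
  define V where "V = grade (*s) br UNIV h (- d)"
  define Z where "Z = centralizer_triple (*s) br UNIV e h f"
  define X where "X = {\<phi> y | \<phi> y. \<phi> \<in> Z \<and> y \<in> q \<inter> V}"
  have ssq: "semisimple_lie (*s) br q"
    and st: "\<And>y. y \<in> q \<Longrightarrow> br e y \<in> q" "\<And>y. y \<in> q \<Longrightarrow> br h y \<in> q" "\<And>y. y \<in> q \<Longrightarrow> br f y \<in> q"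
    and dense: "zdense_in (*s) V X"
    using red by (auto simp: reducing_iff V_def d_def X_def Z_def)
  have saq: "sub_alg q" by (rule semisimple_sub_alg[OF ssq])
  then have q: "subspace q" "\<And>x y. x \<in> q \<Longrightarrow> y \<in> q \<Longrightarrow> br x y \<in> q"
    by (auto simp: sub_alg_def)
  have saU: "sub_alg UNIV" by (simp add: sub_alg_def subspace_UNIV)
  note D = depth_props[OF t e0, folded d_def]
  define n where "n = nat d"
  have dn: "d = int n" using D(1) by (simp add: n_def)
  have n: "even n" "n > 0" using d_even D(1) dn by (auto simp: d_def[symmetric])
  have V: "v \<in> V \<longleftrightarrow> br h v = (- of_nat n) *s v" for v
    by (simp add: V_def grade_iff dn)
  have sV: "subspace V" unfolding V_def by (rule grade_subspace[OF subspace_UNIV])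
  have sqV: "subspace (q \<inter> V)" by (rule subspace_inter[OF q(1) sV])
  have Z: "autom \<phi>" "\<phi> e = e" "\<phi> h = h" if "\<phi> \<in> Z" for \<phi>
    using that autom_adj_group by (auto simp: Z_def centralizer_triple_def)
  have ZV: "\<phi> v \<in> V" if "\<phi> \<in> Z" "v \<in> V" for \<phi> v
    using autom_br[OF Z(1)[OF that(1)], of h v] that(2) Z(3)[OF that(1)]
    by (simp add: V endo_minus[OF autom_endo[OF Z(1)[OF that(1)]]]
        endo_scale[OF autom_endo[OF Z(1)[OF that(1)]]])
  have surjU: "\<phi> ` UNIV = UNIV" if "\<phi> \<in> Z" for \<phi> using autom_surj[OF Z(1)[OF that]] by simp
  have pull: "ad_semisimple (*s) br UNIV (e + y)" if "\<phi> \<in> Z" "ad_semisimple (*s) br UNIV (e + \<phi> y)" for \<phi> y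
  proof -
    note a = Z(1)[OF that(1)]
    have i: "autom (inv_into UNIV \<phi>)" by (rule autom_inv[OF a])
    have "inv_into UNIV \<phi> ` UNIV = UNIV" using autom_surj[OF i] by simp
    from ad_semisimple_autom[OF i this that(2)]
    have "ad_semisimple (*s) br UNIV (inv_into UNIV \<phi> (\<phi> (e + y)))"
      by (simp add: endo_add[OF autom_endo[OF a]] Z(2)[OF that(1)])
    then show ?thesis by (simp only: inv_f_f[OF autom_inj[OF a]])
  qed
  \<comment> \<open>Otherwise \<open>X\<close> would contain no nonzero vector, and the coordinate
    functions, vanishing on this dense set, would force \<open>V\<close> to be zero. The nonzero
    vector found here is what makes the depth in \<open>q\<close> equal to \<open>d\<close>.\<close>
  have ne: "\<exists>w. w \<in> q \<inter> V \<and> w \<noteq> 0"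
  proof (rule ccontr)
    assume "\<not> ?thesis"
    then have X0: "x = 0" if "x \<in> X" for x
      using that endo_0[OF autom_endo[OF Z(1)]] by (auto simp: X_def)
    have "v = 0" if v: "v \<in> V" for v
    proof -
      note R = basis_rep[OF Basis_is_basis]
      have "representation Basis v b = 0" for b
      proof (rule poly_fun_zero_on_dense[OF dense _ _ v, where p = "\<lambda>v. representation Basis v b"])
        show "(\<lambda>v. representation Basis v b) \<in> poly_fun (*s)"
          by (rule poly_fun.pf_lin) (simp_all add: R)
        show "representation Basis x b = 0" if "x \<in> X" for x
          unfolding X0[OF that] by (rule R(4))
      qed
      then show ?thesis using basis_sum[OF Basis_is_basis, of v] by simp
    qed
    then show False using D(2) subspace_0[OF sV] by (auto simp: V_def)
  qed
  have depth_q: "depth (*s) br q h = d" if "e \<in> q"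
    using depth_subalgebra[OF t e0 saq that] ne by (auto simp: V_def d_def)
  have gq: "grade (*s) br q h (- d) = q \<inter> V" by (auto simp: V_def grade_iff)
  show ?thesis
  proof
    assume "ss_type (*s) br UNIV e"
    then obtain h1 f1 where t1: "trip e h1 f1" and s1: "ss_type_wrt (*s) br UNIV e h1 f1"
      by (auto simp: ss_type_def sl2_triple_iff)
    obtain \<phi>1 where \<phi>1: "autom \<phi>1" "\<phi>1 ` UNIV = UNIV" "\<phi>1 e = e" "\<phi>1 h1 = h"
      using triple_conjugate[OF t t1 subspace_UNIV] by (metis UNIV_I)
    have "ss_type_wrt (*s) br UNIV e h f" by (rule ss_type_wrt_autom[OF \<phi>1 s1])
    then obtain U where U: "U \<noteq> {}" "zopen_in (*s) V U"
      "\<And>F. F \<in> U \<Longrightarrow> ad_semisimple (*s) br UNIV (e + F)"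
      by (auto simp: ss_type_wrt_def Let_def V_def d_def)
    have UV: "U \<subseteq> V" and cl: "zclosed_in (*s) V (V - U)" using U(2) by (auto simp: zopen_in_def)
    have "X \<subseteq> V" using dense by (simp add: zdense_in_def)
    \<comment> \<open>Density makes \<open>X\<close> meet the open set \<open>U\<close>. Pulling
      back by \<open>\<phi>\<close>, which fixes \<open>e\<close>, yields a semisimple cyclic
      element \<open>e + y\<close> with \<open>y\<close> in \<open>q\<close>.\<close>
    have "\<not> X \<subseteq> V - U" using dense cl U(1) UV unfolding zdense_in_def by blast
    then obtain x where "x \<in> X" "x \<in> U" using \<open>X \<subseteq> V\<close> by blast
    then obtain \<phi> y where y: "\<phi> \<in> Z" "y \<in> q" "y \<in> V" "\<phi> y \<in> U"
      unfolding X_def by blast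
    have diag: "diag_on UNIV (br (e + y))"
      using pull[OF y(1) U(3)[OF y(4)]] by (simp add: ad_semisimple_iff[OF saU])
    obtain e' h' f' where s: "e' \<in> q" "h' \<in> q" "f' \<in> q" "trip e' h' f'"
      "\<And>y. y \<in> q \<Longrightarrow> br (e - e') y = 0" "\<And>y. y \<in> q \<Longrightarrow> br (h - h') y = 0"
      using split_trip[OF ssq t st] by metis
    have ey: "e' + y \<in> q" by (rule subspace_add[OF q(1) s(1) y(2)])
    have "diag_on q (br (e' + y))"
    proof (rule diag_on_cong[OF ad_endo ad_endo q(1)])
      show "br (e + y) v \<in> q" if "v \<in> q" for v
        unfolding br_add_left by (rule subspace_add[OF q(1) st(1)[OF that] q(2)[OF y(2) that]])
      show "br (e + y) v = br (e' + y) v" if "v \<in> q" for v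
        using s(5)[OF that] by (simp add: br_add_left br_diff_left)
      show "diag_on q (br (e + y))" by (rule diag_on_subset[OF diag]) simp
    qed
    \<comment> \<open>Since \<open>h - h'\<close> commutes with \<open>q\<close>, the vector
      \<open>y\<close> has the same weight for \<open>h'\<close>, and the extension criterion
      applies to the component triple.\<close>
    moreover have "br h' y = (- of_nat n) *s y"
      using s(6)[OF y(2)] y(3) by (simp add: V br_diff_left)
    ultimately have diag': "diag_on UNIV (br (e' + y))"
      using cyclic_diag_extends[OF s(4) q s(2) _ n] by blast
    \<comment> \<open>\<open>e - e'\<close> has weight 2 for \<open>h\<close>, because
      \<open>h\<close> and \<open>h'\<close> act alike on \<open>e'\<close>; this makes it
      ad-nilpotent.\<close>
    have hE: "br h (e - e') = 2 *s (e - e')"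
    proof -
      have "br h e' = br h' e'" using s(6)[OF s(1)] by (simp add: br_diff_left)
      then show ?thesis using t s(4) by (simp add: trip_def br_diff_right scale_right_diff_distrib)
    qed
    obtain N where N: "\<And>u. (br (e - e') ^^ N) u = 0" using ad_nilpotentI[OF hE] by auto
    have diff: "br (e + y) v - br (e' + y) v = br (e - e') v" for v
      by (simp add: br_add_left br_diff_left)
    have "br (e + y) v = br (e' + y) v" for v
    proof (rule commuting_diag_diff_nilpotent[OF ad_endo ad_endo _ diag diag'])
      fix v
      \<comment> \<open>The two elements differ by \<open>e - e'\<close>, which commutes with
        \<open>q\<close> and so with \<open>e' + y\<close>.\<close>
      have "br (e + y) (e' + y) = br (e - e') (e' + y) + br (e' + y) (e' + y)"
        by (simp add: br_add_left br_diff_left)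
      then have "br (e + y) (e' + y) = 0" using s(5)[OF ey] by (simp add: br_self)
      then show "br (e + y) (br (e' + y) v) = br (e' + y) (br (e + y) v)"
        using jacobi[of "e + y" "e' + y" v] by simp
      show "\<exists>n. ((\<lambda>v. br (e + y) v - br (e' + y) v) ^^ n) v = 0"
        unfolding diff using N by blast
    qed
    then have "br (e - e') v = 0" for v using diff[of v] by simp
    then have "e - e' = 0" by (rule semisimple_center[OF ss UNIV_I])
    then have eq: "e \<in> q" using s(1) by simp
    obtain f'' where f'': "h \<in> q" "f'' \<in> q" "trip e h f''"
      using triple_in_subalgebra[OF ssq t eq st(2,3)] .
    \<comment> \<open>The preimage of \<open>U\<close> under the same \<open>\<phi>\<close> is open
      in \<open>q \<inter> V\<close>, and \<open>y\<close> shows that it is nonempty.\<close>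
    let ?U = "{F \<in> q \<inter> V. \<phi> F \<in> U}"
    have "zopen_in (*s) (q \<inter> V) ?U"
    proof -
      obtain P where P: "P \<subseteq> poly_fun (*s)" "V - U = {w \<in> V. \<forall>p\<in>P. p w = 0}"
        using cl by (auto simp: zclosed_in_def)
      let ?P = "(\<lambda>p x. p (\<phi> x)) ` P"
      have "?P \<subseteq> poly_fun (*s)"
        using P(1) poly_fun_comp[OF _ autom_endo[OF Z(1)[OF y(1)]]] by blast
      moreover have "q \<inter> V - ?U = {w \<in> q \<inter> V. \<forall>p\<in>?P. p w = 0}"
      proof -
        have "\<phi> w \<notin> U \<longleftrightarrow> (\<forall>p\<in>P. p (\<phi> w) = 0)" if "w \<in> V" for w
          using P(2) ZV[OF y(1) that] by blast
        then show ?thesis by auto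
      qed
      ultimately show ?thesis unfolding zopen_in_def zclosed_in_def by blast
    qed
    moreover have "ad_semisimple (*s) br q (e + F)" if "F \<in> ?U" for F
    proof -
      have "diag_on UNIV (br (e + F))"
        using pull[OF y(1) U(3)] that by (simp add: ad_semisimple_iff[OF saU])
      then show ?thesis
        using that subspace_add[OF q(1) eq] diag_on_subset[of UNIV "br (e + F)" q]
        by (simp add: ad_semisimple_iff[OF saq])
    qed
    moreover have "?U \<noteq> {}" using y by blast
    ultimately have "ss_type_wrt (*s) br q e h f''"
      unfolding ss_type_wrt_def Let_def depth_q[OF eq] gq by (intro exI[of _ ?U] conjI ballI)
    then show "e \<in> q \<and> ss_type (*s) br q e"
      unfolding ss_type_def sl2_triple_iff using eq f'' by blast
  next
    assume "e \<in> q \<and> ss_type (*s) br q e"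
    then obtain h1 f1 where eq: "e \<in> q" and h1: "h1 \<in> q" and t1: "trip e h1 f1"
      and s1: "ss_type_wrt (*s) br q e h1 f1"
      by (auto simp: ss_type_def sl2_triple_iff)
    obtain f'' where f'': "h \<in> q" "f'' \<in> q" "trip e h f''"
      using triple_in_subalgebra[OF ssq t eq st(2,3)] .
    obtain \<phi>1 where \<phi>1: "autom \<phi>1" "\<phi>1 ` q = q" "\<phi>1 e = e" "\<phi>1 h1 = h"
      using triple_conjugate[OF t t1 q f''(1) h1] .
    have "ss_type_wrt (*s) br q e h f" by (rule ss_type_wrt_autom[OF \<phi>1 s1])
    then obtain U where U: "U \<noteq> {}" "zopen_in (*s) (q \<inter> V) U"
      "\<And>F. F \<in> U \<Longrightarrow> ad_semisimple (*s) br q (e + F)"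
      unfolding ss_type_wrt_def Let_def depth_q[OF eq] gq by blast
    have UV: "U \<subseteq> q \<inter> V" using U(2) by (simp add: zopen_in_def)
    have diagU: "ad_semisimple (*s) br UNIV (e + F)" if "F \<in> U" for F
    proof -
      have "diag_on q (br (e + F))" using U(3)[OF that] by (simp add: ad_semisimple_iff[OF saq])
      moreover have "br h F = (- of_nat n) *s F" using UV that V by blast
      ultimately have "diag_on UNIV (br (e + F))"
        using cyclic_diag_extends[OF t q f''(1) _ n] by blast
      then show ?thesis by (simp add: ad_semisimple_iff[OF saU])
    qed
    define D where "D = {\<phi> F | \<phi> F. \<phi> \<in> Z \<and> F \<in> U}"
    have "id \<in> Z" by (simp add: Z_def centralizer_triple_def adj_group.ag_id)
    then have D1: "D \<noteq> {}" using U(1) by (auto simp: D_def)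
    have D2: "D \<subseteq> V" using UV ZV by (auto simp: D_def)
    have D3: "diag_on UNIV (br (e + G))" if "G \<in> D" for G
    proof -
      obtain \<phi> F where F: "\<phi> \<in> Z" "F \<in> U" "G = \<phi> F" using \<open>G \<in> D\<close> by (auto simp: D_def)
      have "ad_semisimple (*s) br UNIV (\<phi> (e + F))"
        by (rule ad_semisimple_autom[OF Z(1)[OF F(1)] surjU[OF F(1)] diagU[OF F(2)]])
      then show ?thesis
        by (simp add: F(3) endo_add[OF autom_endo[OF Z(1)[OF F(1)]]] Z(2)[OF F(1)] ad_semisimple_iff[OF saU])
    qed
    \<comment> \<open>Density of \<open>D\<close> in two stages: for each \<open>\<phi>\<close>, the
      pullback of \<open>p\<close> vanishes on the nonempty open \<open>U\<close>, hence on the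
      irreducible space \<open>q \<inter> V\<close>. So \<open>p\<close> vanishes on
      \<open>X\<close>, which is dense in \<open>V\<close>.\<close>
    have D4: "p F = 0" if p: "p \<in> poly_fun (*s)" "\<And>F. F \<in> D \<Longrightarrow> p F = 0" and F: "F \<in> V" for p F
    proof (rule poly_fun_zero_on_dense[OF dense p(1) _ F])
      fix x assume "x \<in> X"
      then obtain \<phi> y where y: "\<phi> \<in> Z" "y \<in> q \<inter> V" "x = \<phi> y" by (auto simp: X_def)
      have "(\<lambda>v. p (\<phi> v)) y = 0"
      proof (rule poly_fun_zero_on_open[OF sqV U(2,1) _ _ y(2), where p = "\<lambda>v. p (\<phi> v)"])
        show "(\<lambda>v. p (\<phi> v)) \<in> poly_fun (*s)"
          by (rule poly_fun_comp[OF p(1) autom_endo[OF Z(1)[OF y(1)]]])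
        show "p (\<phi> u) = 0" if "u \<in> U" for u using p(2) y(1) that by (auto simp: D_def)
      qed
      then show "p x = 0" by (simp add: y(3))
    qed
    have "\<exists>P\<in>poly_fun (*s). (\<exists>F\<in>V. P F \<noteq> 0)
        \<and> (\<forall>F\<in>V. P F \<noteq> 0 \<longrightarrow> diag_on UNIV (br (e + F)))"
      by (rule diag_generic[OF D1 D2], erule D3) (rule D4)
    then obtain P where P: "P \<in> poly_fun (*s)" "\<exists>F\<in>V. P F \<noteq> 0"
      "\<And>F. F \<in> V \<Longrightarrow> P F \<noteq> 0 \<Longrightarrow> diag_on UNIV (br (e + F))"
      by blast
    let ?U = "{F \<in> V. P F \<noteq> 0}"
    have "zopen_in (*s) V ?U"
      unfolding zopen_in_def zclosed_in_def using P(1) by (auto intro!: exI[of _ "{P}"])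
    moreover have "?U \<noteq> {}" using P(2) by blast
    moreover have "ad_semisimple (*s) br UNIV (e + F)" if "F \<in> ?U" for F
      using P(3) that by (simp add: ad_semisimple_iff[OF saU])
    ultimately have "ss_type_wrt (*s) br UNIV e h f"
      unfolding ss_type_wrt_def Let_def d_def[symmetric] V_def[symmetric]
      by (intro exI[of _ ?U] conjI ballI)
    then show "ss_type (*s) br UNIV e" unfolding ss_type_def using triple by blast
  qed
qed

end

section \<open>Choice of a basis and passage to the stated theorem\<close>

lemma fin_dim_basis:
  assumes "vector_space smul" "fin_dim smul"
  obtains B where "finite_dimensional_vector_space smul B"
proof -
  interpret vector_space smul by fact
  obtain S where S: "finite S" "lin_span smul S = UNIV" using assms(2) by (auto simp: fin_dim_def)
  have "lin_span smul S = span S" unfolding lin_span_def span_explicit by auto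
  then have "span S = UNIV" using S(2) by simp
  obtain B where B: "B \<subseteq> S" "independent B" "S \<subseteq> span B" by (rule maximal_independent_subset)
  have "span B = UNIV" using \<open>span S = UNIV\<close> B(3) span_minimal[OF B(3) subspace_span] by auto
  then have "finite_dimensional_vector_space smul B"
    using B finite_subset[OF B(1) S(1)] by unfold_locales auto
  then show ?thesis by (rule that)
qed

theorem theorem3p4:
  fixes smul :: "'a::field_char_0 \<Rightarrow> 'v::ab_group_add \<Rightarrow> 'v"
    and br :: "'v \<Rightarrow> 'v \<Rightarrow> 'v"
    and e h f :: 'v and q :: "'v set"
  assumes alg_closed: "\<And>p :: 'a poly. degree p > 0 \<Longrightarrow> \<exists>x. poly p x = 0"
    and lie: "lie_alg smul br"
    and fd: "fin_dim smul"
    and ss: "semisimple_lie smul br UNIV"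
    and e_nz: "e \<noteq> 0"
    and e_nil: "ad_nilpotent br UNIV e"
    and triple: "sl2_triple smul br UNIV e h f"
    and d_even: "even (depth smul br UNIV h)"
    and red: "reducing smul br e h f q"
  shows "ss_type smul br UNIV e \<longleftrightarrow> (e \<in> q \<and> ss_type smul br q e)"
proof -
  have "vector_space smul" using lie by (simp add: lie_alg_def)
  then obtain B where B: "finite_dimensional_vector_space smul B" using fd by (rule fin_dim_basis)
  interpret lie_vs smul B br
    by (intro lie_vs.intro fd_vs.intro B fd_vs_axioms.intro lie_vs_axioms.intro alg_closed lie)
  show ?thesis by (rule reducing_semisimple_type[OF ss e_nz triple d_even red])
qed

end
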